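(* Let $s>3/2$. For any $u_0\in H^s(S^1)$ there exist $T>0$ and a unique solution $$u\in C\big((-T,T),H^s(S^1)\big)\cap C^1\big((-T,T),H^{s-1}(S^1)\big)$$ of the Cauchy problem $$u_t+uu_x+3\mu(u)\,\partial_x\Lambda_\mu^{-2}u=0,\qquad u(0)=u_0,$$ and this solution depends continuously on the initial data $u_0$. Furthermore, the solution persists as long as $\|u(t,\cdot)\|_{C^1}$ stays bounded.
   Context: $S^1=\mathbb{R}/\mathbb{Z}\simeq[0,1)$, $\mu(v)=\int_0^1 v\,dx$, and $H^s(S^1)$ is the Sobolev space of periodic functions $v=\sum_n\hat v(n)e^{2\pi inx}$ with $\sum_n(1+4\pi^2n^2)^s|\hat v(n)|^2<\infty$. The operator $\Lambda_\mu^2:H^s(S^1)\to H^{s-2}(S^1)$, $\Lambda_\mu^2v=\mu(v)-v_{xx}$, is invertible with inverse $\Lambda_\mu^{-2}$. Applying $\Lambda_\mu^2$ to the equation gives the $\mu$DP equation $\mu(u_t)-u_{txx}+3\mu(u)u_x-3u_xu_{xx}-uu_{xxx}=0$. *)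

theory Defs
  imports "HOL-Analysis.Analysis"
begin

text \<open>Periodic real functions on S^1 = R/Z are represented by their Fourier
coefficient sequences v :: int => complex (v(x) = sum_n v n * exp(2 pi i n x)),
with conjugate symmetry v(-n) = cnj(v n) expressing real-valuedness.\<close>

definition Hs_weight :: "real \<Rightarrow> int \<Rightarrow> real" where
  "Hs_weight s n = (1 + 4 * pi^2 * (real_of_int n)^2) powr s"

definition in_Hs :: "real \<Rightarrow> (int \<Rightarrow> complex) \<Rightarrow> bool" where
  "in_Hs s v \<longleftrightarrow> (\<forall>n. v (-n) = cnj (v n)) \<and>
     (\<lambda>n. Hs_weight s n * (cmod (v n))^2) summable_on UNIV"

definition Hs_norm :: "real \<Rightarrow> (int \<Rightarrow> complex) \<Rightarrow> real" where
  "Hs_norm s v = sqrt (\<Sum>\<^sub>\<infinity>n. Hs_weight s n * (cmod (v n))^2)"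

definition Hs_dist :: "real \<Rightarrow> (int \<Rightarrow> complex) \<Rightarrow> (int \<Rightarrow> complex) \<Rightarrow> real" where
  "Hs_dist s v w = Hs_norm s (\<lambda>n. v n - w n)"

text \<open>mu(v) = integral of v over [0,1) = zeroth Fourier coefficient.\<close>
definition mu :: "(int \<Rightarrow> complex) \<Rightarrow> real" where
  "mu v = Re (v 0)"

definition dx :: "(int \<Rightarrow> complex) \<Rightarrow> (int \<Rightarrow> complex)" where
  "dx v = (\<lambda>n. 2 * of_real pi * \<i> * of_int n * v n)"

text \<open>Lambda_mu^2 v = mu(v) - v_xx has symbol 1 at n = 0 and 4 pi^2 n^2 at n /= 0.\<close>
definition Lambda_mu_inv2 :: "(int \<Rightarrow> complex) \<Rightarrow> (int \<Rightarrow> complex)" where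
  "Lambda_mu_inv2 v = (\<lambda>n. if n = 0 then v 0 else v n / of_real (4 * pi^2 * (real_of_int n)^2))"

text \<open>Fourier coefficients of a pointwise product: convolution of coefficients.\<close>
definition conv :: "(int \<Rightarrow> complex) \<Rightarrow> (int \<Rightarrow> complex) \<Rightarrow> (int \<Rightarrow> complex)" where
  "conv v w = (\<lambda>n. \<Sum>\<^sub>\<infinity>k. v k * w (n - k))"

definition mudp_rhs :: "(int \<Rightarrow> complex) \<Rightarrow> (int \<Rightarrow> complex)" where
  "mudp_rhs u = (\<lambda>n. - conv u (dx u) n - 3 * of_real (mu u) * dx (Lambda_mu_inv2 u) n)"

definition cont_Hs :: "real \<Rightarrow> real set \<Rightarrow> (real \<Rightarrow> int \<Rightarrow> complex) \<Rightarrow> bool" where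
  "cont_Hs s I u \<longleftrightarrow> (\<forall>t\<in>I. in_Hs s (u t)) \<and>
     (\<forall>t\<in>I. ((\<lambda>\<tau>. Hs_dist s (u \<tau>) (u t)) \<longlongrightarrow> 0) (at t within I))"

definition has_Hs_deriv :: "real \<Rightarrow> (real \<Rightarrow> int \<Rightarrow> complex) \<Rightarrow> (int \<Rightarrow> complex) \<Rightarrow> real \<Rightarrow> real set \<Rightarrow> bool" where
  "has_Hs_deriv s u u' t I \<longleftrightarrow>
     ((\<lambda>\<tau>. Hs_norm s (\<lambda>n. (u \<tau> n - u t n) / of_real (\<tau> - t) - u' n)) \<longlongrightarrow> 0) (at t within I)"

definition is_solution :: "real \<Rightarrow> real \<Rightarrow> (real \<Rightarrow> int \<Rightarrow> complex) \<Rightarrow> bool" where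
  "is_solution s T u \<longleftrightarrow> cont_Hs s {-T<..<T} u \<and>
     (\<exists>u'. cont_Hs (s - 1) {-T<..<T} u' \<and>
        (\<forall>t\<in>{-T<..<T}. has_Hs_deriv (s - 1) u (u' t) t {-T<..<T} \<and> u' t = mudp_rhs (u t)))"

definition fourier_eval :: "(int \<Rightarrow> complex) \<Rightarrow> real \<Rightarrow> complex" where
  "fourier_eval v x = (\<Sum>\<^sub>\<infinity>n. v n * exp (2 * of_real pi * \<i> * of_int n * of_real x))"

definition C1_bounded :: "real \<Rightarrow> (real \<Rightarrow> int \<Rightarrow> complex) \<Rightarrow> bool" where
  "C1_bounded T u \<longleftrightarrow> (\<exists>M. \<forall>t\<in>{-T<..<T}. \<forall>x.
      cmod (fourier_eval (u t) x) + cmod (fourier_eval (dx (u t)) x) \<le> M)"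

end

theory Submission
  imports Defs "HOL-Probability.Discrete_Topology"
begin

text \<open>
  Every quantity is estimated on Galerkin truncations to the modes \<open>\<bar>n\<bar> \<le> N\<close>, where all energies are
  finite sums and the nonlocal term is skew. For a slowly varying weight \<open>\<omega>\<close> a commutator estimate gives
  \<open>\<bar>d/dt \<Sum> \<omega>\<^sup>2 \<bar>u\<bar>\<^sup>2\<bar> \<le> C \<parallel>u\<^sub>x\<parallel> \<Sum> \<omega>\<^sup>2 \<bar>u\<bar>\<^sup>2\<close> with the Wiener norm of \<open>u\<^sub>x\<close>. Weights that damp the low
  frequencies satisfy it uniformly, so the high-frequency tails of a solution are controlled by those of its
  datum; combined with an \<open>L\<^sup>2\<close> estimate for differences this yields convergence of the Galerkin scheme and
  continuous dependence in the full \<open>H\<^sup>s\<close> norm.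

  For persistence, a two-point functional \<open>\<integral>\<integral> K(x - y) (u\<^sub>x(x) - u\<^sub>x(y))\<^sup>2\<close> with
  \<open>K(h) = (\<delta>\<^sup>2 + sin\<^sup>2 \<pi>h)\<^sup>-\<^sup>2\<close> grows at a rate depending only on \<open>sup \<bar>u\<^sub>x\<bar>\<close>, uniformly in \<open>\<delta>\<close>. This
  bounds \<open>u\<^sub>x\<close> in a Besov space of order greater than \<open>1/2\<close>, hence in the Wiener algebra, and then the
  weighted energy estimate bounds the \<open>H\<^sup>s\<close> norm.
\<close>

section \<open>Weighted sequence spaces\<close>

text \<open>The obstacle is the loss of one derivative. For u in \<open>H^s\<close> the product u
  u_x is only in \<open>H^(s-1)\<close>, so weighted energies of a solution cannot be
  differentiated, and two solutions are compared in \<open>L^2\<close> only, since a higher energy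
  of z = u - v would put s derivatives on v_x. Truncation cures the first point without an error
  term: the projected equation is tested against a function living on the same modes. Damping the
  low frequencies cures the second: closeness in \<open>L^2\<close> settles finitely many modes,
  small tails settle the rest. The energy estimate needs the Wiener norm of u_x, which the supremum
  of u_x does not control. The kernel K is built for this gap. It acts like h^(-4) beyond the scale
  \<open>\<delta>\<close> and is flat below it. After multiplication by a constant times
  \<open>\<delta>\<close>^3 its quadratic form has a Fourier weight that is bounded by a multiple of
  min(1, (n \<open>\<delta>\<close>)^2) and is at least 1 for |n| >= 1 / \<open>\<delta>\<close>: a
  high-pass filter whose commutator with transport sees only sup |u_x|. Running
  \<open>\<delta>\<close> through the powers of 1/2 measures the dyadic blocks of u_x.\<close>

lemma nonneg_bounded_sums:
  fixes f :: "'a \<Rightarrow> real"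
  assumes "\<And>x. 0 \<le> f x" and "\<And>S. finite S \<Longrightarrow> sum f S \<le> B"
  shows "f summable_on UNIV" and "infsum f UNIV \<le> B"
proof -
  show "f summable_on UNIV"
    using assms by (intro nonneg_bdd_above_summable_on) (auto intro!: bdd_aboveI2)
  then show "infsum f UNIV \<le> B"
    using assms by (intro infsum_le_finite_sums) auto
qed

text \<open>The square of the Japanese bracket of 2 pi n. \<open>Hs_weight s\<close> is its s-th
  power, so one derivative corresponds to the power 1/2.\<close>

definition jap :: "int \<Rightarrow> real" where
  "jap n = 1 + 4 * pi^2 * (real_of_int n)^2"

definition modes :: "nat \<Rightarrow> int set" where
  "modes N = {- int N..int N}"

definition herm :: "(int \<Rightarrow> complex) \<Rightarrow> bool" where
  "herm v \<longleftrightarrow> (\<forall>n. v (- n) = cnj (v n))"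

definition nsq :: "real \<Rightarrow> (int \<Rightarrow> complex) \<Rightarrow> real" where
  "nsq s v = (\<Sum>\<^sub>\<infinity>n. Hs_weight s n * (cmod (v n))^2)"

text \<open>The Wiener algebra of absolutely convergent Fourier series. Its norm bounds the supremum
  of the function and turns convolution estimates into sums of nonnegative terms.\<close>

definition ell1 :: "(int \<Rightarrow> complex) \<Rightarrow> bool" where
  "ell1 a \<longleftrightarrow> (\<lambda>n. cmod (a n)) summable_on UNIV"

definition l1n :: "(int \<Rightarrow> complex) \<Rightarrow> real" where
  "l1n a = (\<Sum>\<^sub>\<infinity>n. cmod (a n))"

lemma finite_modes [simp]: "finite (modes N)"
  by (simp add: modes_def)

lemma mem_modes: "n \<in> modes N \<longleftrightarrow> \<bar>n\<bar> \<le> int N"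
  by (auto simp: modes_def)

lemma modes_mono: "N \<le> M \<Longrightarrow> modes N \<subseteq> modes M"
  by (auto simp: mem_modes)

lemma finite_subset_modes:
  assumes "finite S" obtains N where "S \<subseteq> modes N"
proof
  have "nat \<bar>n\<bar> \<le> Max ((\<lambda>n. nat \<bar>n\<bar>) ` S)" if "n \<in> S" for n
    using assms that by (intro Max_ge) auto
  then show "S \<subseteq> modes (Max ((\<lambda>n. nat \<bar>n\<bar>) ` S))"
    by (fastforce simp: mem_modes)
qed

lemma jap_ge_1: "1 \<le> jap n"
  by (simp add: jap_def)

lemma jap_pos [simp]: "0 < jap n"
  using jap_ge_1[of n] by linarith

lemma Hs_weight_jap: "Hs_weight s n = jap n powr s"
  by (simp add: Hs_weight_def jap_def)

lemma Hs_weight_pos [simp]: "0 < Hs_weight s n"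
  by (simp add: Hs_weight_jap less_imp_neq[symmetric])

lemma Hs_weight_nonneg [simp]: "0 \<le> Hs_weight s n"
  using Hs_weight_pos[of s n] by linarith

lemma Hs_weight_mono: "s \<le> t \<Longrightarrow> Hs_weight s n \<le> Hs_weight t n"
  by (simp add: Hs_weight_jap jap_ge_1 powr_mono)

lemma Hs_weight_ge_1: "0 \<le> s \<Longrightarrow> 1 \<le> Hs_weight s n"
  by (simp add: Hs_weight_jap jap_ge_1 ge_one_powr_ge_zero)

lemma Hs_weight_half_sq: "(Hs_weight (s/2) n)^2 = Hs_weight s n"
  by (simp add: Hs_weight_jap power2_eq_square powr_add[symmetric])

lemma Hs_weight_add: "Hs_weight (s + t) n = Hs_weight s n * Hs_weight t n"
  by (simp add: Hs_weight_jap powr_add)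

lemma Hs_weight_1: "Hs_weight 1 n = jap n"
  by (simp add: Hs_weight_jap abs_of_pos)

lemma in_Hs_herm: "in_Hs s v \<Longrightarrow> herm v"
  by (auto simp: in_Hs_def herm_def)

lemma in_Hs_summable: "in_Hs s v \<Longrightarrow> (\<lambda>n. Hs_weight s n * (cmod (v n))^2) summable_on UNIV"
  by (auto simp: in_Hs_def)

lemma nsq_nonneg [simp]: "0 \<le> nsq s v"
  unfolding nsq_def by (intro infsum_nonneg) auto

lemma Hs_norm_nsq: "Hs_norm s v = sqrt (nsq s v)"
  by (simp add: Hs_norm_def nsq_def)

lemma nsq_ge_sum:
  assumes "in_Hs s v" "finite S"
  shows "(\<Sum>n\<in>S. Hs_weight s n * (cmod (v n))^2) \<le> nsq s v"
  unfolding nsq_def using assms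
  by (intro finite_sum_le_infsum in_Hs_summable) auto

text \<open>The usual way into \<open>H^s\<close> below: a uniform bound on finite partial sums
  yields summability and the norm bound together.\<close>

lemma in_Hs_bounded:
  assumes "herm v" and "\<And>S. finite S \<Longrightarrow> (\<Sum>n\<in>S. Hs_weight s n * (cmod (v n))^2) \<le> B"
  shows "in_Hs s v" and "nsq s v \<le> B"
  using nonneg_bounded_sums[of "\<lambda>n. Hs_weight s n * (cmod (v n))^2" B] assms
  by (auto simp: in_Hs_def herm_def nsq_def)

lemma norm_add_sq_le: "(norm (a + b))^2 \<le> 2 * (norm a)^2 + 2 * (norm b)^2"
proof -
  have "(norm (a + b))^2 \<le> (norm a + norm b)^2"
    by (intro power_mono norm_triangle_ineq) auto
  also have "\<dots> \<le> 2 * (norm a)^2 + 2 * (norm b)^2"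
    using sum_squares_ge_zero[of "norm a - norm b" 0] by (simp add: power2_eq_square algebra_simps)
  finally show ?thesis .
qed

lemma norm_diff_sq_le: "(norm (a - b))^2 \<le> 2 * (norm a)^2 + 2 * (norm b)^2"
  using norm_add_sq_le[of a "- b"] by simp

lemma herm_diff: "herm u \<Longrightarrow> herm v \<Longrightarrow> herm (\<lambda>n. u n - v n)"
  by (simp add: herm_def)

lemma in_Hs_diff:
  assumes "in_Hs s u" "in_Hs s v"
  shows "in_Hs s (\<lambda>n. u n - v n)" and "nsq s (\<lambda>n. u n - v n) \<le> 2 * nsq s u + 2 * nsq s v"
proof -
  have *: "(\<Sum>n\<in>S. Hs_weight s n * (cmod (u n - v n))^2) \<le> 2 * nsq s u + 2 * nsq s v" if "finite S" for S
  proof -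
    have "(\<Sum>n\<in>S. Hs_weight s n * (cmod (u n - v n))^2)
        \<le> (\<Sum>n\<in>S. Hs_weight s n * (2 * (cmod (u n))^2 + 2 * (cmod (v n))^2))"
      by (intro sum_mono mult_left_mono norm_diff_sq_le) auto
    also have "\<dots> = 2 * (\<Sum>n\<in>S. Hs_weight s n * (cmod (u n))^2) + 2 * (\<Sum>n\<in>S. Hs_weight s n * (cmod (v n))^2)"
      by (simp add: sum.distrib sum_distrib_left algebra_simps)
    also have "\<dots> \<le> 2 * nsq s u + 2 * nsq s v"
      using nsq_ge_sum[OF assms(1) that] nsq_ge_sum[OF assms(2) that] by linarith
    finally show ?thesis .
  qed
  have h: "herm (\<lambda>n. u n - v n)"
    using assms by (intro herm_diff in_Hs_herm)
  show "in_Hs s (\<lambda>n. u n - v n)" "nsq s (\<lambda>n. u n - v n) \<le> 2 * nsq s u + 2 * nsq s v"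
    using in_Hs_bounded[OF h *] by auto
qed

lemma in_Hs_mono:
  assumes "in_Hs t v" "s \<le> t"
  shows "in_Hs s v" and "nsq s v \<le> nsq t v"
proof -
  have *: "(\<Sum>n\<in>S. Hs_weight s n * (cmod (v n))^2) \<le> nsq t v" if "finite S" for S
    using nsq_ge_sum[OF assms(1) that]
    by (smt (verit, best) Hs_weight_mono[OF assms(2)] mult_right_mono sum_mono zero_le_power2)
  show "in_Hs s v" "nsq s v \<le> nsq t v"
    using in_Hs_bounded[OF in_Hs_herm[OF assms(1)] *] by auto
qed

lemma nsq_zero [simp]: "nsq s (\<lambda>n. 0) = 0"
  by (simp add: nsq_def)

lemma in_Hs_uminus: "in_Hs s v \<Longrightarrow> in_Hs s (\<lambda>n. - v n)"
  by (simp add: in_Hs_def)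

lemma nsq_uminus: "nsq s (\<lambda>n. - v n) = nsq s v"
  by (simp add: nsq_def)

lemma in_Hs_add:
  assumes "in_Hs s u" "in_Hs s v"
  shows "in_Hs s (\<lambda>n. u n + v n)" and "nsq s (\<lambda>n. u n + v n) \<le> 2 * nsq s u + 2 * nsq s v"
  using in_Hs_diff[OF assms(1) in_Hs_uminus[OF assms(2)]] by (auto simp: nsq_uminus)

lemma norm_le_nsq:
  assumes "in_Hs s v" "0 \<le> s" shows "(cmod (v n))^2 \<le> nsq s v"
proof -
  have "(cmod (v n))^2 \<le> Hs_weight s n * (cmod (v n))^2"
    using Hs_weight_ge_1[OF assms(2), of n] by (simp add: mult_le_cancel_right1)
  also have "\<dots> \<le> nsq s v"
    using nsq_ge_sum[OF assms(1), of "{n}"] by simp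
  finally show ?thesis .
qed

lemma finite_support_in_Hs:
  assumes "herm v" "\<And>n. n \<notin> modes N \<Longrightarrow> v n = 0"
  shows "in_Hs s v" and "nsq s v = (\<Sum>n\<in>modes N. Hs_weight s n * (cmod (v n))^2)"
proof -
  have "(\<Sum>n\<in>S. Hs_weight s n * (cmod (v n))^2) \<le> (\<Sum>n\<in>modes N. Hs_weight s n * (cmod (v n))^2)"
    if "finite S" for S
  proof -
    have "(\<Sum>n\<in>S. Hs_weight s n * (cmod (v n))^2) = (\<Sum>n\<in>S \<inter> modes N. Hs_weight s n * (cmod (v n))^2)"
      using assms(2) that by (intro sum.mono_neutral_right) auto
    also have "\<dots> \<le> (\<Sum>n\<in>modes N. Hs_weight s n * (cmod (v n))^2)"
      by (intro sum_mono2) auto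
    finally show ?thesis .
  qed
  then show "in_Hs s v" by (rule in_Hs_bounded(1)[OF assms(1)])
  have "infsum (\<lambda>n. Hs_weight s n * (cmod (v n))^2) UNIV = infsum (\<lambda>n. Hs_weight s n * (cmod (v n))^2) (modes N)"
    using assms(2) by (intro infsum_cong_neutral) auto
  then show "nsq s v = (\<Sum>n\<in>modes N. Hs_weight s n * (cmod (v n))^2)"
    by (simp add: nsq_def)
qed

section \<open>Embedding of \<open>H^q\<close> into the Wiener algebra for q > 1/2\<close>

lemma jap_weight_sum_bounded:
  fixes q :: real
  assumes "q > 1/2"
  obtains C where "0 \<le> C" "\<And>S. finite S \<Longrightarrow> (\<Sum>n\<in>S. Hs_weight (- q) n) \<le> C"
proof -
  let ?f = "\<lambda>k::nat. real k powr (- 2 * q)"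
  have "summable ?f"
    using assms by (subst summable_real_powr_iff) auto
  then have bd: "sum ?f F \<le> suminf ?f" if "finite F" for F
    using that by (intro sum_le_suminf) auto
  \<comment> \<open>Off the zero mode \<open>jap n\<close> is at least n^2, which reduces the sum
    over the integers to two copies of the series of k^(-2q), convergent for q > 1/2.\<close>
  have le: "Hs_weight (- q) n \<le> (if n = 0 then 1 else ?f (nat \<bar>n\<bar>))" for n
  proof (cases "n = 0")
    case True
    then show ?thesis by (simp add: Hs_weight_def)
  next
    case False
    have "(real (nat \<bar>n\<bar>))^2 \<le> jap n"
    proof -
      have "1 * (real_of_int n)^2 \<le> 4 * pi^2 * (real_of_int n)^2"
      proof (rule mult_right_mono)
        have "1 * 1 \<le> pi^2" using pi_gt3 by (intro order.trans[OF _ power_mono[of 1 pi 2]]) auto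
        then show "1 \<le> 4 * pi^2" by linarith
      qed auto
      then show ?thesis by (simp add: jap_def of_nat_nat)
    qed
    then have "jap n powr (- q) \<le> ((real (nat \<bar>n\<bar>))^2) powr (- q)"
      using assms False by (intro powr_mono2') auto
    also have "\<dots> = ?f (nat \<bar>n\<bar>)"
      using False powr_powr[of "real (nat \<bar>n\<bar>)" 2 "- q"] by (simp add: powr_numeral)
    finally show ?thesis using False by (simp add: Hs_weight_jap)
  qed
  have "(\<Sum>n\<in>S. Hs_weight (- q) n) \<le> 1 + 2 * suminf ?f" if S: "finite S" for S
  proof -
    have "(\<Sum>n\<in>S. Hs_weight (- q) n) \<le> (\<Sum>n\<in>S \<union> {0}. Hs_weight (- q) n)"
      using S by (intro sum_mono2) auto
    also have "\<dots> \<le> (\<Sum>n\<in>S \<union> {0}. (if n = 0 then 1 else ?f (nat \<bar>n\<bar>)))"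
      by (intro sum_mono le)
    also have "\<dots> = 1 + (\<Sum>n\<in>S - {0}. ?f (nat \<bar>n\<bar>))"
      using S by (subst sum.remove[of _ 0]) (auto intro!: sum.cong)
    also have "(\<Sum>n\<in>S - {0}. ?f (nat \<bar>n\<bar>)) = (\<Sum>n\<in>S \<inter> {1..}. ?f (nat \<bar>n\<bar>)) + (\<Sum>n\<in>S \<inter> {..-1}. ?f (nat \<bar>n\<bar>))"
      using S by (subst sum.union_disjoint[symmetric]) (auto intro!: sum.cong)
    also have "(\<Sum>n\<in>S \<inter> {1..}. ?f (nat \<bar>n\<bar>)) = sum ?f ((\<lambda>n. nat \<bar>n\<bar>) ` (S \<inter> {1..}))"
      by (subst sum.reindex) (auto simp: inj_on_def)
    also have "(\<Sum>n\<in>S \<inter> {..-1}. ?f (nat \<bar>n\<bar>)) = sum ?f ((\<lambda>n. nat \<bar>n\<bar>) ` (S \<inter> {..-1}))"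
      by (subst sum.reindex) (auto simp: inj_on_def)
    finally show ?thesis
      using bd[of "(\<lambda>n. nat \<bar>n\<bar>) ` (S \<inter> {1..})"] bd[of "(\<lambda>n. nat \<bar>n\<bar>) ` (S \<inter> {..-1})"] S by auto
  qed
  moreover have "0 \<le> 1 + 2 * suminf ?f"
    using bd[of "{}"] by simp
  ultimately show thesis by (rule that[rotated])
qed

text \<open>Cauchy-Schwarz against the weight of order -q, whose sum converges for q > 1/2. Applied
  to u_x with q = s - 1, this Sobolev embedding is the source of the condition s > 3/2.\<close>

lemma sum_norm_le_weighted:
  fixes q :: real
  assumes "q > 1/2"
  obtains C where "0 < C"
    "\<And>(a :: int \<Rightarrow> complex) S. finite S \<Longrightarrow>
       (\<Sum>n\<in>S. cmod (a n)) \<le> C * sqrt (\<Sum>n\<in>S. Hs_weight q n * (cmod (a n))^2)"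
proof -
  obtain D where D: "0 \<le> D" "\<And>S. finite S \<Longrightarrow> (\<Sum>n\<in>S. Hs_weight (- q) n) \<le> D"
    using jap_weight_sum_bounded[OF assms] by blast
  have "(\<Sum>n\<in>S. cmod (a n)) \<le> sqrt (D + 1) * sqrt (\<Sum>n\<in>S. Hs_weight q n * (cmod (a n))^2)"
    if S: "finite S" for a :: "int \<Rightarrow> complex" and S
  proof (rule power2_le_imp_le)
    have "(\<Sum>n\<in>S. cmod (a n)) = (\<Sum>n\<in>S. Hs_weight (- q/2) n * (Hs_weight (q/2) n * cmod (a n)))"
      by (simp add: Hs_weight_jap powr_minus mult.assoc[symmetric] less_imp_neq[symmetric])
    then have "(\<Sum>n\<in>S. cmod (a n))^2 \<le> (\<Sum>n\<in>S. (Hs_weight (- q/2) n)^2) * (\<Sum>n\<in>S. (Hs_weight (q/2) n * cmod (a n))^2)"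
      using Cauchy_Schwarz_ineq_sum by metis
    also have "\<dots> = (\<Sum>n\<in>S. Hs_weight (- q) n) * (\<Sum>n\<in>S. Hs_weight q n * (cmod (a n))^2)"
      using Hs_weight_half_sq[of q] Hs_weight_half_sq[of "- q"] by (simp add: power_mult_distrib)
    also have "\<dots> \<le> (D + 1) * (\<Sum>n\<in>S. Hs_weight q n * (cmod (a n))^2)"
      using D(2)[OF S] by (intro mult_right_mono sum_nonneg) auto
    also have "\<dots> = (sqrt (D + 1) * sqrt (\<Sum>n\<in>S. Hs_weight q n * (cmod (a n))^2))^2"
      using D(1) by (simp add: power_mult_distrib sum_nonneg)
    finally show "(\<Sum>n\<in>S. cmod (a n))^2 \<le> (sqrt (D + 1) * sqrt (\<Sum>n\<in>S. Hs_weight q n * (cmod (a n))^2))^2" .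
  qed (use D(1) in \<open>auto intro!: mult_nonneg_nonneg sum_nonneg\<close>)
  moreover have "0 < sqrt (D + 1)" using D(1) by auto
  ultimately show thesis by (rule that[rotated])
qed

lemma ell1_bounded:
  assumes "\<And>S. finite S \<Longrightarrow> (\<Sum>n\<in>S. cmod (a n)) \<le> B"
  shows "ell1 a" and "l1n a \<le> B"
  using nonneg_bounded_sums[of "\<lambda>n. cmod (a n)" B] assms by (auto simp: ell1_def l1n_def)

lemma l1n_nonneg [simp]: "0 \<le> l1n a"
  unfolding l1n_def by (intro infsum_nonneg) auto

lemma l1n_ge_sum: "ell1 a \<Longrightarrow> finite S \<Longrightarrow> (\<Sum>n\<in>S. cmod (a n)) \<le> l1n a"
  unfolding l1n_def ell1_def by (intro finite_sum_le_infsum) auto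

lemma l1n_ge_norm: "ell1 a \<Longrightarrow> cmod (a n) \<le> l1n a"
  using l1n_ge_sum[of a "{n}"] by simp

lemma norm_dx: "cmod (dx v n) = 2 * pi * \<bar>real_of_int n\<bar> * cmod (v n)"
  by (simp add: dx_def norm_mult)

lemma norm_dx_sq_weight_le: "Hs_weight (s - 1) n * (cmod (dx v n))^2 \<le> Hs_weight s n * (cmod (v n))^2"
proof -
  have "Hs_weight (s - 1) n * (cmod (dx v n))^2 = Hs_weight (s - 1) n * ((4 * pi^2 * (real_of_int n)^2) * (cmod (v n))^2)"
    by (simp add: norm_dx power_mult_distrib)
  also have "\<dots> \<le> Hs_weight (s - 1) n * (jap n * (cmod (v n))^2)"
    by (intro mult_left_mono mult_right_mono) (auto simp: jap_def)
  also have "\<dots> = Hs_weight s n * (cmod (v n))^2"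
    using Hs_weight_add[of "s - 1" 1 n] by (simp add: Hs_weight_1)
  finally show ?thesis .
qed

lemma in_Hs_dx:
  assumes "in_Hs s v"
  shows "in_Hs (s - 1) (dx v)" and "nsq (s - 1) (dx v) \<le> nsq s v"
proof -
  have h: "herm (dx v)"
    using in_Hs_herm[OF assms] by (simp add: herm_def dx_def)
  have *: "(\<Sum>n\<in>S. Hs_weight (s - 1) n * (cmod (dx v n))^2) \<le> nsq s v" if "finite S" for S
    by (rule order.trans[OF _ nsq_ge_sum[OF assms that]]) (intro sum_mono norm_dx_sq_weight_le)
  show "in_Hs (s - 1) (dx v)" "nsq (s - 1) (dx v) \<le> nsq s v"
    using in_Hs_bounded[OF h *] by auto
qed

lemma in_Hs_ell1:
  fixes q :: real
  assumes "q > 1/2"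
  obtains C where "0 < C" "\<And>v. in_Hs q v \<Longrightarrow> ell1 v" "\<And>v. in_Hs q v \<Longrightarrow> l1n v \<le> C * sqrt (nsq q v)"
proof -
  obtain C where C: "0 < C"
    "\<And>(a :: int \<Rightarrow> complex) S. finite S \<Longrightarrow>
       (\<Sum>n\<in>S. cmod (a n)) \<le> C * sqrt (\<Sum>n\<in>S. Hs_weight q n * (cmod (a n))^2)"
    using sum_norm_le_weighted[OF assms] by blast
  have "(\<Sum>n\<in>S. cmod (v n)) \<le> C * sqrt (nsq q v)" if "in_Hs q v" "finite S" for v S
    by (rule order.trans[OF C(2)[OF that(2)]]) (use C(1) nsq_ge_sum[OF that] in auto)
  then show thesis
    using that[OF C(1)] ell1_bounded by metis
qed

lemma ell1_diff: 
  assumes "ell1 u" "ell1 v" shows "ell1 (\<lambda>n. u n - v n)" "l1n (\<lambda>n. u n - v n) \<le> l1n u + l1n v"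
proof -
  have *: "(\<Sum>n\<in>S. cmod (u n - v n)) \<le> l1n u + l1n v" if "finite S" for S
  proof -
    have "(\<Sum>n\<in>S. cmod (u n - v n)) \<le> (\<Sum>n\<in>S. cmod (u n) + cmod (v n))"
      by (intro sum_mono norm_triangle_ineq4)
    then show ?thesis
      using l1n_ge_sum[OF assms(1) that] l1n_ge_sum[OF assms(2) that] by (simp add: sum.distrib)
  qed
  show "ell1 (\<lambda>n. u n - v n)" "l1n (\<lambda>n. u n - v n) \<le> l1n u + l1n v"
    using ell1_bounded[OF *] by auto
qed

lemma dx_diff: "dx (\<lambda>n. u n - v n) = (\<lambda>n. dx u n - dx v n)"
  by (auto simp: dx_def algebra_simps)

lemma dx_herm: "herm v \<Longrightarrow> herm (dx v)"
  by (simp add: herm_def dx_def)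

section \<open>Convolution estimates\<close>

lemma weighted_Cauchy_Schwarz:
  fixes g x y :: "'a \<Rightarrow> real"
  assumes "\<And>p. p \<in> P \<Longrightarrow> 0 \<le> g p"
    and "(\<Sum>p\<in>P. g p * (x p)^2) \<le> X" "(\<Sum>p\<in>P. g p * (y p)^2) \<le> Y"
  shows "(\<Sum>p\<in>P. g p * x p * y p) \<le> sqrt X * sqrt Y"
proof -
  have "(\<Sum>p\<in>P. g p * x p * y p) = (\<Sum>p\<in>P. (sqrt (g p) * x p) * (sqrt (g p) * y p))"
    using assms(1) by (intro sum.cong) (auto simp: algebra_simps simp flip: power2_eq_square)
  then have "(\<Sum>p\<in>P. g p * x p * y p)^2 \<le> (\<Sum>p\<in>P. (sqrt (g p) * x p)^2) * (\<Sum>p\<in>P. (sqrt (g p) * y p)^2)"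
    using Cauchy_Schwarz_ineq_sum by metis
  also have "\<dots> = (\<Sum>p\<in>P. g p * (x p)^2) * (\<Sum>p\<in>P. g p * (y p)^2)"
    using assms(1) by (simp add: power_mult_distrib)
  also have "\<dots> \<le> X * Y"
    using assms by (intro mult_mono order.trans[OF _ assms(2)] sum_nonneg) auto
  finally show ?thesis
    by (metis abs_le_D1 real_le_rsqrt real_sqrt_mult)
qed

lemma sum_translate_le:
  fixes f :: "int \<Rightarrow> real"
  assumes "finite A" "\<And>S. finite S \<Longrightarrow> sum f S \<le> B"
  shows "(\<Sum>n\<in>A. f (n - m)) \<le> B" "(\<Sum>n\<in>A. f (m - n)) \<le> B"
proof -
  have "(\<Sum>n\<in>A. f (n - m)) = sum f ((\<lambda>n. n - m) ` A)" "(\<Sum>n\<in>A. f (m - n)) = sum f ((\<lambda>n. m - n) ` A)"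
    by (auto simp: sum.reindex inj_on_def)
  then show "(\<Sum>n\<in>A. f (n - m)) \<le> B" "(\<Sum>n\<in>A. f (m - n)) \<le> B"
    using assms by simp_all
qed

text \<open>Schur's test: all row sums and column sums of the kernel b(n - m) are at most B, so
  Cauchy-Schwarz with b as a weight on pairs separates a from c.\<close>

lemma Young_form:
  fixes a b c :: "int \<Rightarrow> real"
  assumes "finite A" "finite M" "\<And>k. 0 \<le> b k" "\<And>S. finite S \<Longrightarrow> sum b S \<le> B"
  shows "(\<Sum>n\<in>A. \<Sum>m\<in>M. b (n - m) * a n * c m) \<le> B * (sqrt (\<Sum>n\<in>A. (a n)^2) * sqrt (\<Sum>m\<in>M. (c m)^2))"
proof -
  have B: "0 \<le> B" using assms(4)[of "{}"] by simp
  have rows: "(\<Sum>m\<in>M. b (n - m)) \<le> B" for n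
    by (rule sum_translate_le(2)[OF assms(2,4)])
  have cols: "(\<Sum>n\<in>A. b (n - m)) \<le> B" for m
    by (rule sum_translate_le(1)[OF assms(1,4)])
  have "(\<Sum>p\<in>A\<times>M. b (fst p - snd p) * (a (fst p))^2) = (\<Sum>n\<in>A. (\<Sum>m\<in>M. b (n - m)) * (a n)^2)"
    by (simp add: sum.cartesian_product' sum_distrib_right)
  also have "\<dots> \<le> (\<Sum>n\<in>A. B * (a n)^2)"
    by (intro sum_mono mult_right_mono rows) auto
  finally have 1: "(\<Sum>p\<in>A\<times>M. b (fst p - snd p) * (a (fst p))^2) \<le> B * (\<Sum>n\<in>A. (a n)^2)"
    by (simp add: sum_distrib_left)
  have "(\<Sum>p\<in>A\<times>M. b (fst p - snd p) * (c (snd p))^2) = (\<Sum>m\<in>M. (\<Sum>n\<in>A. b (n - m)) * (c m)^2)"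
    by (simp add: sum.cartesian_product' sum_distrib_right sum.swap[of _ A])
  also have "\<dots> \<le> (\<Sum>m\<in>M. B * (c m)^2)"
    by (intro sum_mono mult_right_mono cols) auto
  finally have 2: "(\<Sum>p\<in>A\<times>M. b (fst p - snd p) * (c (snd p))^2) \<le> B * (\<Sum>m\<in>M. (c m)^2)"
    by (simp add: sum_distrib_left)
  have "(\<Sum>n\<in>A. \<Sum>m\<in>M. b (n - m) * a n * c m) = (\<Sum>p\<in>A\<times>M. b (fst p - snd p) * a (fst p) * c (snd p))"
    by (simp add: sum.cartesian_product')
  also have "\<dots> \<le> sqrt (B * (\<Sum>n\<in>A. (a n)^2)) * sqrt (B * (\<Sum>m\<in>M. (c m)^2))"
    by (rule weighted_Cauchy_Schwarz[OF _ 1 2]) (use assms(3) in auto)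
  also have "\<dots> = B * (sqrt (\<Sum>n\<in>A. (a n)^2) * sqrt (\<Sum>m\<in>M. (c m)^2))"
    using B by (simp add: real_sqrt_mult)
  finally show ?thesis .
qed

text \<open>The companion of \<open>Young_form\<close> for a summable factor attached to the index m
  itself. The column sums now run over translates of d, so d must be square summable over all
  integers. It serves the commutator term in which the derivative stays on m and the weight moves to
  n - m.\<close>

lemma Young_form':
  fixes a b d :: "int \<Rightarrow> real"
  assumes "finite A" "finite M" "\<And>k. 0 \<le> b k" "sum b M \<le> B"
    and "\<And>S. finite S \<Longrightarrow> (\<Sum>k\<in>S. (d k)^2) \<le> D"
  shows "(\<Sum>n\<in>A. \<Sum>m\<in>M. b m * a n * d (n - m)) \<le> B * (sqrt (\<Sum>n\<in>A. (a n)^2) * sqrt D)"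
proof -
  have B: "0 \<le> B" using assms(3,4) sum_nonneg[of M b] by force
  have D: "0 \<le> D" using assms(5)[of "{}"] by simp
  have cols: "(\<Sum>n\<in>A. (d (n - m))^2) \<le> D" for m
    by (rule sum_translate_le(1)[OF assms(1), of "\<lambda>k. (d k)^2", OF assms(5)])
  have "(\<Sum>p\<in>A\<times>M. b (snd p) * (a (fst p))^2) = sum b M * (\<Sum>n\<in>A. (a n)^2)"
    by (simp add: sum.cartesian_product' sum_product mult.commute sum.swap[of _ A])
  also have "\<dots> \<le> B * (\<Sum>n\<in>A. (a n)^2)"
    using assms(4) by (intro mult_right_mono sum_nonneg) auto
  finally have 1: "(\<Sum>p\<in>A\<times>M. b (snd p) * (a (fst p))^2) \<le> B * (\<Sum>n\<in>A. (a n)^2)" .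
  have "(\<Sum>p\<in>A\<times>M. b (snd p) * (d (fst p - snd p))^2) = (\<Sum>m\<in>M. b m * (\<Sum>n\<in>A. (d (n - m))^2))"
    by (simp add: sum.cartesian_product' sum_distrib_left sum.swap[of _ A])
  also have "\<dots> \<le> (\<Sum>m\<in>M. b m * D)"
    using assms(3) by (intro sum_mono mult_left_mono cols) auto
  also have "\<dots> \<le> B * D"
    using assms(4) D by (simp add: mult_right_mono flip: sum_distrib_right)
  finally have 2: "(\<Sum>p\<in>A\<times>M. b (snd p) * (d (fst p - snd p))^2) \<le> B * D" .
  have "(\<Sum>n\<in>A. \<Sum>m\<in>M. b m * a n * d (n - m)) = (\<Sum>p\<in>A\<times>M. b (snd p) * a (fst p) * d (fst p - snd p))"
    by (simp add: sum.cartesian_product')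
  also have "\<dots> \<le> sqrt (B * (\<Sum>n\<in>A. (a n)^2)) * sqrt (B * D)"
    by (rule weighted_Cauchy_Schwarz[OF _ 1 2]) (use assms(3) in auto)
  also have "\<dots> = B * (sqrt (\<Sum>n\<in>A. (a n)^2) * sqrt D)"
    using B by (simp add: real_sqrt_mult)
  finally show ?thesis .
qed

text \<open>Cauchy-Schwarz with weight f proves the bound for inner sums over finite sets K,
  uniformly in K. It passes to the limit because n also runs through a finite set.\<close>

lemma Young_l1_l2:
  fixes f g :: "int \<Rightarrow> real"
  assumes "\<And>k. 0 \<le> f k" "\<And>S. finite S \<Longrightarrow> sum f S \<le> F"
    and "\<And>S. finite S \<Longrightarrow> (\<Sum>k\<in>S. (g k)^2) \<le> G" and "finite S"
    and summable: "\<And>n. (\<lambda>k. f k * g (n - k)) summable_on UNIV"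
  shows "(\<Sum>n\<in>S. (\<Sum>\<^sub>\<infinity>k. f k * g (n - k))^2) \<le> F^2 * G"
proof -
  have F: "0 \<le> F" using assms(2)[of "{}"] by simp
  have fin: "(\<Sum>n\<in>S. (\<Sum>k\<in>K. f k * g (n - k))^2) \<le> F^2 * G" if K: "finite K" for K
  proof -
    have "(\<Sum>n\<in>S. (\<Sum>k\<in>K. f k * g (n - k))^2) \<le> (\<Sum>n\<in>S. F * (\<Sum>k\<in>K. f k * (g (n - k))^2))"
    proof (rule sum_mono)
      fix n
      have "(\<Sum>k\<in>K. f k * g (n - k)) = (\<Sum>k\<in>K. sqrt (f k) * (sqrt (f k) * g (n - k)))"
        using assms(1) by (simp add: mult.assoc[symmetric])
      then have "(\<Sum>k\<in>K. f k * g (n - k))^2 \<le> (\<Sum>k\<in>K. (sqrt (f k))^2) * (\<Sum>k\<in>K. (sqrt (f k) * g (n - k))^2)"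
        using Cauchy_Schwarz_ineq_sum by metis
      also have "\<dots> = sum f K * (\<Sum>k\<in>K. f k * (g (n - k))^2)"
        using assms(1) by (simp add: power_mult_distrib)
      also have "\<dots> \<le> F * (\<Sum>k\<in>K. f k * (g (n - k))^2)"
        using assms(1) assms(2)[OF K] by (intro mult_right_mono sum_nonneg) auto
      finally show "(\<Sum>k\<in>K. f k * g (n - k))^2 \<le> F * (\<Sum>k\<in>K. f k * (g (n - k))^2)" .
    qed
    also have "\<dots> = F * (\<Sum>k\<in>K. f k * (\<Sum>n\<in>S. (g (n - k))^2))"
      by (simp add: sum_distrib_left sum.swap[of _ S])
    also have "\<dots> \<le> F * (\<Sum>k\<in>K. f k * G)"
    proof (intro mult_left_mono sum_mono)
      show "(\<Sum>n\<in>S. (g (n - k))^2) \<le> G" for k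
        by (rule sum_translate_le(1)[OF assms(4), of "\<lambda>k. (g k)^2", OF assms(3)])
    qed (use assms(1) F in auto)
    also have "\<dots> \<le> F * (F * G)"
      using F assms(2)[OF K] assms(3)[of "{}"] by (simp add: mult_left_mono mult_right_mono flip: sum_distrib_right)
    finally show ?thesis by (simp add: power2_eq_square)
  qed
  have "((\<lambda>K. \<Sum>n\<in>S. (\<Sum>k\<in>K. f k * g (n - k))^2) \<longlongrightarrow> (\<Sum>n\<in>S. (\<Sum>\<^sub>\<infinity>k. f k * g (n - k))^2)) (finite_subsets_at_top UNIV)"
    by (intro tendsto_sum tendsto_power infsum_tendsto summable)
  then show ?thesis
    by (rule tendsto_upperbound) (auto intro!: eventually_finite_subsets_at_top_weakI fin)
qed

lemma conv_altdef: "conv v w n = (\<Sum>\<^sub>\<infinity>m. v (n - m) * w m)"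
  unfolding conv_def by (rule infsum_reindex_bij_witness[of _ "\<lambda>k. n - k" "\<lambda>k. n - k"]) auto

lemma ell1_conv_abs_summable:
  assumes "ell1 f" "\<And>n. cmod (g n) \<le> G"
  shows "(\<lambda>k. cmod (f k * g (n - k))) summable_on UNIV"
proof (rule Infinite_Sum.abs_summable_on_comparison_test[of "\<lambda>k. complex_of_real G * f k"])
  have "(\<lambda>k. cmod (of_real G * f k)) = (\<lambda>k. \<bar>G\<bar> * cmod (f k))"
    by (simp add: norm_mult)
  then show "(\<lambda>k. cmod (of_real G * f k)) summable_on UNIV"
    using assms(1) by (simp add: ell1_def summable_on_cmult_right)
  show "cmod (f k * g (n - k)) \<le> cmod (of_real G * f k)" for k
  proof -
    have "cmod (g (n - k)) \<le> \<bar>G\<bar>" using assms(2)[of "n - k"] by linarith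
    from mult_left_mono[OF this norm_ge_zero[of "f k"]] show ?thesis
      by (simp add: norm_mult mult.commute)
  qed
qed

lemma conv_summable:
  assumes "ell1 f" "ell1 g"
  shows "(\<lambda>k. f k * g (n - k)) summable_on UNIV" "(\<lambda>k. cmod (f k) * cmod (g (n - k))) summable_on UNIV"
  using ell1_conv_abs_summable[OF assms(1), of g "l1n g" n] l1n_ge_norm[OF assms(2)]
  by (auto simp: norm_mult intro: Infinite_Sum.abs_summable_summable)

lemma infsum_minus:
  fixes f g :: "'a \<Rightarrow> complex"
  assumes "f summable_on A" "g summable_on A"
  shows "infsum (\<lambda>x. f x - g x) A = infsum f A - infsum g A"
  using infsum_add[OF assms(1) summable_on_uminus[THEN iffD2, OF assms(2)]] infsum_uminus[of g A] by simp

lemma conv_diff: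
  assumes "ell1 u" "ell1 v" "ell1 f" "ell1 g"
  shows "conv u f n - conv v g n = conv u (\<lambda>n. f n - g n) n + conv (\<lambda>n. u n - v n) g n"
proof -
  have "conv u f n - conv u g n = conv u (\<lambda>n. f n - g n) n"
    unfolding conv_def using assms
    by (subst infsum_minus[symmetric]) (auto intro!: conv_summable simp: algebra_simps)
  moreover have "conv u g n - conv v g n = conv (\<lambda>n. u n - v n) g n"
    unfolding conv_def using assms
    by (subst infsum_minus[symmetric]) (auto intro!: conv_summable simp: algebra_simps)
  ultimately show ?thesis by (simp add: algebra_simps)
qed

lemma conv_herm:
  assumes "herm f" "herm g" shows "herm (conv f g)"
  unfolding herm_def
proof
  fix n
  have "conv f g (- n) = (\<Sum>\<^sub>\<infinity>k. cnj (f k * g (n - k)))"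
    unfolding conv_def
  proof (rule infsum_reindex_bij_witness[of _ uminus uminus])
    fix k
    have "g (n + k) = cnj (g (- n - k))"
    proof -
      have "g (- (- n - k)) = cnj (g (- n - k))" using assms(2) unfolding herm_def by blast
      then show ?thesis by (simp add: add.commute)
    qed
    moreover have "f (- k) = cnj (f k)" using assms(1) by (simp add: herm_def)
    ultimately show "cnj (f (- k) * g (n - - k)) = f k * g (- n - k)" by simp
  qed auto
  then show "conv f g (- n) = cnj (conv f g n)"
    by (simp only: infsum_cnj conv_def)
qed

lemma norm_conv_le:
  assumes "ell1 f" "ell1 g"
  shows "cmod (conv f g n) \<le> (\<Sum>\<^sub>\<infinity>k. cmod (f k) * cmod (g (n - k)))"
  using norm_infsum_bound[of "\<lambda>k. f k * g (n - k)" UNIV] conv_summable(2)[OF assms]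
  by (simp add: conv_def norm_mult)

section \<open>Products in \<open>H^q\<close>\<close>

lemma jap_add_le: "jap n \<le> 2 * (jap k + jap (n - k))"
proof -
  have "0 \<le> (real_of_int k - real_of_int (n - k))^2" by simp
  then have "(real_of_int n)^2 \<le> 2 * (real_of_int k)^2 + 2 * (real_of_int (n - k))^2"
    by (simp add: power2_eq_square algebra_simps)
  then have "4 * pi^2 * (real_of_int n)^2 \<le> 4 * pi^2 * (2 * (real_of_int k)^2 + 2 * (real_of_int (n - k))^2)"
    by (intro mult_left_mono) auto
  then show ?thesis by (simp add: jap_def algebra_simps)
qed

lemma Hs_weight_subadd:
  assumes "0 \<le> r"
  shows "Hs_weight r n \<le> 4 powr r * (Hs_weight r k + Hs_weight r (n - k))"
proof -
  have "jap n \<le> 4 * max (jap k) (jap (n - k))"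
  proof -
    have "2 * (jap k + jap (n - k)) \<le> 2 * (max (jap k) (jap (n - k)) + max (jap k) (jap (n - k)))"
      by (intro mult_left_mono add_mono) auto
    then show ?thesis using jap_add_le[of n k] by simp
  qed
  then have "jap n powr r \<le> (4 * max (jap k) (jap (n - k))) powr r"
    using assms by (intro powr_mono2) (auto simp: less_imp_le)
  also have "\<dots> = 4 powr r * (max (jap k) (jap (n - k))) powr r"
    by (simp add: powr_mult le_max_iff_disj less_imp_le)
  also have "(max (jap k) (jap (n - k))) powr r \<le> jap k powr r + jap (n - k) powr r"
    by (simp add: max_def)
  finally show ?thesis by (simp add: Hs_weight_jap mult_left_mono)
qed

lemma weighted_conv_summable:
  assumes "ell1 f" "in_Hs q g" 
  shows "(\<lambda>k. cmod (f k) * (Hs_weight (q/2) (n - k) * cmod (g (n - k)))) summable_on UNIV"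
proof -
  have *: "cmod (of_real (Hs_weight (q/2) n * cmod (g n))) \<le> sqrt (nsq q g)" for n
  proof (rule real_le_rsqrt)
    have "(cmod (of_real (Hs_weight (q/2) n * cmod (g n))))^2 = Hs_weight q n * (cmod (g n))^2"
      by (simp only: norm_of_real power2_abs power_mult_distrib Hs_weight_half_sq)
    also have "\<dots> \<le> nsq q g"
      using nsq_ge_sum[OF assms(2), of "{n}"] by simp
    finally show "(cmod (of_real (Hs_weight (q/2) n * cmod (g n))))^2 \<le> nsq q g" .
  qed
  show ?thesis
    using ell1_conv_abs_summable[OF assms(1), of "\<lambda>n. of_real (Hs_weight (q/2) n * cmod (g n))", OF *]
    by (simp add: norm_mult)
qed

text \<open>The algebra property of \<open>H^q\<close>: subadditivity lets the weight at n fall on k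
  or on n - k. The factor left without weight is summable by the Sobolev embedding, the weighted one
  is square summable, and Young's inequality applies.\<close>

lemma conv_Hs:
  fixes q :: real
  assumes "q > 1/2"
  obtains C where "0 < C" "\<And>f g. in_Hs q f \<Longrightarrow> in_Hs q g \<Longrightarrow> in_Hs q (conv f g)"
    "\<And>f g. in_Hs q f \<Longrightarrow> in_Hs q g \<Longrightarrow> nsq q (conv f g) \<le> C * nsq q f * nsq q g"
proof -
  obtain E where E: "0 < E" "\<And>v. in_Hs q v \<Longrightarrow> ell1 v" "\<And>v. in_Hs q v \<Longrightarrow> l1n v \<le> E * sqrt (nsq q v)"
    using in_Hs_ell1[OF assms] by blast
  define c where "c = 4 powr (q/2)"
  have c: "0 < c" by (simp add: c_def)
  have *: "(\<Sum>n\<in>S. Hs_weight q n * (cmod (conv f g n))^2) \<le> 4 * c^2 * E^2 * nsq q f * nsq q g"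
    if fg: "in_Hs q f" "in_Hs q g" and S: "finite S" for f g S
  proof -
    let ?w = "Hs_weight (q/2)"
    define P where "P n = (\<Sum>\<^sub>\<infinity>k. cmod (f k) * (?w (n - k) * cmod (g (n - k))))" for n
    define Q where "Q n = (\<Sum>\<^sub>\<infinity>k. cmod (g k) * (?w (n - k) * cmod (f (n - k))))" for n
    have young: "(\<Sum>n\<in>S. (\<Sum>\<^sub>\<infinity>k. cmod (u k) * (?w (n - k) * cmod (v (n - k))))^2) \<le> E^2 * nsq q u * nsq q v"
      if uv: "in_Hs q u" "in_Hs q v" for u v
    proof -
      have "(\<Sum>n\<in>S. (\<Sum>\<^sub>\<infinity>k. cmod (u k) * (?w (n - k) * cmod (v (n - k))))^2) \<le> (E * sqrt (nsq q u))^2 * nsq q v"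
      proof (rule Young_l1_l2[where g = "\<lambda>k. ?w k * cmod (v k)"])
        show "sum (\<lambda>k. cmod (u k)) S \<le> E * sqrt (nsq q u)" if "finite S" for S
          using l1n_ge_sum[OF E(2)[OF uv(1)] that] E(3)[OF uv(1)] by linarith
        show "(\<Sum>k\<in>S. (?w k * cmod (v k))^2) \<le> nsq q v" if "finite S" for S
          using nsq_ge_sum[OF uv(2) that] by (simp add: power_mult_distrib Hs_weight_half_sq)
      qed (use S weighted_conv_summable[OF E(2)[OF uv(1)] uv(2)] in auto)
      then show ?thesis using E(1) by (simp add: power_mult_distrib)
    qed
    \<comment> \<open>The part with the weight on k is an instance of the same Young bound after the
      reflection of k to n - k, with f and g exchanged.\<close>
    have Q_alt: "Q n = (\<Sum>\<^sub>\<infinity>k. ?w k * cmod (f k) * cmod (g (n - k)))" 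
      and Q_summ: "(\<lambda>k. ?w k * cmod (f k) * cmod (g (n - k))) summable_on UNIV" for n
    proof -
      have bij: "bij (\<lambda>k::int. n - k)"
        by (rule bij_betw_byWitness[of _ "\<lambda>k. n - k"]) auto
      show "Q n = (\<Sum>\<^sub>\<infinity>k. ?w k * cmod (f k) * cmod (g (n - k)))"
        unfolding Q_def by (rule infsum_reindex_bij_witness[of _ "\<lambda>k. n - k" "\<lambda>k. n - k"]) auto
      show "(\<lambda>k. ?w k * cmod (f k) * cmod (g (n - k))) summable_on UNIV"
        using summable_on_reindex_bij_betw[OF bij, of "\<lambda>k. ?w k * cmod (f k) * cmod (g (n - k))"]
          weighted_conv_summable[OF E(2)[OF fg(2)] fg(1), of n] by (simp add: mult_ac)
    qed
    have P_summ: "(\<lambda>k. cmod (f k) * (?w (n - k) * cmod (g (n - k)))) summable_on UNIV" for n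
      by (rule weighted_conv_summable[OF E(2)[OF fg(1)] fg(2)])
    have pt: "?w n * cmod (conv f g n) \<le> c * (P n + Q n)" for n
    proof -
      have "?w n * cmod (conv f g n) \<le> ?w n * (\<Sum>\<^sub>\<infinity>k. cmod (f k) * cmod (g (n - k)))"
        using norm_conv_le[OF E(2)[OF fg(1)] E(2)[OF fg(2)]] by (intro mult_left_mono) auto
      also have "\<dots> = (\<Sum>\<^sub>\<infinity>k. ?w n * (cmod (f k) * cmod (g (n - k))))"
        by (simp add: infsum_cmult_right')
      also have "\<dots> \<le> (\<Sum>\<^sub>\<infinity>k. c * (cmod (f k) * (?w (n - k) * cmod (g (n - k))) + ?w k * cmod (f k) * cmod (g (n - k))))"
      proof (rule infsum_mono)
        show "(\<lambda>k. ?w n * (cmod (f k) * cmod (g (n - k)))) summable_on UNIV"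
          by (intro summable_on_cmult_right conv_summable(2) E(2) fg)
        show "(\<lambda>k. c * (cmod (f k) * (?w (n - k) * cmod (g (n - k))) + ?w k * cmod (f k) * cmod (g (n - k)))) summable_on UNIV"
          by (intro summable_on_cmult_right summable_on_add P_summ Q_summ)
        fix k
        have "?w n * (cmod (f k) * cmod (g (n - k))) \<le> (c * (?w k + ?w (n - k))) * (cmod (f k) * cmod (g (n - k)))"
          unfolding c_def using assms by (intro mult_right_mono Hs_weight_subadd) auto
        then show "?w n * (cmod (f k) * cmod (g (n - k)))
            \<le> c * (cmod (f k) * (?w (n - k) * cmod (g (n - k))) + ?w k * cmod (f k) * cmod (g (n - k)))"
          by (simp add: algebra_simps)
      qed
      also have "\<dots> = c * (P n + Q n)"
        unfolding P_def Q_alt by (simp add: infsum_cmult_right' infsum_add[OF P_summ Q_summ])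
      finally show ?thesis .
    qed
    have "(\<Sum>n\<in>S. Hs_weight q n * (cmod (conv f g n))^2) = (\<Sum>n\<in>S. (?w n * cmod (conv f g n))^2)"
      by (simp add: power_mult_distrib Hs_weight_half_sq)
    also have "\<dots> \<le> (\<Sum>n\<in>S. (c * (P n + Q n))^2)"
      using pt by (intro sum_mono power_mono) auto
    also have "\<dots> \<le> (\<Sum>n\<in>S. c^2 * (2 * (P n)^2 + 2 * (Q n)^2))"
    proof (rule sum_mono)
      fix n
      show "(c * (P n + Q n))^2 \<le> c^2 * (2 * (P n)^2 + 2 * (Q n)^2)"
        using norm_add_sq_le[of "P n" "Q n"] by (simp add: power_mult_distrib mult_left_mono)
    qed
    also have "\<dots> = c^2 * (2 * (\<Sum>n\<in>S. (P n)^2) + 2 * (\<Sum>n\<in>S. (Q n)^2))"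
      by (simp add: sum.distrib flip: sum_distrib_left)
    also have "\<dots> \<le> c^2 * (2 * (E^2 * nsq q f * nsq q g) + 2 * (E^2 * nsq q g * nsq q f))"
      using young[OF fg] young[OF fg(2,1)] unfolding P_def Q_def by (intro mult_left_mono add_mono) auto
    finally show ?thesis by (simp add: algebra_simps)
  qed
  show thesis
  proof (rule that)
    show "0 < 4 * c^2 * E^2" using c E(1) by simp
    fix f g assume fg: "in_Hs q f" "in_Hs q g"
    have h: "herm (conv f g)" using fg by (intro conv_herm in_Hs_herm)
    show "in_Hs q (conv f g)" "nsq q (conv f g) \<le> 4 * c^2 * E^2 * nsq q f * nsq q g"
      using in_Hs_bounded[OF h *[OF fg]] by auto
  qed
qed

section \<open>The nonlocal term and the right-hand side as a map from \<open>H^s\<close> to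
  \<open>H^(s-1)\<close>\<close>

lemma dx_Lambda_inv: "dx (Lambda_mu_inv2 v) n = \<i> * of_real (if n = 0 then 0 else 1 / (2 * pi * real_of_int n)) * v n"
  by (auto simp: dx_def Lambda_mu_inv2_def field_simps power2_eq_square)

lemma dx_Lambda_inv_diff: "dx (Lambda_mu_inv2 (\<lambda>n. u n - v n)) n = dx (Lambda_mu_inv2 u) n - dx (Lambda_mu_inv2 v) n"
  by (simp add: dx_Lambda_inv algebra_simps)

lemma norm_dx_Lambda_inv_le: "cmod (dx (Lambda_mu_inv2 v) n) \<le> cmod (v n)"
proof -
  have "\<bar>if n = 0 then 0 else 1 / (2 * pi * real_of_int n)\<bar> \<le> 1"
  proof (cases "n = 0")
    case False
    then have "1 \<le> \<bar>real_of_int n\<bar>" by linarith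
    then have "1 * 1 \<le> (2 * pi) * \<bar>real_of_int n\<bar>" using pi_gt3 by (intro mult_mono) auto
    then show ?thesis using False by (simp add: abs_mult)
  qed auto
  then show ?thesis
    unfolding dx_Lambda_inv norm_mult by (simp add: mult_left_le_one_le del: of_real_divide)
qed

text \<open>The symbol of the nonlocal operator is purely imaginary and c is real. The cancellation
  occurs in each mode separately, hence in energies with arbitrary real weights.\<close>

lemma Re_cnj_dx_Lambda_inv: "Re (cnj (v n) * (of_real c * dx (Lambda_mu_inv2 v) n)) = 0"
proof -
  have "cnj (v n) * (of_real c * dx (Lambda_mu_inv2 v) n)
      = \<i> * of_real (c * (if n = 0 then 0 else 1 / (2 * pi * real_of_int n)) * (cmod (v n))^2)"
    unfolding dx_Lambda_inv of_real_mult complex_norm_square by (simp only: mult_ac)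
  then show ?thesis by (metis Re_i_times Im_complex_of_real neg_equal_0_iff_equal)
qed

lemma dx_Lambda_inv_herm: "herm v \<Longrightarrow> herm (dx (Lambda_mu_inv2 v))"
  by (simp add: herm_def dx_Lambda_inv)

text \<open>Polarising the quadratic right-hand side gives local Lipschitz continuity with the loss
  of one derivative. This makes the time derivative continuous in \<open>H^(s-1)\<close> and lets
  the equation pass to limits.\<close>

lemma mudp_rhs_Hs:
  fixes s :: real
  assumes s: "s > 3/2"
  obtains C where "0 < C" "\<And>u. in_Hs s u \<Longrightarrow> in_Hs (s - 1) (mudp_rhs u)"
    "\<And>u v. in_Hs s u \<Longrightarrow> in_Hs s v \<Longrightarrow>
       nsq (s - 1) (\<lambda>n. mudp_rhs u n - mudp_rhs v n) \<le> C * (nsq s u + nsq s v) * nsq s (\<lambda>n. u n - v n)"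
proof -
  let ?q = "s - 1"
  have q: "?q > 1/2" using s by simp
  obtain D where D: "0 < D" "\<And>f g. in_Hs ?q f \<Longrightarrow> in_Hs ?q g \<Longrightarrow> in_Hs ?q (conv f g)"
    "\<And>f g. in_Hs ?q f \<Longrightarrow> in_Hs ?q g \<Longrightarrow> nsq ?q (conv f g) \<le> D * nsq ?q f * nsq ?q g"
    using conv_Hs[OF q] by blast
  obtain E where E: "\<And>v. in_Hs ?q v \<Longrightarrow> ell1 v"
    using in_Hs_ell1[OF q] by blast
  have lin: "in_Hs ?q (\<lambda>n. of_real (mu u) * dx (Lambda_mu_inv2 v) n)"
    "nsq ?q (\<lambda>n. of_real (mu u) * dx (Lambda_mu_inv2 v) n) \<le> nsq s u * nsq s v" 
    if uv: "in_Hs s u" "in_Hs s v" for u v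
  proof -
    have mu: "(mu u)^2 \<le> nsq s u"
      using norm_le_nsq[OF uv(1), of 0] s power_mono[OF abs_Re_le_cmod[of "u 0"], of 2] by (simp add: mu_def)
    have *: "(\<Sum>n\<in>S. Hs_weight ?q n * (cmod (of_real (mu u) * dx (Lambda_mu_inv2 v) n))^2) \<le> nsq s u * nsq s v"
      if S: "finite S" for S
    proof -
      have "(\<Sum>n\<in>S. Hs_weight ?q n * (cmod (of_real (mu u) * dx (Lambda_mu_inv2 v) n))^2)
          \<le> (\<Sum>n\<in>S. Hs_weight ?q n * ((mu u)^2 * (cmod (v n))^2))"
        by (intro sum_mono mult_left_mono)
          (auto simp: norm_mult power_mult_distrib intro!: mult_left_mono power_mono norm_dx_Lambda_inv_le)
      also have "\<dots> = (mu u)^2 * (\<Sum>n\<in>S. Hs_weight ?q n * (cmod (v n))^2)"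
        by (simp add: sum_distrib_left mult_ac)
      also have "\<dots> \<le> nsq s u * nsq ?q v"
        using mu nsq_ge_sum[OF in_Hs_mono(1)[OF uv(2), of ?q] S] by (intro mult_mono sum_nonneg) auto
      also have "\<dots> \<le> nsq s u * nsq s v"
        using in_Hs_mono(2)[OF uv(2), of ?q] by (intro mult_left_mono) auto
      finally show ?thesis .
    qed
    have h: "herm (\<lambda>n. of_real (mu u) * dx (Lambda_mu_inv2 v) n)"
      using dx_Lambda_inv_herm[OF in_Hs_herm[OF uv(2)]] by (simp add: herm_def)
    show "in_Hs ?q (\<lambda>n. of_real (mu u) * dx (Lambda_mu_inv2 v) n)"
      "nsq ?q (\<lambda>n. of_real (mu u) * dx (Lambda_mu_inv2 v) n) \<le> nsq s u * nsq s v"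
      using in_Hs_bounded[OF h *] by auto
  qed
  have scale: "in_Hs ?q (\<lambda>n. 3 * v n)" "nsq ?q (\<lambda>n. 3 * v n) = 9 * nsq ?q v" if "in_Hs ?q v" for v
  proof -
    have eq: "Hs_weight ?q n * (cmod (3 * v n))^2 = 9 * (Hs_weight ?q n * (cmod (v n))^2)" for n
      by (simp add: norm_mult power_mult_distrib)
    have "nsq ?q (\<lambda>n. 3 * v n) = (\<Sum>\<^sub>\<infinity>n. 9 * (Hs_weight ?q n * (cmod (v n))^2))"
      unfolding nsq_def eq ..
    then show "nsq ?q (\<lambda>n. 3 * v n) = 9 * nsq ?q v"
      unfolding nsq_def infsum_cmult_right' .
    have "(\<lambda>n. 9 * (Hs_weight ?q n * (cmod (v n))^2)) summable_on UNIV"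
      using in_Hs_summable[OF that] by (rule summable_on_cmult_right)
    then show "in_Hs ?q (\<lambda>n. 3 * v n)"
      using that unfolding in_Hs_def eq by simp
  qed
  have prod: "in_Hs ?q (conv u (dx v))" "nsq ?q (conv u (dx v)) \<le> D * nsq s u * nsq s v"
    if uv: "in_Hs s u" "in_Hs s v" for u v
  proof -
    show "in_Hs ?q (conv u (dx v))"
      using in_Hs_mono(1)[OF uv(1), of ?q] in_Hs_dx(1)[OF uv(2)] D(2) by simp
    have "nsq ?q (conv u (dx v)) \<le> D * nsq ?q u * nsq ?q (dx v)"
      using in_Hs_mono(1)[OF uv(1), of ?q] in_Hs_dx(1)[OF uv(2)] D(3) by simp
    also have "\<dots> \<le> D * nsq s u * nsq s v"
      using in_Hs_mono(2)[OF uv(1), of ?q] in_Hs_dx(2)[OF uv(2)] D(1) by (intro mult_mono) auto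
    finally show "nsq ?q (conv u (dx v)) \<le> D * nsq s u * nsq s v" .
  qed
  show thesis
  proof (rule that)
    \<comment> \<open>With X and Y the transport and nonlocal differences below, the squared norm of
      -X - 3Y is at most 2 |X|^2 + 18 |Y|^2; the two parts contribute 2 times 2D and 18 times
      2.\<close>
    show "0 < 4 * D + 36" using D(1) by simp
    show "in_Hs ?q (mudp_rhs u)" if "in_Hs s u" for u
      using in_Hs_diff(1)[OF in_Hs_uminus[OF prod(1)[OF that that]] scale(1)[OF lin(1)[OF that that]]]
      by (simp add: mudp_rhs_def mult.assoc)
    fix u v assume uv: "in_Hs s u" "in_Hs s v"
    let ?z = "\<lambda>n. u n - v n"
    have z: "in_Hs s ?z" by (rule in_Hs_diff(1)[OF uv])
    have ell: "ell1 u" "ell1 v" "ell1 (dx u)" "ell1 (dx v)"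
      using in_Hs_mono(1)[OF uv(1), of ?q] in_Hs_mono(1)[OF uv(2), of ?q] in_Hs_dx(1)[OF uv(1)] in_Hs_dx(1)[OF uv(2)]
      by (simp_all add: E)
    let ?X = "\<lambda>n. conv u (dx ?z) n + conv ?z (dx v) n"
    let ?Y = "\<lambda>n. of_real (mu u) * dx (Lambda_mu_inv2 ?z) n + of_real (mu ?z) * dx (Lambda_mu_inv2 v) n"
    have eq: "mudp_rhs u n - mudp_rhs v n = - ?X n - 3 * ?Y n" for n
    proof -
      have "conv u (dx u) n - conv v (dx v) n = ?X n"
        using conv_diff[OF ell] by (simp add: dx_diff)
      moreover have "of_real (mu u) * dx (Lambda_mu_inv2 u) n - of_real (mu v) * dx (Lambda_mu_inv2 v) n = ?Y n"
        unfolding dx_Lambda_inv_diff mu_def by (simp add: algebra_simps)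
      ultimately show ?thesis
        by (simp add: mudp_rhs_def algebra_simps)
    qed
    have X: "in_Hs ?q ?X" "nsq ?q ?X \<le> 2 * D * (nsq s u + nsq s v) * nsq s ?z"
      using in_Hs_add[OF prod(1)[OF uv(1) z] prod(1)[OF z uv(2)]] prod(2)[OF uv(1) z] prod(2)[OF z uv(2)]
      by (auto simp: algebra_simps)
    have Y: "in_Hs ?q ?Y" "nsq ?q ?Y \<le> 2 * (nsq s u + nsq s v) * nsq s ?z"
      using in_Hs_add[OF lin(1)[OF uv(1) z] lin(1)[OF z uv(2)]] lin(2)[OF uv(1) z] lin(2)[OF z uv(2)]
      by (auto simp: algebra_simps)
    have "nsq ?q (\<lambda>n. mudp_rhs u n - mudp_rhs v n) = nsq ?q (\<lambda>n. - ?X n - 3 * ?Y n)"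
      unfolding eq ..
    also have "\<dots> \<le> 2 * nsq ?q (\<lambda>n. - ?X n) + 2 * nsq ?q (\<lambda>n. 3 * ?Y n)"
      by (rule in_Hs_diff(2)[OF in_Hs_uminus[OF X(1)] scale(1)[OF Y(1)]])
    also have "\<dots> = 2 * nsq ?q ?X + 18 * nsq ?q ?Y"
      unfolding nsq_uminus scale(2)[OF Y(1)] by simp
    also have "\<dots> \<le> (4 * D + 36) * (nsq s u + nsq s v) * nsq s ?z"
      using X(2) Y(2) by (simp add: algebra_simps)
    finally show "nsq ?q (\<lambda>n. mudp_rhs u n - mudp_rhs v n) \<le> (4 * D + 36) * (nsq s u + nsq s v) * nsq s ?z" .
  qed
qed

section \<open>The weighted energy estimate\<close>

text \<open>Commuting a weight past the transport term leaves the factor m (w(n) - w(m)). The right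
  side puts the derivative on index n - m and the weight on m, or the other way round, so that one
  of the three factors is measured by the Wiener norm of the derivative and the other two by the
  weighted energy.\<close>

definition comm_weight :: "real \<Rightarrow> (int \<Rightarrow> real) \<Rightarrow> bool" where
  "comm_weight C \<omega> \<longleftrightarrow> (\<forall>n. 0 \<le> \<omega> n) \<and>
     (\<forall>n m. \<bar>real_of_int m\<bar> * \<bar>\<omega> n - \<omega> m\<bar>
        \<le> C * (\<bar>real_of_int (n - m)\<bar> * \<omega> m + \<bar>real_of_int m\<bar> * \<omega> (n - m)))"

lemma power_minus_one_le:
  fixes r :: real assumes "1 \<le> r"
  shows "r ^ p - 1 \<le> real p * (r - 1) * r ^ p"
proof (induction p)
  case (Suc p)
  have "r ^ Suc p - 1 = r * (r ^ p - 1) + (r - 1) * 1"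
    by (simp add: algebra_simps)
  also have "\<dots> \<le> r * (real p * (r - 1) * r ^ p) + (r - 1) * r ^ Suc p"
    using assms Suc one_le_power[OF assms, of "Suc p"] by (intro add_mono mult_left_mono) auto
  also have "\<dots> = real (Suc p) * (r - 1) * r ^ Suc p"
    by (simp add: algebra_simps)
  finally show ?case .
qed auto

lemma jap_le_scaled:
  assumes "\<bar>n\<bar> \<le> c * \<bar>m\<bar>" "1 \<le> c"
  shows "jap n \<le> (real_of_int c)^2 * jap m"
proof -
  have "\<bar>real_of_int n\<bar> \<le> real_of_int c * \<bar>real_of_int m\<bar>"
    using of_int_le_iff[of "\<bar>n\<bar>" "c * \<bar>m\<bar>", where ?'a = real] assms(1) by simp
  from power_mono[OF this, of 2] have "(real_of_int n)^2 \<le> (real_of_int c)^2 * (real_of_int m)^2"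
    by (simp add: power_mult_distrib)
  then have "4 * pi^2 * (real_of_int n)^2 \<le> 4 * pi^2 * ((real_of_int c)^2 * (real_of_int m)^2)"
    by (intro mult_left_mono) auto
  moreover have "1 \<le> (real_of_int c)^2"
    using assms(2) by simp
  moreover have "(real_of_int c)^2 * jap m = (real_of_int c)^2 + 4 * pi^2 * ((real_of_int c)^2 * (real_of_int m)^2)"
    by (simp add: jap_def algebra_simps)
  ultimately show ?thesis
    unfolding jap_def[of n] by linarith
qed

text \<open>Nondecreasing functions of \<open>jap\<close> of polynomial growth qualify, with a
  constant that depends on the growth exponent p alone. If n - m is small against m, then n and m
  are comparable and a discrete mean value bound applies. Otherwise both weights are controlled by
  the weight at n - m.\<close>

lemma growth_comm_weight:
  fixes \<phi> :: "real \<Rightarrow> real"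
  assumes nonneg: "\<And>x. 1 \<le> x \<Longrightarrow> 0 \<le> \<phi> x"
    and mono: "\<And>x y. 1 \<le> x \<Longrightarrow> x \<le> y \<Longrightarrow> \<phi> x \<le> \<phi> y"
    and growth: "\<And>x y. 1 \<le> x \<Longrightarrow> x \<le> y \<Longrightarrow> \<phi> y \<le> (y / x) ^ p * \<phi> x"
  shows "comm_weight (10 * real p * 4 ^ p + 9 ^ p) (\<lambda>n. \<phi> (jap n))"
  unfolding comm_weight_def
proof (intro conjI allI)
  show "0 \<le> \<phi> (jap n)" for n
    by (intro nonneg jap_ge_1)
  fix n m :: int
  let ?k = "n - m" and ?A = "10 * real p * 4 ^ p" and ?B = "9 ^ p :: real"
  have pos: "0 \<le> \<phi> (jap m)" "0 \<le> \<phi> (jap ?k)"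
    by (intro nonneg jap_ge_1)+
  consider "m = 0" | "m \<noteq> 0" "2 * \<bar>?k\<bar> \<le> \<bar>m\<bar>" | "\<bar>m\<bar> < 2 * \<bar>?k\<bar>"
    by linarith
  then show "\<bar>real_of_int m\<bar> * \<bar>\<phi> (jap n) - \<phi> (jap m)\<bar>
      \<le> (?A + ?B) * (\<bar>real_of_int ?k\<bar> * \<phi> (jap m) + \<bar>real_of_int m\<bar> * \<phi> (jap ?k))"
  proof cases
    case 1
    then show ?thesis using pos by simp
  next
    case 2
    define lo where "lo = min (jap n) (jap m)"
    define hi where "hi = max (jap n) (jap m)"
    define r where "r = hi / lo"
    have lo: "1 \<le> lo" "lo \<le> hi" "lo \<le> jap m"
      using jap_ge_1[of n] jap_ge_1[of m] by (auto simp: lo_def hi_def)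
    have "jap n \<le> 4 * jap m" "jap m \<le> 4 * jap n"
    proof -
      have "\<bar>n\<bar> \<le> 2 * \<bar>m\<bar>" using 2(2) by (smt (verit))
      moreover have "\<bar>m\<bar> \<le> 2 * \<bar>n\<bar>" using 2(2) by (smt (verit))
      ultimately show "jap n \<le> 4 * jap m" "jap m \<le> 4 * jap n"
        using jap_le_scaled[of n 2 m] jap_le_scaled[of m 2 n] by auto
    qed
    then have "hi \<le> 4 * lo"
      using jap_pos[of n] jap_pos[of m] by (auto simp: lo_def hi_def min_def max_def)
    then have r: "1 \<le> r" "r \<le> 4"
      using lo by (auto simp: r_def field_simps)
    have rp: "r ^ p \<le> 4 ^ p"
      using r by (intro power_mono) auto
    have "m^2 \<le> 4 * n^2"
    proof -
      have "\<bar>m\<bar> \<le> 2 * \<bar>n\<bar>" using 2(2) by (smt (verit))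
      from power_mono[OF this, of 2] show ?thesis by (simp add: power_mult_distrib)
    qed
    then have m2: "(real_of_int m)^2 \<le> 4 * (real_of_int n)^2"
      using of_int_le_iff[of "m^2" "4 * n^2", where ?'a = real] by simp
    have "pi^2 * (real_of_int m)^2 \<le> jap n"
      unfolding jap_def using mult_left_mono[OF m2 zero_le_power2[of pi]] by linarith
    moreover have "pi^2 * (real_of_int m)^2 \<le> jap m"
      unfolding jap_def using mult_nonneg_nonneg[OF zero_le_power2[of pi] zero_le_power2[of "real_of_int m"]] by linarith
    ultimately have lom: "pi^2 * (real_of_int m)^2 \<le> lo"
      by (simp add: lo_def)
    have "2 * \<bar>n + m\<bar> \<le> 5 * \<bar>m\<bar>"
      using 2(2) by (smt (verit))
    then have nm: "\<bar>real_of_int (n + m)\<bar> \<le> 5/2 * \<bar>real_of_int m\<bar>"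
      using of_int_le_iff[of "2 * \<bar>n + m\<bar>" "5 * \<bar>m\<bar>", where ?'a = real] by simp
    have "hi - lo = \<bar>jap n - jap m\<bar>"
      by (auto simp: hi_def lo_def)
    also have "jap n - jap m = 4 * pi^2 * (real_of_int ?k * real_of_int (n + m))"
      by (simp add: jap_def power2_eq_square algebra_simps)
    also have "\<bar>\<dots>\<bar> = 4 * pi^2 * (\<bar>real_of_int ?k\<bar> * \<bar>real_of_int (n + m)\<bar>)"
      by (simp add: abs_mult)
    also have "\<dots> \<le> 4 * pi^2 * (\<bar>real_of_int ?k\<bar> * (5/2 * \<bar>real_of_int m\<bar>))"
      using nm by (intro mult_left_mono) auto
    finally have "\<bar>real_of_int m\<bar> * (hi - lo) \<le> \<bar>real_of_int m\<bar> * (4 * pi^2 * (\<bar>real_of_int ?k\<bar> * (5/2 * \<bar>real_of_int m\<bar>)))"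
      by (intro mult_left_mono) auto
    also have "\<dots> = 10 * \<bar>real_of_int ?k\<bar> * (pi^2 * (real_of_int m)^2)"
      by (simp add: power2_eq_square)
    also have "\<dots> \<le> 10 * \<bar>real_of_int ?k\<bar> * lo"
      using lom by (intro mult_left_mono) auto
    \<comment> \<open>The relative increment r - 1 is of order |n - m| / |m|. The 10 is 4 times 5/2:
      \<open>jap n - jap m\<close> is 4 pi^2 (n - m) (n + m), and |n + m| is at most 5/2 |m|. The
      remaining pi^2 m^2 is absorbed by \<open>lo\<close>.\<close>
    finally have mr: "\<bar>real_of_int m\<bar> * (r - 1) \<le> 10 * \<bar>real_of_int ?k\<bar>"
      using lo by (simp add: r_def field_simps)
    have "\<bar>\<phi> (jap n) - \<phi> (jap m)\<bar> = \<phi> hi - \<phi> lo"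
      using mono[of "jap n" "jap m"] mono[of "jap m" "jap n"] jap_ge_1[of n] jap_ge_1[of m]
      by (auto simp: hi_def lo_def min_def max_def)
    also have "\<dots> \<le> (r ^ p - 1) * \<phi> lo"
      using growth[OF lo(1,2)] by (simp add: r_def algebra_simps)
    also have "\<dots> \<le> (real p * (r - 1) * r ^ p) * \<phi> lo"
      by (intro mult_right_mono power_minus_one_le r nonneg lo)
    also have "\<dots> \<le> (real p * (r - 1) * 4 ^ p) * \<phi> (jap m)"
      using r rp lo mono[OF lo(1,3)] nonneg[OF lo(1)] by (intro mult_mono) auto
    finally have "\<bar>real_of_int m\<bar> * \<bar>\<phi> (jap n) - \<phi> (jap m)\<bar>
        \<le> \<bar>real_of_int m\<bar> * ((real p * (r - 1) * 4 ^ p) * \<phi> (jap m))"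
      by (intro mult_left_mono) auto
    also have "\<dots> = (real p * 4 ^ p * \<phi> (jap m)) * (\<bar>real_of_int m\<bar> * (r - 1))"
      by simp
    also have "\<dots> \<le> (real p * 4 ^ p * \<phi> (jap m)) * (10 * \<bar>real_of_int ?k\<bar>)"
      using pos by (intro mult_left_mono mr) auto
    also have "\<dots> = ?A * (\<bar>real_of_int ?k\<bar> * \<phi> (jap m))"
      by simp
    also have "\<dots> \<le> (?A + ?B) * (\<bar>real_of_int ?k\<bar> * \<phi> (jap m) + \<bar>real_of_int m\<bar> * \<phi> (jap ?k))"
      using pos by (intro mult_mono) auto
    finally show ?thesis .
  next
    case 3
    \<comment> \<open>Here |m| < 2 |n - m| and hence |n| < 3 |n - m|; the 9 is the square of
      3.\<close>
    have "jap n \<le> 9 * jap ?k" "jap m \<le> 9 * jap ?k"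
    proof -
      have "\<bar>n\<bar> \<le> 3 * \<bar>?k\<bar>" using 3 by (smt (verit))
      moreover have "\<bar>m\<bar> \<le> 3 * \<bar>?k\<bar>" using 3 by (smt (verit))
      ultimately show "jap n \<le> 9 * jap ?k" "jap m \<le> 9 * jap ?k"
        using jap_le_scaled[of n 3 ?k] jap_le_scaled[of m 3 ?k] by auto
    qed
    then have "\<phi> (jap n) \<le> \<phi> (9 * jap ?k)" "\<phi> (jap m) \<le> \<phi> (9 * jap ?k)"
      by (auto intro!: mono jap_ge_1)
    moreover have "\<phi> (9 * jap ?k) \<le> 9 ^ p * \<phi> (jap ?k)"
      using growth[OF jap_ge_1, of ?k "9 * jap ?k"] jap_pos[of ?k] by (simp add: less_imp_neq[symmetric])
    ultimately have "\<bar>\<phi> (jap n) - \<phi> (jap m)\<bar> \<le> ?B * \<phi> (jap ?k)"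
      using nonneg[OF jap_ge_1, of n] pos by linarith
    then have "\<bar>real_of_int m\<bar> * \<bar>\<phi> (jap n) - \<phi> (jap m)\<bar> \<le> ?B * (\<bar>real_of_int m\<bar> * \<phi> (jap ?k))"
      by (simp add: mult.left_commute mult_left_mono)
    also have "\<dots> \<le> (?A + ?B) * (\<bar>real_of_int ?k\<bar> * \<phi> (jap m) + \<bar>real_of_int m\<bar> * \<phi> (jap ?k))"
      using pos by (intro mult_mono) auto
    finally show ?thesis .
  qed
qed

text \<open>For \<open>K = 1\<close> this is the square root of the Sobolev weight; for large \<open>K\<close> it damps the
  frequencies with \<open>jap n < K\<close> while satisfying the same commutator bound.\<close>

definition tail_weight :: "real \<Rightarrow> real \<Rightarrow> int \<Rightarrow> real" where
  "tail_weight s K n = Hs_weight (s/2) n * min 1 (jap n / K)"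

text \<open>The point is uniformity in K: the factor min 1 (x / K) grows with exponent at most 1
  whatever K is.\<close>

lemma tail_weight_comm:
  assumes "0 \<le> s"
  obtains C where "0 < C" "\<And>K. 1 \<le> K \<Longrightarrow> comm_weight C (tail_weight s K)"
proof -
  \<comment> \<open>An integer exponent that dominates s/2, plus one for the cut-off factor.\<close>
  define p where "p = nat \<lceil>s/2\<rceil> + 1"
  have p: "s/2 \<le> real (nat \<lceil>s/2\<rceil>)" by linarith
  have "comm_weight (10 * real p * 4 ^ p + 9 ^ p) (tail_weight s K)" if K: "1 \<le> K" for K
  proof -
    define \<phi> where "\<phi> x = x powr (s/2) * min 1 (x / K)" for x
    have "comm_weight (10 * real p * 4 ^ p + 9 ^ p) (\<lambda>n. \<phi> (jap n))"
    proof (rule growth_comm_weight)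
      show "0 \<le> \<phi> x" if "1 \<le> x" for x
        using K that by (simp add: \<phi>_def)
      fix x y :: real assume xy: "1 \<le> x" "x \<le> y"
      show "\<phi> x \<le> \<phi> y"
        unfolding \<phi>_def using xy K assms
        by (intro mult_mono powr_mono2 min.mono divide_right_mono) auto
      have "y powr (s/2) = (y / x) powr (s/2) * x powr (s/2)"
        using xy by (simp flip: powr_mult)
      also have "(y / x) powr (s/2) \<le> (y / x) powr (real (nat \<lceil>s/2\<rceil>))"
        using xy p by (intro powr_mono) auto
      also have "\<dots> = (y / x) ^ (nat \<lceil>s/2\<rceil>)"
        using xy by (intro powr_realpow) auto
      finally have 1: "y powr (s/2) \<le> (y / x) ^ (nat \<lceil>s/2\<rceil>) * x powr (s/2)"
        by (simp add: mult_right_mono)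
      have 2: "min 1 (y / K) \<le> (y / x) * min 1 (x / K)"
      proof (cases "x \<le> K")
        case True
        then have "min 1 (x / K) = x / K" using K by auto
        then show ?thesis using xy K by simp
      next
        case False
        then have "min 1 (x / K) = 1" using K by auto
        moreover have "1 \<le> y / x" using xy by simp
        ultimately show ?thesis by (simp add: min_le_iff_disj)
      qed
      have "\<phi> y \<le> ((y / x) ^ (nat \<lceil>s/2\<rceil>) * x powr (s/2)) * ((y / x) * min 1 (x / K))"
        unfolding \<phi>_def using xy K by (intro mult_mono 1 2) auto
      then show "\<phi> y \<le> (y / x) ^ p * \<phi> x"
        by (simp add: \<phi>_def p_def mult_ac)
    qed
    then show ?thesis
      by (simp add: \<phi>_def tail_weight_def[abs_def] Hs_weight_jap)
  qed
  moreover have "0 < 10 * real p * 4 ^ p + (9::real) ^ p"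
    by (intro add_nonneg_pos) auto
  ultimately show thesis by (rule that[rotated])
qed

lemma tail_weight_1: "(tail_weight s 1 n)^2 = Hs_weight s n"
  using jap_ge_1[of n] by (simp add: tail_weight_def min_def Hs_weight_half_sq)

lemma tail_weight_sq_le: "1 \<le> K \<Longrightarrow> (tail_weight s K n)^2 \<le> Hs_weight s n"
  unfolding tail_weight_def power_mult_distrib Hs_weight_half_sq
  by (intro mult_left_le power_le_one) (auto simp: less_imp_le)

lemma tail_weight_eq: "1 \<le> K \<Longrightarrow> K \<le> jap n \<Longrightarrow> (tail_weight s K n)^2 = Hs_weight s n"
  unfolding tail_weight_def power_mult_distrib Hs_weight_half_sq by (simp add: min_def)

section \<open>The transport form and the flux of weighted energies\<close>

lemma conv_support:
  assumes "\<And>m. m \<notin> M \<Longrightarrow> w m = 0" "finite M"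
  shows "conv v w n = (\<Sum>m\<in>M. v (n - m) * w m)"
proof -
  have "conv v w n = (\<Sum>\<^sub>\<infinity>m\<in>M. v (n - m) * w m)"
    unfolding conv_altdef using assms(1) by (intro infsum_cong_neutral) auto
  then show ?thesis using assms(2) by simp
qed

lemma dx_support: "v n = 0 \<Longrightarrow> dx v n = 0"
  by (simp add: dx_def)

text \<open>Integration by parts on the Fourier side. Conjugation exchanges n and m because u is
  real-valued, and the form plus its conjugate carries the factor m - n in place of m, which is
  minus the derivative on u. Truncation causes no error because both indices run through the same
  set.\<close>

lemma transport_antisymmetric:
  assumes "herm u"
  shows "2 * Re (\<Sum>n\<in>A. \<Sum>m\<in>A. cnj (a n) * u (n - m) * dx a m)
    = - Re (\<Sum>n\<in>A. \<Sum>m\<in>A. cnj (a n) * dx u (n - m) * a m)"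
proof -
  let ?S = "\<Sum>n\<in>A. \<Sum>m\<in>A. cnj (a n) * u (n - m) * dx a m"
  have "cnj ?S = (\<Sum>n\<in>A. \<Sum>m\<in>A. a n * cnj (u (n - m)) * cnj (dx a m))"
    by simp
  also have "\<dots> = (\<Sum>m\<in>A. \<Sum>n\<in>A. a n * cnj (u (n - m)) * cnj (dx a m))"
    by (rule sum.swap)
  also have "\<dots> = (\<Sum>n\<in>A. \<Sum>m\<in>A. a m * u (n - m) * cnj (dx a n))"
  proof (intro sum.cong refl)
    fix n m
    have "cnj (u (m - n)) = u (n - m)"
      using assms by (metis herm_def minus_diff_eq)
    then show "a m * cnj (u (m - n)) * cnj (dx a n) = a m * u (n - m) * cnj (dx a n)" by simp
  qed
  finally have cnj_S: "cnj ?S = (\<Sum>n\<in>A. \<Sum>m\<in>A. a m * u (n - m) * cnj (dx a n))" .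
  have "?S + cnj ?S = (\<Sum>n\<in>A. \<Sum>m\<in>A. cnj (a n) * u (n - m) * dx a m + a m * u (n - m) * cnj (dx a n))"
    unfolding cnj_S by (simp only: sum.distrib)
  also have "\<dots> = (\<Sum>n\<in>A. \<Sum>m\<in>A. - (cnj (a n) * dx u (n - m) * a m))"
    by (intro sum.cong refl) (simp add: dx_def algebra_simps)
  also have "\<dots> = - (\<Sum>n\<in>A. \<Sum>m\<in>A. cnj (a n) * dx u (n - m) * a m)"
    by (simp add: sum_negf)
  finally have eq: "?S + cnj ?S = - (\<Sum>n\<in>A. \<Sum>m\<in>A. cnj (a n) * dx u (n - m) * a m)" .
  have "Re (z + cnj z) = 2 * Re z" for z by simp
  from this[of ?S] show ?thesis unfolding eq by (simp only: uminus_complex.sel)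
qed

lemma transport_form_le:
  assumes "herm u" "ell1 (dx u)" "finite A"
  shows "\<bar>Re (\<Sum>n\<in>A. \<Sum>m\<in>A. cnj (a n) * u (n - m) * dx a m)\<bar> \<le> 1/2 * l1n (dx u) * (\<Sum>n\<in>A. (cmod (a n))^2)"
proof -
  have "2 * \<bar>Re (\<Sum>n\<in>A. \<Sum>m\<in>A. cnj (a n) * u (n - m) * dx a m)\<bar>
      = \<bar>Re (\<Sum>n\<in>A. \<Sum>m\<in>A. cnj (a n) * dx u (n - m) * a m)\<bar>"
    using transport_antisymmetric[OF assms(1), of a A] by linarith
  also have "\<dots> \<le> (\<Sum>n\<in>A. \<Sum>m\<in>A. cmod (dx u (n - m)) * cmod (a n) * cmod (a m))"
    by (intro order.trans[OF abs_Re_le_cmod] sum_norm_le) (simp add: norm_mult mult_ac)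
  also have "\<dots> \<le> l1n (dx u) * (sqrt (\<Sum>n\<in>A. (cmod (a n))^2) * sqrt (\<Sum>n\<in>A. (cmod (a n))^2))"
    using assms by (intro Young_form l1n_ge_sum) auto
  also have "\<dots> = l1n (dx u) * (\<Sum>n\<in>A. (cmod (a n))^2)"
    by (simp add: sum_nonneg flip: power2_eq_square)
  finally show ?thesis by simp
qed

lemma finite_support_ell1:
  assumes "\<And>n. n \<notin> modes N \<Longrightarrow> v n = 0" shows "ell1 v"
proof (rule ell1_bounded)
  fix S :: "int set" assume "finite S"
  then have "(\<Sum>n\<in>S. cmod (v n)) = (\<Sum>n\<in>S \<inter> modes N. cmod (v n))"
    using assms by (intro sum.mono_neutral_right) auto
  also have "\<dots> \<le> (\<Sum>n\<in>modes N. cmod (v n))"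
    by (intro sum_mono2) auto
  finally show "(\<Sum>n\<in>S. cmod (v n)) \<le> (\<Sum>n\<in>modes N. cmod (v n))" .
qed

text \<open>One of the two factors w(n) is moved to the index m. The main part is then the transport
  form of a = w v, which accounts for the 1/2; the remainder contains w(n) - w(m) and splits by
  \<open>comm_weight\<close> into two Young forms with constant C each. The factor 2 in
  \<open>2 * C\<close> counts these.\<close>

lemma energy_flux_le:
  assumes v: "herm v" "\<And>n. n \<notin> modes N \<Longrightarrow> v n = 0" and \<omega>: "comm_weight C \<omega>" and C: "0 \<le> C"
  shows "\<bar>Re (\<Sum>n\<in>modes N. of_real ((\<omega> n)^2) * cnj (v n) * conv v (dx v) n)\<bar>
    \<le> (1/2 + 2 * C) * l1n (dx v) * (\<Sum>n\<in>modes N. (\<omega> n)^2 * (cmod (v n))^2)"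
proof -
  let ?E = "\<Sum>n\<in>modes N. (\<omega> n)^2 * (cmod (v n))^2"
  define a where "a n = of_real (\<omega> n) * v n" for n
  have \<omega>0: "0 \<le> \<omega> n" for n using \<omega> by (simp add: comm_weight_def)
  have a2: "(cmod (a n))^2 = (\<omega> n)^2 * (cmod (v n))^2" for n
    by (simp add: a_def norm_mult power_mult_distrib)
  have na: "cmod (a n) = \<omega> n * cmod (v n)" for n
    using \<omega>0 by (simp add: a_def norm_mult)
  have dxv: "ell1 (dx v)" using v(2) by (intro finite_support_ell1[of N]) (simp add: dx_support)
  let ?S1 = "\<Sum>n\<in>modes N. \<Sum>m\<in>modes N. cnj (a n) * v (n - m) * dx a m"
  let ?S2 = "\<Sum>n\<in>modes N. \<Sum>m\<in>modes N. cnj (a n) * v (n - m) * (of_real (\<omega> n - \<omega> m) * dx v m)"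
  have "(\<Sum>n\<in>modes N. of_real ((\<omega> n)^2) * cnj (v n) * conv v (dx v) n) = ?S1 + ?S2"
  proof -
    have "(\<Sum>n\<in>modes N. of_real ((\<omega> n)^2) * cnj (v n) * conv v (dx v) n)
        = (\<Sum>n\<in>modes N. \<Sum>m\<in>modes N. of_real ((\<omega> n)^2) * cnj (v n) * (v (n - m) * dx v m))"
      using v(2) by (intro sum.cong refl) (subst conv_support[of "modes N"], auto simp: dx_support sum_distrib_left)
    also have "\<dots> = (\<Sum>n\<in>modes N. \<Sum>m\<in>modes N. cnj (a n) * v (n - m) * dx a m
        + cnj (a n) * v (n - m) * (of_real (\<omega> n - \<omega> m) * dx v m))"
      by (intro sum.cong refl) (simp add: a_def dx_def power2_eq_square algebra_simps)
    finally show ?thesis by (simp add: sum.distrib)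
  qed
  moreover have "\<bar>Re ?S1\<bar> \<le> 1/2 * l1n (dx v) * ?E"
    using transport_form_le[OF v(1) dxv, of "modes N" a] by (simp add: a2)
  moreover have "\<bar>Re ?S2\<bar> \<le> 2 * C * l1n (dx v) * ?E"
  proof -
    have E: "sqrt ?E * sqrt ?E = ?E"
      by (simp add: sum_nonneg flip: power2_eq_square)
    have "\<bar>Re ?S2\<bar> \<le> (\<Sum>n\<in>modes N. \<Sum>m\<in>modes N. C * (cmod (dx v (n - m)) * cmod (a n) * cmod (a m))
        + C * (cmod (dx v m) * cmod (a n) * cmod (a (n - m))))"
    proof (intro order.trans[OF abs_Re_le_cmod] sum_norm_le)
      fix n m
      have "cmod (cnj (a n) * v (n - m) * (of_real (\<omega> n - \<omega> m) * dx v m))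
          = (2 * pi * cmod (a n) * cmod (v (n - m)) * cmod (v m)) * (\<bar>real_of_int m\<bar> * \<bar>\<omega> n - \<omega> m\<bar>)"
        by (simp add: norm_mult norm_dx del: of_real_diff)
      also have "\<dots> \<le> (2 * pi * cmod (a n) * cmod (v (n - m)) * cmod (v m)) *
          (C * (\<bar>real_of_int (n - m)\<bar> * \<omega> m + \<bar>real_of_int m\<bar> * \<omega> (n - m)))"
        using \<omega> by (intro mult_left_mono) (auto simp: comm_weight_def)
      also have "\<dots> = C * (cmod (dx v (n - m)) * cmod (a n) * cmod (a m))
        + C * (cmod (dx v m) * cmod (a n) * cmod (a (n - m)))"
        unfolding norm_dx na by (simp add: algebra_simps)
      finally show "cmod (cnj (a n) * v (n - m) * (of_real (\<omega> n - \<omega> m) * dx v m)) \<le> \<dots>" .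
    qed
    also have "\<dots> = C * (\<Sum>n\<in>modes N. \<Sum>m\<in>modes N. cmod (dx v (n - m)) * cmod (a n) * cmod (a m))
        + C * (\<Sum>n\<in>modes N. \<Sum>m\<in>modes N. cmod (dx v m) * cmod (a n) * cmod (a (n - m)))"
      by (simp add: sum.distrib sum_distrib_left)
    also have "\<dots> \<le> C * (l1n (dx v) * (sqrt ?E * sqrt ?E)) + C * (l1n (dx v) * (sqrt ?E * sqrt ?E))"
    proof (intro add_mono mult_left_mono C)
      show "(\<Sum>n\<in>modes N. \<Sum>m\<in>modes N. cmod (dx v (n - m)) * cmod (a n) * cmod (a m)) \<le> l1n (dx v) * (sqrt ?E * sqrt ?E)"
        unfolding a2[symmetric] by (intro Young_form l1n_ge_sum dxv) auto
      show "(\<Sum>n\<in>modes N. \<Sum>m\<in>modes N. cmod (dx v m) * cmod (a n) * cmod (a (n - m))) \<le> l1n (dx v) * (sqrt ?E * sqrt ?E)"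
        unfolding a2[symmetric]
      proof (intro Young_form' l1n_ge_sum dxv)
        fix S :: "int set" assume "finite S"
        then have "(\<Sum>k\<in>S. (cmod (a k))^2) = (\<Sum>k\<in>S \<inter> modes N. (cmod (a k))^2)"
          using v(2) by (intro sum.mono_neutral_right) (auto simp: a_def)
        also have "\<dots> \<le> (\<Sum>k\<in>modes N. (cmod (a k))^2)"
          by (intro sum_mono2) auto
        finally show "(\<Sum>k\<in>S. (cmod (a k))^2) \<le> (\<Sum>k\<in>modes N. (cmod (a k))^2)" .
      qed auto
    qed
    finally show ?thesis unfolding E by simp
  qed
  ultimately show ?thesis by (simp add: algebra_simps)
qed

section \<open>Galerkin approximations\<close>

instance bcontfun :: (metric_space, banach) banach ..

text \<open>The exponential weight makes the Picard operator a contraction on the whole of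
  \<open>{-T..T}\<close>, so that no continuation argument is needed.\<close>

lemma global_Picard:
  fixes G :: "'a::banach \<Rightarrow> 'a"
  assumes L: "0 < L" "\<And>x y. norm (G x - G y) \<le> L * norm (x - y)" and T: "0 < T"
  obtains x where "x 0 = x0" "\<And>t. t \<in> {-T..T} \<Longrightarrow> (x has_vector_derivative G (x t)) (at t within {-T..T})"
proof -
  \<comment> \<open>With the weight exp (c |t|) the Picard operator has Lipschitz constant L / c,
    here 1/2.\<close>
  define c where "c = 2 * L"
  \<comment> \<open>Clamping time to \<open>{-T..T}\<close> extends trajectories to bounded
    continuous functions on the real line, which form a complete space.\<close>
  define cl where "cl t = max (- T) (min T t)" for t
  \<comment> \<open>The signed integral from 0 to t; the base point -T gives a single derivative
    formula for both signs of t.\<close>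
  define J where "J f t = integral {-T..t} f - integral {-T..0} f" for f :: "real \<Rightarrow> 'a" and t
  have c: "0 < c" using L by (simp add: c_def)
  have cl: "cl t \<in> {-T..T}" "t \<in> {-T..T} \<Longrightarrow> cl t = t" for t
    using T by (auto simp: cl_def)
  have cont_cl: "continuous_on A cl" for A
    unfolding cl_def by (intro continuous_intros)
  have contG: "continuous_on UNIV G"
  proof (rule lipschitz_on_continuous_on)
    show "L-lipschitz_on UNIV G" using L by (auto simp: lipschitz_on_def dist_norm)
  qed
  have J0: "J f 0 = 0" for f by (simp add: J_def)
  have Jderiv: "(J f has_vector_derivative f t) (at t within {-T..T})"
    if "continuous_on {-T..T} f" "t \<in> {-T..T}" for f t
    using has_vector_derivative_diff[OF integral_has_vector_derivative[OF that] has_vector_derivative_const]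
    unfolding J_def by simp
  have Jcont: "continuous_on {-T..T} (J f)" if "continuous_on {-T..T} f" for f
    using Jderiv[OF that] has_vector_derivative_continuous continuous_on_eq_continuous_within by blast
  \<comment> \<open>The fixed point is sought for exp (-c |t|) x(t); \<open>x'\<close> undoes this
    weight.\<close>
  define x' where "x' y t = exp (c * \<bar>t\<bar>) *\<^sub>R apply_bcontfun y t" for y :: "real \<Rightarrow>\<^sub>C 'a" and t
  have cont_x': "continuous_on A (x' y)" for y A
    unfolding x'_def by (intro continuous_intros) auto
  have cont_Gx: "continuous_on A (\<lambda>r. G (x' y r))" for y A
    using continuous_on_compose2[OF contG cont_x'] by auto
  define \<Psi> where "\<Psi> y t = exp (- c * \<bar>cl t\<bar>) *\<^sub>R (x0 + J (\<lambda>r. G (x' y r)) (cl t))" for y t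
  define \<Phi> where "\<Phi> y = Bcontfun (\<Psi> y)" for y
  have \<Psi>: "\<Psi> y \<in> bcontfun" for y
  proof -
    let ?g = "\<lambda>t. exp (- c * \<bar>t\<bar>) *\<^sub>R (x0 + J (\<lambda>r. G (x' y r)) t)"
    have g: "continuous_on {-T..T} ?g"
      by (intro continuous_intros Jcont cont_Gx)
    have "continuous_on UNIV (\<lambda>t. ?g (cl t))"
      by (rule continuous_on_compose2[OF g cont_cl]) (use cl in auto)
    moreover have "bounded (range (\<lambda>t. ?g (cl t)))"
      by (rule bounded_subset[OF compact_imp_bounded[OF compact_continuous_image[OF g]]]) (use cl in auto)
    ultimately show ?thesis by (auto simp: bcontfun_def \<Psi>_def[abs_def])
  qed
  have app: "apply_bcontfun (\<Phi> y) = \<Psi> y" for y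
    unfolding \<Phi>_def by (rule Bcontfun_inverse[OF \<Psi>])
  have "\<exists>!y. \<Phi> y = y"
  proof (rule banach_fix_type[of "1/2"])
    show "\<forall>y z. dist (\<Phi> y) (\<Phi> z) \<le> 1/2 * dist y z"
    proof (intro allI dist_bound)
      fix y z :: "real \<Rightarrow>\<^sub>C 'a" and t :: real
      define d where "d = dist y z"
      define D where "D r = J (\<lambda>r. G (x' y r)) r - J (\<lambda>r. G (x' z r)) r" for r
      have D0: "D 0 = 0" by (simp add: D_def J0)
      have Dcont: "continuous_on {-T..T} D"
        unfolding D_def by (intro continuous_intros Jcont cont_Gx)
      have Dder: "(D has_vector_derivative (G (x' y r) - G (x' z r))) (at r)" if "-T < r" "r < T" for r
      proof -
        have "(D has_vector_derivative (G (x' y r) - G (x' z r))) (at r within {-T..T})"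
          unfolding D_def using that by (intro has_vector_derivative_diff Jderiv cont_Gx) auto
        then show ?thesis
          using that at_within_interior[of r "{-T..T}"] by (simp add: interior_atLeastAtMost_real)
      qed
      have Dbd: "norm (G (x' y r) - G (x' z r)) \<le> L * d * exp (c * \<bar>r\<bar>)" for r
      proof -
        have "norm (G (x' y r) - G (x' z r)) \<le> L * norm (x' y r - x' z r)" by (rule L(2))
        also have "\<dots> = L * (exp (c * \<bar>r\<bar>) * dist (apply_bcontfun y r) (apply_bcontfun z r))"
          by (simp add: x'_def dist_norm flip: scaleR_diff_right)
        also have "\<dots> \<le> L * (exp (c * \<bar>r\<bar>) * d)"
          unfolding d_def using L(1) by (intro mult_left_mono dist_bounded) auto
        finally show ?thesis by (simp add: mult_ac)
      qed
      define \<tau> where "\<tau> = cl t"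
      have \<tau>: "-T \<le> \<tau>" "\<tau> \<le> T" using cl(1)[of t] by (auto simp: \<tau>_def)
      have "norm (D \<tau>) \<le> L * d / c * exp (c * \<bar>\<tau>\<bar>)"
      proof -
        consider "\<tau> = 0" | "0 < \<tau>" | "\<tau> < 0" by linarith
        then show ?thesis
        proof cases
          case 1
          then show ?thesis using D0 L(1) c by (simp add: d_def)
        next
          case 2
          have "norm (D \<tau> - D 0) \<le> L * d / c * exp (c * \<tau>) - L * d / c * exp (c * 0)"
          proof (rule differentiable_bound_general[OF 2, where \<phi>' = "\<lambda>r. L * d * exp (c * r)"])
            show "continuous_on {0..\<tau>} D" using Dcont \<tau> T by (rule_tac continuous_on_subset) auto
            show "(D has_vector_derivative G (x' y r) - G (x' z r)) (at r)" if "0 < r" "r < \<tau>" for r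
              using that \<tau> T by (intro Dder) auto
            show "((\<lambda>r. L * d / c * exp (c * r)) has_vector_derivative L * d * exp (c * r)) (at r)" for r
              using c by (auto intro!: derivative_eq_intros simp: has_real_derivative_iff_has_vector_derivative[symmetric])
            show "norm (G (x' y r) - G (x' z r)) \<le> L * d * exp (c * r)" if "0 < r" "r < \<tau>" for r
              using Dbd[of r] that by simp
          qed (intro continuous_intros)
          moreover have "0 \<le> L * d / c" using L(1) c by (simp add: d_def)
          ultimately show ?thesis using 2 D0 by simp
        next
          case 3
          have "norm (D 0 - D \<tau>) \<le> - L * d / c * exp (- c * 0) - (- L * d / c * exp (- c * \<tau>))"
          proof (rule differentiable_bound_general[OF 3, where \<phi>' = "\<lambda>r. L * d * exp (- c * r)"])
            show "continuous_on {\<tau>..0} D" using Dcont \<tau> T by (rule_tac continuous_on_subset) auto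
            show "(D has_vector_derivative G (x' y r) - G (x' z r)) (at r)" if "\<tau> < r" "r < 0" for r
              using that \<tau> T by (intro Dder) auto
            show "((\<lambda>r. - L * d / c * exp (- c * r)) has_vector_derivative L * d * exp (- c * r)) (at r)" for r
              using c by (auto intro!: derivative_eq_intros simp: has_real_derivative_iff_has_vector_derivative[symmetric])
            show "norm (G (x' y r) - G (x' z r)) \<le> L * d * exp (- c * r)" if "\<tau> < r" "r < 0" for r
              using Dbd[of r] that by simp
          qed (intro continuous_intros)
          moreover have "0 \<le> L * d / c" using L(1) c by (simp add: d_def)
          ultimately show ?thesis using 3 D0 by simp
        qed
      qed
      then have "exp (- c * \<bar>\<tau>\<bar>) * norm (D \<tau>) \<le> exp (- c * \<bar>\<tau>\<bar>) * (L * d / c * exp (c * \<bar>\<tau>\<bar>))"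
        by (intro mult_left_mono) auto
      also have "\<dots> = 1/2 * d"
        using L(1) by (simp add: c_def exp_minus field_simps)
      finally have "exp (- c * \<bar>\<tau>\<bar>) * norm (D \<tau>) \<le> 1/2 * d" .
      moreover have "dist (\<Psi> y t) (\<Psi> z t) = exp (- c * \<bar>\<tau>\<bar>) * norm (D \<tau>)"
        by (simp add: \<Psi>_def D_def \<tau>_def dist_norm flip: scaleR_diff_right)
      ultimately show "dist (apply_bcontfun (\<Phi> y) t) (apply_bcontfun (\<Phi> z) t) \<le> 1/2 * dist y z"
        by (simp add: app d_def)
    qed
  qed auto
  then obtain y where y: "\<Phi> y = y" by blast
  have eq: "x' y t = x0 + J (\<lambda>r. G (x' y r)) t" if "t \<in> {-T..T}" for t
  proof -
    have "apply_bcontfun y t = \<Psi> y t" using app[of y] y by simp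
    then show ?thesis using cl(2)[OF that] by (simp add: x'_def \<Psi>_def flip: exp_add)
  qed
  show thesis
  proof (rule that[of "x' y"])
    show "x' y 0 = x0" using eq[of 0] T by (simp add: J0)
    fix t assume t: "t \<in> {-T..T}"
    have "((\<lambda>t. x0 + J (\<lambda>r. G (x' y r)) t) has_vector_derivative (0 + G (x' y t))) (at t within {-T..T})"
      by (intro has_vector_derivative_add has_vector_derivative_const Jderiv cont_Gx t)
    then show "(x' y has_vector_derivative G (x' y t)) (at t within {-T..T})"
      using has_vector_derivative_transform[OF t eq] by simp
  qed
qed

text \<open>The difference is split into x - y scaled by the factor of x, and y scaled by the change
  of factor, which is controlled by the change of the norm. Each part costs |x - y|. No inner
  product enters, so the bound applies to the supremum norm.\<close>

lemma radial_retraction_lipschitz: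
  fixes x y :: "'a::real_normed_vector"
  assumes "0 < R"
  shows "norm ((R / max R (norm x)) *\<^sub>R x - (R / max R (norm y)) *\<^sub>R y) \<le> 2 * norm (x - y)"
proof -
  define a where "a = max R (norm x)"
  define b where "b = max R (norm y)"
  have ab: "0 < a" "0 < b" "R \<le> a" "norm y \<le> b" using assms by (auto simp: a_def b_def)
  have "\<bar>b - a\<bar> \<le> norm (x - y)"
    using norm_triangle_ineq3[of x y] by (auto simp: a_def b_def max_def)
  have "(R / a) *\<^sub>R x - (R / b) *\<^sub>R y = (R / a) *\<^sub>R (x - y) + ((R / a) * ((b - a) / b)) *\<^sub>R y"
  proof -
    have "R / b = R / a - (R / a) * ((b - a) / b)"
      using ab by (simp add: field_simps)
    then show ?thesis by (simp add: scaleR_diff_right scaleR_diff_left)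
  qed
  then have "norm ((R / a) *\<^sub>R x - (R / b) *\<^sub>R y) \<le> (R / a) * norm (x - y) + (R / a) * (\<bar>b - a\<bar> / b) * norm y"
    using ab assms norm_triangle_ineq[of "(R / a) *\<^sub>R (x - y)" "((R / a) * ((b - a) / b)) *\<^sub>R y"]
    by (simp add: abs_mult abs_divide)
  also have "(R / a) * (\<bar>b - a\<bar> / b) * norm y = (R / a) * (\<bar>b - a\<bar> * (norm y / b))"
    by simp
  also have "(R / a) * norm (x - y) \<le> 1 * norm (x - y)"
    using ab assms by (intro mult_right_mono) auto
  also have "(R / a) * (\<bar>b - a\<bar> * (norm y / b)) \<le> 1 * (norm (x - y) * 1)"
    using ab assms \<open>\<bar>b - a\<bar> \<le> norm (x - y)\<close> by (intro mult_mono) auto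
  finally show ?thesis by (simp add: a_def b_def)
qed

section \<open>Conservation of energy and construction of the Galerkin flow\<close>

lemma conv_dx_commute: "conv v (dx v) n = (\<Sum>\<^sub>\<infinity>m. dx v (n - m) * v m)"
proof -
  have "conv v (dx v) n = conv (dx v) v n"
    unfolding conv_altdef[of v] by (simp add: conv_def mult.commute)
  then show ?thesis by (simp add: conv_altdef)
qed

text \<open>The cubic form with the derivative on one factor equals the form with it on the other,
  as convolution is commutative. By antisymmetry twice the real part of the first is minus that of
  the second, so both vanish.\<close>

lemma energy_conserved:
  assumes v: "herm v" "\<And>n. n \<notin> modes N \<Longrightarrow> v n = 0"
  shows "Re (\<Sum>n\<in>modes N. cnj (v n) * mudp_rhs v n) = 0"
proof -
  let ?S = "\<Sum>n\<in>modes N. \<Sum>m\<in>modes N. cnj (v n) * v (n - m) * dx v m"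
  have S: "(\<Sum>n\<in>modes N. cnj (v n) * conv v (dx v) n) = ?S"
    using v(2) by (intro sum.cong refl) (subst conv_support[of "modes N"], auto simp: dx_support sum_distrib_left mult.assoc)
  have "conv v (dx v) n = (\<Sum>m\<in>modes N. dx v (n - m) * v m)" for n
    unfolding conv_dx_commute using conv_support[of "modes N" v "dx v" n] v(2) by (simp add: conv_altdef)
  then have S': "?S = (\<Sum>n\<in>modes N. \<Sum>m\<in>modes N. cnj (v n) * dx v (n - m) * v m)"
    unfolding S[symmetric] by (simp add: sum_distrib_left mult.assoc)
  have "Re ?S = 0"
    using transport_antisymmetric[OF v(1), of v "modes N"] unfolding S' by linarith
  moreover have "Re (cnj (v n) * mudp_rhs v n) = - Re (cnj (v n) * conv v (dx v) n)" for n
    using Re_cnj_dx_Lambda_inv[of v n "3 * mu v"] unfolding mudp_rhs_def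
    by (simp add: right_diff_distrib)
  ultimately show ?thesis
    using arg_cong[OF S, of Re] by (simp only: Re_sum sum_negf minus_zero)
qed

lemma weighted_energy_derivative:
  assumes "\<And>n. n \<in> A \<Longrightarrow> ((\<lambda>t. u t n) has_vector_derivative d n) (at t within I)"
  shows "((\<lambda>t. \<Sum>n\<in>A. w n * (cmod (u t n))^2) has_real_derivative
           2 * Re (\<Sum>n\<in>A. of_real (w n) * cnj (u t n) * d n)) (at t within I)"
proof -
  have "((\<lambda>t. w n * (u t n \<bullet> u t n)) has_vector_derivative (w n * (u t n \<bullet> d n + d n \<bullet> u t n))) (at t within I)"
    if "n \<in> A" for n
    by (intro has_vector_derivative_mult_right bounded_bilinear.has_vector_derivative[OF bounded_bilinear_inner] assms that)
  then have "((\<lambda>t. \<Sum>n\<in>A. w n * (u t n \<bullet> u t n)) has_vector_derivative (\<Sum>n\<in>A. w n * (u t n \<bullet> d n + d n \<bullet> u t n))) (at t within I)"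
    by (intro has_vector_derivative_sum)
  moreover have "w n * (u t n \<bullet> d n + d n \<bullet> u t n) = 2 * Re (of_real (w n) * cnj (u t n) * d n)" for n
    by (simp add: inner_complex_def algebra_simps)
  ultimately show ?thesis
    by (simp add: has_real_derivative_iff_has_vector_derivative power2_norm_eq_inner sum_distrib_left)
qed

definition trunc :: "nat \<Rightarrow> (int \<Rightarrow> complex) \<Rightarrow> int \<Rightarrow> complex" where
  "trunc N v = (\<lambda>n. if n \<in> modes N then v n else 0)"

lemma trunc_outside: "n \<notin> modes N \<Longrightarrow> trunc N v n = 0"
  by (simp add: trunc_def)

lemma uminus_mem_modes [simp]: "- n \<in> modes N \<longleftrightarrow> n \<in> modes N"
  by (simp add: mem_modes)

lemma zero_mem_modes [simp]: "0 \<in> modes N"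
  by (simp add: mem_modes)

lemma trunc_herm: "herm v \<Longrightarrow> herm (trunc N v)"
  by (simp add: herm_def trunc_def)

lemma mudp_rhs_herm: "herm v \<Longrightarrow> herm (mudp_rhs v)"
  using conv_herm[of v "dx v"] dx_Lambda_inv_herm[of v] dx_herm[of v]
  by (simp add: herm_def mudp_rhs_def)

text \<open>At fixed N any Lipschitz constant will do, so a derivative is bounded by the largest
  frequency 2 pi N. Differences are measured in the supremum of the coefficients, the norm of the
  sequence space in which the truncated equation is solved.\<close>

lemma mudp_rhs_lipschitz_finite:
  assumes "0 \<le> R"
  obtains L where "0 < L"
    "\<And>f g n e. (\<And>k. k \<notin> modes N \<Longrightarrow> f k = 0) \<Longrightarrow> (\<And>k. k \<notin> modes N \<Longrightarrow> g k = 0) \<Longrightarrow>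
       (\<And>k. cmod (f k) \<le> R) \<Longrightarrow> (\<And>k. cmod (g k) \<le> R) \<Longrightarrow> (\<And>k. cmod (f k - g k) \<le> e) \<Longrightarrow>
       cmod (mudp_rhs f n - mudp_rhs g n) \<le> L * e"
proof
  let ?D = "2 * pi * real N"
  let ?c = "real (card (modes N))"
  let ?L = "?c * (2 * R * ?D) + 6 * R + 1"
  show "0 < ?L" using assms by (intro add_nonneg_pos add_nonneg_nonneg) auto
  fix f g n e
  assume f: "\<And>k. k \<notin> modes N \<Longrightarrow> f k = 0" and g: "\<And>k. k \<notin> modes N \<Longrightarrow> g k = 0"
    and fR: "\<And>k. cmod (f k) \<le> R" and gR: "\<And>k. cmod (g k) \<le> R" and e: "\<And>k. cmod (f k - g k) \<le> e"
  have e0: "0 \<le> e" using e[of 0] norm_ge_zero order.trans by blast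
  have D: "cmod (dx h k) \<le> ?D * cmod (h k)" if "k \<in> modes N" for h k
  proof -
    have "\<bar>real_of_int k\<bar> \<le> real N" using that by (simp add: mem_modes)
    then show ?thesis unfolding norm_dx by (intro mult_right_mono mult_left_mono) auto
  qed
  have conv: "conv h (dx h) n = (\<Sum>m\<in>modes N. h (n - m) * dx h m)" if "\<And>k. k \<notin> modes N \<Longrightarrow> h k = 0" for h
    using that by (intro conv_support) (auto simp: dx_support)
  have "cmod (conv f (dx f) n - conv g (dx g) n) = cmod (\<Sum>m\<in>modes N. f (n - m) * dx f m - g (n - m) * dx g m)"
  proof -
    have "conv f (dx f) n = (\<Sum>m\<in>modes N. f (n - m) * dx f m)" by (rule conv) (rule f)
    moreover have "conv g (dx g) n = (\<Sum>m\<in>modes N. g (n - m) * dx g m)" by (rule conv) (rule g)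
    ultimately show ?thesis by (simp add: sum_subtractf)
  qed
  also have "\<dots> \<le> (\<Sum>m\<in>modes N. 2 * R * ?D * e)"
  proof (rule sum_norm_le)
    fix m assume m: "m \<in> modes N"
    have "cmod (f (n - m) * dx f m - g (n - m) * dx g m)
        = cmod (f (n - m) * dx (\<lambda>k. f k - g k) m + (f (n - m) - g (n - m)) * dx g m)"
      by (simp add: dx_def algebra_simps)
    also have "\<dots> \<le> cmod (f (n - m)) * cmod (dx (\<lambda>k. f k - g k) m) + cmod (f (n - m) - g (n - m)) * cmod (dx g m)"
      by (rule order.trans[OF norm_triangle_ineq]) (simp only: norm_mult order.refl)
    also have "\<dots> \<le> R * (?D * e) + e * (?D * R)"
      using fR gR e e0 assms order.trans[OF D[OF m, of "\<lambda>k. f k - g k"] mult_left_mono[OF e[of m], of ?D]]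
        order.trans[OF D[OF m, of g] mult_left_mono[OF gR[of m], of ?D]]
      by (intro add_mono mult_mono) auto
    finally show "cmod (f (n - m) * dx f m - g (n - m) * dx g m) \<le> 2 * R * ?D * e"
      by (simp add: algebra_simps)
  qed
  finally have 1: "cmod (conv f (dx f) n - conv g (dx g) n) \<le> ?c * (2 * R * ?D) * e" by simp
  have mu: "\<bar>mu f\<bar> \<le> R" "\<bar>mu f - mu g\<bar> \<le> e"
    using order.trans[OF abs_Re_le_cmod fR[of 0]] order.trans[OF abs_Re_le_cmod e[of 0]] by (auto simp: mu_def)
  have "of_real (mu f) * dx (Lambda_mu_inv2 f) n - of_real (mu g) * dx (Lambda_mu_inv2 g) n
     = of_real (mu f) * dx (Lambda_mu_inv2 (\<lambda>n. f n - g n)) n + of_real (mu f - mu g) * dx (Lambda_mu_inv2 g) n"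
    by (simp add: dx_Lambda_inv_diff algebra_simps)
  also have "cmod \<dots> \<le> \<bar>mu f\<bar> * cmod (dx (Lambda_mu_inv2 (\<lambda>n. f n - g n)) n) + \<bar>mu f - mu g\<bar> * cmod (dx (Lambda_mu_inv2 g) n)"
    by (rule order.trans[OF norm_triangle_ineq]) (simp only: norm_mult norm_of_real order.refl)
  also have "\<dots> \<le> R * e + e * R"
    using mu e0 assms order.trans[OF norm_dx_Lambda_inv_le[of "\<lambda>n. f n - g n"] e[of n]]
      order.trans[OF norm_dx_Lambda_inv_le[of g] gR[of n]]
    by (intro add_mono mult_mono) auto
  finally have 2: "cmod (of_real (mu f) * dx (Lambda_mu_inv2 f) n - of_real (mu g) * dx (Lambda_mu_inv2 g) n) \<le> 2 * R * e"
    by simp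
  have triangle: "cmod (- a - 3 * b) \<le> cmod a + 3 * cmod b" for a b
    by (rule order.trans[OF norm_triangle_ineq4]) (simp add: norm_mult)
  have "cmod (mudp_rhs f n - mudp_rhs g n) = cmod (- (conv f (dx f) n - conv g (dx g) n)
      - 3 * (of_real (mu f) * dx (Lambda_mu_inv2 f) n - of_real (mu g) * dx (Lambda_mu_inv2 g) n))"
    by (rule arg_cong[where f = cmod]) (simp add: mudp_rhs_def algebra_simps)
  also have "\<dots> \<le> cmod (conv f (dx f) n - conv g (dx g) n)
      + 3 * cmod (of_real (mu f) * dx (Lambda_mu_inv2 f) n - of_real (mu g) * dx (Lambda_mu_inv2 g) n)"
    by (rule triangle)
  also have "\<dots> \<le> ?c * (2 * R * ?D) * e + 3 * (2 * R * e)"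
    by (intro add_mono mult_left_mono 1 2) simp
  also have "\<dots> \<le> ?L * e"
    unfolding distrib_right using e0 by simp
  finally show "cmod (mudp_rhs f n - mudp_rhs g n) \<le> ?L * e" .
qed

text \<open>The full right-hand side is imposed on the retained modes only: the orthogonal
  projection of the equation. Derivatives are taken within I, hence are one-sided at the ends of a
  closed interval.\<close>

definition galerkin :: "nat \<Rightarrow> real set \<Rightarrow> (real \<Rightarrow> int \<Rightarrow> complex) \<Rightarrow> bool" where
  "galerkin N I v \<longleftrightarrow> (\<forall>t\<in>I. herm (v t) \<and> (\<forall>n. n \<notin> modes N \<longrightarrow> v t n = 0) \<and>
     (\<forall>n\<in>modes N. ((\<lambda>\<tau>. v \<tau> n) has_vector_derivative mudp_rhs (v t) n) (at t within I)))"

lemma Re_of_real_mult: "Re (of_real a * z) = a * Re z"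
  by simp

text \<open>The vector field is made globally Lipschitz by a radial cut-off; conservation of the \<open>l\<^sup>2\<close> norm shows that
  the cut-off is never active. Sequences are indexed by \<open>int discrete\<close> because completeness of the space
  of bounded functions is only available over metric index types.\<close>

lemma galerkin_exists:
  assumes u0: "herm u0" and T: "0 < T"
  obtains v where "galerkin N {-T..T} v" "v 0 = trunc N u0"
proof -
  \<comment> \<open>Adding 1 keeps the radius positive for zero data.\<close>
  define R where "R = sqrt (\<Sum>n\<in>modes N. (cmod (u0 n))^2) + 1"
  have R: "0 < R" unfolding R_def by (intro add_nonneg_pos) (auto intro!: sum_nonneg)
  define app where "app y n = apply_bcontfun y (discrete n)" for y :: "int discrete \<Rightarrow>\<^sub>C complex" and n
  define mk where "mk f = Bcontfun (\<lambda>d. trunc N f (of_discrete d))" for f :: "int \<Rightarrow> complex"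
  have mk: "app (mk f) = trunc N f" for f
  proof -
    have "(\<lambda>d. trunc N f (of_discrete d)) \<in> bcontfun"
    proof (rule bcontfun_normI)
      show "continuous_on UNIV (\<lambda>d. trunc N f (of_discrete d))"
        unfolding continuous_on_open_vimage[OF open_UNIV] by (simp add: open_discrete)
      show "cmod (trunc N f (of_discrete d)) \<le> (\<Sum>n\<in>modes N. cmod (f n))" for d
        using member_le_sum[of "of_discrete d" "modes N" "\<lambda>n. cmod (f n)"] by (auto simp: trunc_def intro!: sum_nonneg)
    qed
    then show ?thesis unfolding mk_def app_def by (auto simp: Bcontfun_inverse discrete_inverse)
  qed
  have app_linear: "app (x + y) n = app x n + app y n" "app (x - y) n = app x n - app y n" "app (r *\<^sub>R x) n = r *\<^sub>R app x n" for x y r n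
    by (simp_all add: app_def)
  have app_le: "cmod (app y n) \<le> norm y" for y n
    unfolding app_def by (rule norm_bounded)
  have app_bound: "norm y \<le> b" if "\<And>n. cmod (app y n) \<le> b" for y b
  proof (rule norm_bound)
    show "cmod (apply_bcontfun y d) \<le> b" for d
      using that[of "of_discrete d"] by (simp add: app_def of_discrete_inverse)
  qed
  define \<rho> where "\<rho> y = (R / max R (norm y)) *\<^sub>R y" for y :: "int discrete \<Rightarrow>\<^sub>C complex"
  \<comment> \<open>Averaging with the reflected conjugate makes \<open>V y\<close> hermitian for
    every y, so that \<open>energy_conserved\<close> applies before the trajectory itself is known
    to be hermitian.\<close>
  define V where "V y = trunc N (\<lambda>n. (app (\<rho> y) n + cnj (app (\<rho> y) (- n))) / 2)" for y
  define G where "G y = mk (mudp_rhs (V y))" for y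
  have V_outside: "V y n = 0" if "n \<notin> modes N" for y n
    using that by (simp add: V_def trunc_outside)
  have V_herm: "herm (V y)" for y
    unfolding V_def by (intro trunc_herm) (simp add: herm_def add.commute)
  have half: "cmod ((a + cnj b) / 2) \<le> e" if "cmod a \<le> e" "cmod b \<le> e" for a b e
    using norm_triangle_ineq[of a "cnj b"] that by (simp add: norm_divide)
  have V_le: "cmod (V y n) \<le> R" for y n
  proof -
    have "norm (\<rho> y) \<le> R"
      using R by (auto simp: \<rho>_def max_def)
    then have "cmod (app (\<rho> y) k) \<le> R" for k
      using app_le[of "\<rho> y" k] by linarith
    from half[OF this[of n] this[of "- n"]] show ?thesis
      using R by (auto simp: V_def trunc_def)
  qed
  have V_diff: "cmod (V x n - V y n) \<le> 2 * norm (x - y)" for x y n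
  proof -
    have *: "cmod (app (\<rho> x) k - app (\<rho> y) k) \<le> 2 * norm (x - y)" for k
      using app_le[of "\<rho> x - \<rho> y" k] radial_retraction_lipschitz[OF R, of x y] by (simp add: \<rho>_def[abs_def] app_linear)
    have "V x n - V y n = (if n \<in> modes N then
        ((app (\<rho> x) n - app (\<rho> y) n) + cnj (app (\<rho> x) (- n) - app (\<rho> y) (- n))) / 2 else 0)"
      by (simp add: V_def trunc_def add_divide_distrib diff_divide_distrib algebra_simps)
    then show ?thesis
      using half[OF *[of n] *[of "- n"]] by auto
  qed
  obtain L where L: "0 < L" and L_le:
    "\<And>f g n e. (\<And>k. k \<notin> modes N \<Longrightarrow> f k = 0) \<Longrightarrow> (\<And>k. k \<notin> modes N \<Longrightarrow> g k = 0) \<Longrightarrow>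
       (\<And>k. cmod (f k) \<le> R) \<Longrightarrow> (\<And>k. cmod (g k) \<le> R) \<Longrightarrow> (\<And>k. cmod (f k - g k) \<le> e) \<Longrightarrow>
       cmod (mudp_rhs f n - mudp_rhs g n) \<le> L * e"
    using mudp_rhs_lipschitz_finite[of R N] R less_imp_le[of 0 R] by metis
  have G_lip: "norm (G x - G y) \<le> (L * 2) * norm (x - y)" for x y
  proof (rule app_bound)
    fix n
    have "cmod (mudp_rhs (V x) n - mudp_rhs (V y) n) \<le> L * (2 * norm (x - y))"
      by (intro L_le V_outside V_le V_diff)
    then show "cmod (app (G x - G y) n) \<le> (L * 2) * norm (x - y)"
      using L by (auto simp: G_def app_linear mk trunc_def)
  qed
  obtain x where x: "x 0 = mk u0"
    "\<And>t. t \<in> {-T..T} \<Longrightarrow> (x has_vector_derivative G (x t)) (at t within {-T..T})"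
    using global_Picard[of "L * 2" G T "mk u0"] L G_lip T by auto
  define v where "v t = app (x t)" for t
  have v0: "v 0 = trunc N u0" by (simp add: v_def x(1) mk)
  have blin: "bounded_linear (\<lambda>y :: int discrete \<Rightarrow>\<^sub>C complex. app y n)" for n
    by (rule bounded_linear_intro[where K = 1]) (use app_le in \<open>auto simp: app_linear\<close>)
  have v_der: "((\<lambda>\<tau>. v \<tau> n) has_vector_derivative trunc N (mudp_rhs (V (x t))) n) (at t within {-T..T})"
    if "t \<in> {-T..T}" for t n
    using bounded_linear.has_vector_derivative[OF blin x(2)[OF that]] by (simp add: v_def G_def mk)
  have const: "f t = f 0"
    if t: "t \<in> {-T..T}" and f: "\<And>r. r \<in> {-T..T} \<Longrightarrow> (f has_vector_derivative 0) (at r within {-T..T})"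
    for f :: "real \<Rightarrow> 'b::real_normed_vector" and t
  proof -
    obtain c where "\<And>r. r \<in> {-T..T} \<Longrightarrow> f r = c"
      using has_vector_derivative_zero_constant[of "{-T..T}" f] f by auto
    then show ?thesis using t T by simp
  qed
  have v_outside: "v t n = 0" if "n \<notin> modes N" "t \<in> {-T..T}" for t n
    using const[of t "\<lambda>t. v t n"] v_der[of _ n] that v0 by (auto simp: trunc_outside)
  have v_herm: "herm (v t)" if t: "t \<in> {-T..T}" for t
    unfolding herm_def
  proof
    fix n
    have "v t (- n) - cnj (v t n) = v 0 (- n) - cnj (v 0 n)"
    proof (rule const[OF t])
      fix r assume r: "r \<in> {-T..T}"
      have "((\<lambda>r. v r (- n) - cnj (v r n)) has_vector_derivative
          trunc N (mudp_rhs (V (x r))) (- n) - cnj (trunc N (mudp_rhs (V (x r))) n)) (at r within {-T..T})"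
        by (intro has_vector_derivative_diff has_vector_derivative_cnj v_der r)
      then show "((\<lambda>r. v r (- n) - cnj (v r n)) has_vector_derivative 0) (at r within {-T..T})"
        using trunc_herm[OF mudp_rhs_herm[OF V_herm[of "x r"]]] by (simp add: herm_def)
    qed
    then show "v t (- n) = cnj (v t n)"
      using trunc_herm[OF u0] by (simp add: v0 herm_def)
  qed
  \<comment> \<open>The cut-off only rescales: along the trajectory \<open>V\<close> is a positive
    multiple of v, and the energy identity for \<open>V\<close> can be divided by that
    factor.\<close>
  define lam where "lam t = R / max R (norm (x t))" for t
  have lam: "0 < lam t" for t using R by (simp add: lam_def)
  have V_eq: "V (x t) = (\<lambda>n. of_real (lam t) * v t n)" if t: "t \<in> {-T..T}" for t
  proof
    fix n
    have "v t (- n) = cnj (v t n)" using v_herm[OF t] by (simp add: herm_def)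
    moreover have "app (\<rho> (x t)) k = of_real (lam t) * v t k" for k
      by (simp add: \<rho>_def lam_def v_def app_linear scaleR_conv_of_real)
    ultimately show "V (x t) n = of_real (lam t) * v t n"
      using v_outside[OF _ t, of n] by (auto simp: V_def trunc_def)
  qed
  have energy: "(\<Sum>n\<in>modes N. (cmod (v t n))^2) = (\<Sum>n\<in>modes N. (cmod (v 0 n))^2)" if t: "t \<in> {-T..T}" for t
  proof (rule const[OF t])
    fix r assume r: "r \<in> {-T..T}"
    have "Re (\<Sum>n\<in>modes N. cnj (V (x r) n) * mudp_rhs (V (x r)) n) = 0"
      by (intro energy_conserved V_herm V_outside)
    also have "(\<Sum>n\<in>modes N. cnj (V (x r) n) * mudp_rhs (V (x r)) n)
        = of_real (lam r) * (\<Sum>n\<in>modes N. of_real 1 * cnj (v r n) * trunc N (mudp_rhs (V (x r))) n)"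
      unfolding sum_distrib_left
    proof (rule sum.cong)
      fix n assume "n \<in> modes N"
      then show "cnj (V (x r) n) * mudp_rhs (V (x r)) n
          = of_real (lam r) * (of_real 1 * cnj (v r n) * trunc N (mudp_rhs (V (x r))) n)"
        unfolding trunc_def using fun_cong[OF V_eq[OF r], of n] by simp
    qed simp
    finally have "Re (\<Sum>n\<in>modes N. of_real 1 * cnj (v r n) * trunc N (mudp_rhs (V (x r))) n) = 0"
      using lam[of r] by (simp add: Re_of_real_mult del: Re_sum)
    then show "((\<lambda>t. \<Sum>n\<in>modes N. (cmod (v t n))^2) has_vector_derivative 0) (at r within {-T..T})"
      using weighted_energy_derivative[of "modes N" v "trunc N (mudp_rhs (V (x r)))" r "{-T..T}" "\<lambda>_. 1"] v_der[OF r]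
      by (simp add: has_real_derivative_iff_has_vector_derivative)
  qed
  \<comment> \<open>The conserved \<open>l^2\<close> norm bounds every coefficient, hence the
    supremum norm, by R; inside this ball the scaling factor is 1.\<close>
  have lam1: "lam t = 1" if t: "t \<in> {-T..T}" for t
  proof -
    have "norm (x t) \<le> R"
    proof (rule app_bound)
      fix n
      have "(cmod (v t n))^2 \<le> (\<Sum>n\<in>modes N. (cmod (u0 n))^2)"
      proof (cases "n \<in> modes N")
        case True
        then have "(cmod (v t n))^2 \<le> (\<Sum>n\<in>modes N. (cmod (v t n))^2)"
          by (intro member_le_sum) auto
        also have "\<dots> = (\<Sum>n\<in>modes N. (cmod (u0 n))^2)"
          unfolding energy[OF t] by (simp add: v0 trunc_def)
        finally show ?thesis .
      next
        case False
        then show ?thesis using v_outside[OF _ t] by (auto intro!: sum_nonneg)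
      qed
      then have "cmod (v t n) \<le> sqrt (\<Sum>n\<in>modes N. (cmod (u0 n))^2)"
        by (rule real_le_rsqrt)
      then show "cmod (app (x t) n) \<le> R" by (simp add: R_def v_def)
    qed
    then show ?thesis using R by (simp add: lam_def max_def)
  qed
  show thesis
  proof (rule that[of v])
    show "v 0 = trunc N u0" by (rule v0)
    show "galerkin N {-T..T} v"
      unfolding galerkin_def
    proof (intro ballI conjI allI impI)
      fix t n assume t: "t \<in> {-T..T}"
      show "herm (v t)" by (rule v_herm[OF t])
      show "v t n = 0" if "n \<notin> modes N" by (rule v_outside[OF that t])
      show "((\<lambda>\<tau>. v \<tau> n) has_vector_derivative mudp_rhs (v t) n) (at t within {-T..T})" if "n \<in> modes N"
        using v_der[OF t, of n] that V_eq[OF t] lam1[OF t] by (simp add: trunc_def)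
    qed
  qed
qed

section \<open>A priori bounds and stability\<close>

lemma mvt_within:
  fixes f :: "real \<Rightarrow> real"
  assumes "a < b" "{a..b} \<subseteq> I" "\<And>t. t \<in> I \<Longrightarrow> (f has_real_derivative f' t) (at t within I)"
  obtains x where "a < x" "x < b" "f b - f a = f' x * (b - a)"
proof -
  have "(f has_derivative (*) (f' t)) (at t within {a..b})" if "t \<in> {a..b}" for t
    using has_field_derivative_subset[OF assms(3) assms(2)] that assms(2)
    by (auto simp: has_field_derivative_def)
  from mvt_simple[OF assms(1) this] show thesis
    using that by (auto simp: greaterThanLessThan_iff)
qed

text \<open>The function f exp (-c (t - a)) - e (t - a) is nonincreasing, because the exponential is
  at most 1 for t >= a.\<close>

lemma gronwall_forward:
  fixes f :: "real \<Rightarrow> real"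
  assumes "a \<le> b" "{a..b} \<subseteq> I" "0 \<le> c" "0 \<le> e"
    and der: "\<And>t. t \<in> I \<Longrightarrow> (f has_real_derivative f' t) (at t within I)"
    and le: "\<And>t. t \<in> I \<Longrightarrow> f' t \<le> c * f t + e"
  shows "f b \<le> (f a + e * (b - a)) * exp (c * (b - a))"
proof (cases "a = b")
  case False
  then have ab: "a < b" using assms(1) by simp
  define g where "g t = f t * exp (- c * (t - a)) - e * (t - a)" for t
  define g' where "g' t = (f' t - c * f t) * exp (- c * (t - a)) - e" for t
  have "(g has_real_derivative g' t) (at t within I)" if "t \<in> I" for t
    unfolding g_def g'_def by (auto intro!: derivative_eq_intros der that simp: algebra_simps)
  from mvt_within[OF ab assms(2) this] obtain x where x: "a < x" "x < b" "g b - g a = g' x * (b - a)"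
    by blast
  have "(f' x - c * f x) * exp (- c * (x - a)) \<le> e * 1"
  proof (rule order.trans[OF mult_right_mono])
    have "x \<in> I" using x assms(2) by auto
    from le[OF this] show "f' x - c * f x \<le> e" by simp
    show "e * exp (- c * (x - a)) \<le> e * 1"
      using x assms(3,4) by (intro mult_left_mono) auto
  qed simp
  then have "g' x \<le> 0" by (simp add: g'_def)
  then have "g b \<le> g a" using x ab by (smt (verit) mult_nonneg_nonneg mult_minus_left)
  then have "f b * exp (- c * (b - a)) \<le> f a + e * (b - a)"
    by (simp add: g_def)
  then have "(f b * exp (- c * (b - a))) * exp (c * (b - a)) \<le> (f a + e * (b - a)) * exp (c * (b - a))"
    by (intro mult_right_mono) auto
  then show ?thesis by (simp add: mult.assoc flip: exp_add)
qed simp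

text \<open>Bounds are needed on both sides of the initial time. A bound on |f'| survives time
  reflection, which turns backward segments into forward ones.\<close>

lemma gronwall:
  fixes f :: "real \<Rightarrow> real"
  assumes seg: "closed_segment a b \<subseteq> I" and "0 \<le> c" "0 \<le> e"
    and der: "\<And>t. t \<in> I \<Longrightarrow> (f has_real_derivative f' t) (at t within I)"
    and le: "\<And>t. t \<in> I \<Longrightarrow> \<bar>f' t\<bar> \<le> c * f t + e"
  shows "f b \<le> (f a + e * \<bar>b - a\<bar>) * exp (c * \<bar>b - a\<bar>)"
proof (cases "a \<le> b")
  case True
  then show ?thesis
    using gronwall_forward[of a b I c e f f'] assms
    by (auto simp: closed_segment_eq_real_ivl intro: order.trans[OF abs_ge_self])
next
  case False
  have "(f \<circ> uminus) (- b) \<le> ((f \<circ> uminus) (- a) + e * (- b - - a)) * exp (c * (- b - - a))"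
  proof (rule gronwall_forward)
    show "- a \<le> - b" using False by simp
    show "{- a..- b} \<subseteq> uminus ` I"
    proof
      fix x assume "x \<in> {- a..- b}"
      then have "- x \<in> I" using seg False by (auto simp: closed_segment_eq_real_ivl)
      then show "x \<in> uminus ` I" by (metis imageI minus_minus)
    qed
    fix t assume "t \<in> uminus ` I"
    then have t: "- t \<in> I" by auto
    have "((f \<circ> uminus) has_real_derivative (f' (- t) * - 1)) (at t within uminus ` I)"
    proof (rule DERIV_image_chain)
      show "(f has_real_derivative f' (- t)) (at (- t) within uminus ` uminus ` I)"
        using der[OF t] by (simp add: image_image)
    qed (auto intro!: derivative_eq_intros)
    then show "((f \<circ> uminus) has_real_derivative - f' (- t)) (at t within uminus ` I)" by simp
    show "- f' (- t) \<le> c * (f \<circ> uminus) t + e" using le[OF t] by simp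
  qed (use assms in auto)
  then show ?thesis using False by simp
qed

lemma galerkin_energy_derivative:
  assumes v: "galerkin N I v" and t: "t \<in> I"
  shows "((\<lambda>t. \<Sum>n\<in>modes N. A n * (cmod (v t n))^2) has_real_derivative
    - 2 * Re (\<Sum>n\<in>modes N. of_real (A n) * cnj (v t n) * conv (v t) (dx (v t)) n)) (at t within I)"
proof -
  have "((\<lambda>t. \<Sum>n\<in>modes N. A n * (cmod (v t n))^2) has_real_derivative
      2 * Re (\<Sum>n\<in>modes N. of_real (A n) * cnj (v t n) * mudp_rhs (v t) n)) (at t within I)"
    using v t by (intro weighted_energy_derivative) (auto simp: galerkin_def)
  moreover have "Re (of_real (A n) * cnj (v t n) * mudp_rhs (v t) n)
      = - Re (of_real (A n) * cnj (v t n) * conv (v t) (dx (v t)) n)" for n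
  proof -
    have "Re (cnj (v t n) * mudp_rhs (v t) n) = - Re (cnj (v t n) * conv (v t) (dx (v t)) n)"
      using Re_cnj_dx_Lambda_inv[of "v t" n "3 * mu (v t)"] unfolding mudp_rhs_def
      by (simp add: right_diff_distrib)
    then show ?thesis by (simp only: mult.assoc Re_of_real_mult mult_minus_right)
  qed
  then have "Re (\<Sum>n\<in>modes N. of_real (A n) * cnj (v t n) * mudp_rhs (v t) n)
      = - Re (\<Sum>n\<in>modes N. of_real (A n) * cnj (v t n) * conv (v t) (dx (v t)) n)"
    by (simp only: Re_sum sum_negf)
  ultimately show ?thesis by simp
qed

lemma galerkin_weighted_bound:
  assumes v: "galerkin N I v" and seg: "closed_segment a b \<subseteq> I" and c: "0 \<le> c"
    and le: "\<And>t. t \<in> I \<Longrightarrow> \<bar>Re (\<Sum>n\<in>modes N. of_real (A n) * cnj (v t n) * conv (v t) (dx (v t)) n)\<bar>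
      \<le> c * (\<Sum>n\<in>modes N. A n * (cmod (v t n))^2)"
  shows "(\<Sum>n\<in>modes N. A n * (cmod (v b n))^2) \<le> exp (2 * c * \<bar>b - a\<bar>) * (\<Sum>n\<in>modes N. A n * (cmod (v a n))^2)"
proof -
  have "(\<Sum>n\<in>modes N. A n * (cmod (v b n))^2)
      \<le> ((\<Sum>n\<in>modes N. A n * (cmod (v a n))^2) + 0 * \<bar>b - a\<bar>) * exp ((2 * c) * \<bar>b - a\<bar>)"
  proof (rule gronwall[OF seg _ _ galerkin_energy_derivative[OF v]])
    fix t assume "t \<in> I"
    from le[OF this] show "\<bar>- 2 * Re (\<Sum>n\<in>modes N. of_real (A n) * cnj (v t n) * conv (v t) (dx (v t)) n)\<bar>
        \<le> 2 * c * (\<Sum>n\<in>modes N. A n * (cmod (v t n))^2) + 0"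
      by (simp add: abs_mult del: Re_sum)
  qed (use c in auto)
  then show ?thesis by (simp add: mult.commute)
qed

section \<open>Stability in \<open>L^2\<close>\<close>

lemma norm_conv_le_sup:
  assumes "ell1 f" "ell1 g" "\<And>k. cmod (g k) \<le> G"
  shows "cmod (conv f g n) \<le> l1n f * G" and "cmod (conv g f n) \<le> l1n f * G"
proof -
  have *: "(\<Sum>\<^sub>\<infinity>k. cmod (f k) * cmod (g (n - k))) \<le> l1n f * G"
  proof -
    have "(\<Sum>\<^sub>\<infinity>k. cmod (f k) * cmod (g (n - k))) \<le> (\<Sum>\<^sub>\<infinity>k. cmod (f k) * G)"
      using assms by (intro infsum_mono conv_summable summable_on_cmult_left mult_left_mono) (auto simp: ell1_def)
    then show ?thesis by (simp add: l1n_def infsum_cmult_left')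
  qed
  show "cmod (conv f g n) \<le> l1n f * G"
    by (rule order.trans[OF norm_conv_le[OF assms(1,2)] *])
  have "conv g f n = conv f g n"
    unfolding conv_altdef[of g] by (simp add: conv_def mult.commute)
  then show "cmod (conv g f n) \<le> l1n f * G"
    using norm_conv_le[OF assms(1,2), of n] * by simp
qed

text \<open>A bound for the coefficients of u_x beyond frequency N when u is in the unit ball of
  \<open>H^s\<close>. Since only convergence to 0 matters, \<open>jap n\<close> is estimated from
  below by |n| + 1.\<close>

definition tail_rate :: "real \<Rightarrow> nat \<Rightarrow> real" where
  "tail_rate s N = (real N + 1) powr (- ((s - 1) / 2))"

lemma tail_rate_tendsto: "1 < s \<Longrightarrow> tail_rate s \<longlonglongrightarrow> 0"
  unfolding tail_rate_def
  using filterlim_tendsto_add_at_top[OF tendsto_const[of "1::real"] filterlim_real_sequentially]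
  by (intro tendsto_neg_powr) (auto simp: add.commute)

lemma jap_ge_abs: "real_of_int \<bar>n\<bar> + 1 \<le> jap n"
proof -
  have "\<bar>n\<bar> \<le> n^2"
  proof (cases "n = 0")
    case False
    then have "\<bar>n\<bar> * 1 \<le> \<bar>n\<bar> * \<bar>n\<bar>" by (intro mult_left_mono) auto
    then show ?thesis by (simp add: power2_eq_square)
  qed simp
  then have "real_of_int \<bar>n\<bar> \<le> (real_of_int n)^2"
    using of_int_le_iff[of "\<bar>n\<bar>" "n^2", where ?'a = real] by simp
  also have "\<dots> = 1 * (real_of_int n)^2" by simp
  also have "\<dots> \<le> 4 * pi^2 * (real_of_int n)^2"
  proof (rule mult_right_mono)
    have "1^2 \<le> pi^2" using pi_gt3 by (intro power_mono) auto
    then show "1 \<le> 4 * pi^2" by simp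
  qed simp
  finally show ?thesis by (simp add: jap_def)
qed

lemma high_mode_le:
  assumes s: "1 \<le> s" and z: "in_Hs s z" and n: "n \<notin> modes N"
  shows "cmod (dx z n) \<le> tail_rate s N * sqrt (nsq s z)" "cmod (z n) \<le> tail_rate s N * sqrt (nsq s z)"
proof -
  have "real N + 1 \<le> jap n"
    using n jap_ge_abs[of n] by (simp add: mem_modes)
  then have w: "(real N + 1) powr (s - 1) \<le> Hs_weight (s - 1) n"
    unfolding Hs_weight_jap using s by (intro powr_mono2) auto
  have rate: "(tail_rate s N)^2 * (real N + 1) powr (s - 1) = 1"
    by (simp add: tail_rate_def power2_eq_square flip: powr_add) 
  have "(real N + 1) powr (s - 1) * (cmod (dx z n))^2 \<le> Hs_weight (s - 1) n * (cmod (dx z n))^2"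
    by (intro mult_right_mono w) auto
  also have "\<dots> \<le> Hs_weight s n * (cmod (z n))^2"
    by (rule norm_dx_sq_weight_le)
  also have "\<dots> \<le> nsq s z"
    using nsq_ge_sum[OF z, of "{n}"] by simp
  finally have "(tail_rate s N)^2 * ((real N + 1) powr (s - 1) * (cmod (dx z n))^2) \<le> (tail_rate s N)^2 * nsq s z"
    by (intro mult_left_mono) auto
  then have "(cmod (dx z n))^2 \<le> (tail_rate s N * sqrt (nsq s z))^2"
    using rate by (simp add: power_mult_distrib mult.assoc[symmetric])
  then show 1: "cmod (dx z n) \<le> tail_rate s N * sqrt (nsq s z)"
    by (rule power2_le_imp_le) (simp add: tail_rate_def)
  have "n \<noteq> 0" using n by auto
  then have "1 \<le> \<bar>real_of_int n\<bar>" by linarith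
  then have "1 * 1 \<le> (2 * pi) * \<bar>real_of_int n\<bar>" using pi_gt3 by (intro mult_mono) auto
  then have "1 * cmod (z n) \<le> cmod (dx z n)" unfolding norm_dx by (intro mult_right_mono) auto
  then show "cmod (z n) \<le> tail_rate s N * sqrt (nsq s z)" using 1 by simp
qed

lemma ell1_trunc: "ell1 (trunc N v)"
  by (rule finite_support_ell1[of N]) (simp add: trunc_outside)

lemma mudp_rhs_diff:
  assumes "ell1 u" "ell1 v" "ell1 (dx u)" "ell1 (dx v)"
  defines "z \<equiv> \<lambda>n. u n - v n"
  shows "mudp_rhs u n - mudp_rhs v n = - conv u (dx z) n - conv z (dx v) n
    - of_real (3 * mu u) * dx (Lambda_mu_inv2 z) n - of_real (3 * mu z) * dx (Lambda_mu_inv2 v) n"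
proof -
  have "conv u (dx u) n - conv v (dx v) n = conv u (dx z) n + conv z (dx v) n"
    using conv_diff[OF assms(1-4)] by (simp add: z_def dx_diff)
  moreover have "of_real (mu u) * dx (Lambda_mu_inv2 u) n - of_real (mu v) * dx (Lambda_mu_inv2 v) n
      = of_real (mu u) * dx (Lambda_mu_inv2 z) n + of_real (mu z) * dx (Lambda_mu_inv2 v) n"
    unfolding z_def dx_Lambda_inv_diff mu_def by (simp add: algebra_simps)
  ultimately show ?thesis
    by (simp add: mudp_rhs_def algebra_simps)
qed

text \<open>Neither function is confined to \<open>modes N\<close>, so z = u - v is split into a low
  part a and a high part h. The low part involves no bound on z_x: antisymmetry removes the
  derivative in u z_x, and in z v_x it falls on v. Products with h have coefficients of size
  \<open>tail_rate\<close> and are tested against z in the Wiener norm.\<close>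

lemma difference_form_le:
  fixes s :: real
  assumes s: "s > 3/2"
  obtains c where "0 < c" "\<And>N R u v. \<lbrakk>in_Hs s u; in_Hs s v; nsq s u \<le> R^2; nsq s v \<le> R^2; 0 \<le> R\<rbrakk> \<Longrightarrow>
     \<bar>Re (\<Sum>n\<in>modes N. cnj (u n - v n) * (mudp_rhs u n - mudp_rhs v n))\<bar>
       \<le> c * R * (\<Sum>n\<in>modes N. (cmod (u n - v n))^2) + c * R^3 * tail_rate s N"
proof -
  let ?q = "s - 1"
  have q: "?q > 1/2" using s by simp
  obtain C where C: "0 < C" "\<And>v. in_Hs ?q v \<Longrightarrow> ell1 v" "\<And>v. in_Hs ?q v \<Longrightarrow> l1n v \<le> C * sqrt (nsq ?q v)"
    using in_Hs_ell1[OF q] by blast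
  have l1: "ell1 w" "ell1 (dx w)" "l1n w \<le> C * R" "l1n (dx w) \<le> C * R"
    if w: "in_Hs s w" "nsq s w \<le> R^2" "0 \<le> R" for w R
  proof -
    have R: "sqrt (nsq s w) \<le> R" using w by (intro real_le_lsqrt) auto
    have w': "in_Hs ?q w" "nsq ?q w \<le> nsq s w"
      using in_Hs_mono[OF w(1), of ?q] by auto
    show "ell1 w" "ell1 (dx w)"
      using C(2)[OF w'(1)] C(2)[OF in_Hs_dx(1)[OF w(1)]] by auto
    have "sqrt (nsq ?q w) \<le> R" "sqrt (nsq ?q (dx w)) \<le> R"
      using R real_sqrt_le_mono[OF w'(2)] real_sqrt_le_mono[OF in_Hs_dx(2)[OF w(1)]] by linarith+
    then show "l1n w \<le> C * R" "l1n (dx w) \<le> C * R"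
      using C(3)[OF w'(1)] C(3)[OF in_Hs_dx(1)[OF w(1)]] C(1)
      by (meson mult_left_mono less_imp_le order.trans)+
  qed
  \<comment> \<open>2C for the low parts of u z_x and z v_x, 3 for the nonlocal term, and 8 C^2 for
    the two products with h, each bounded by 2CR times CR times 2R \<open>tail_rate\<close>.\<close>
  define c where "c = 2 * C + 3 + 8 * C^2"
  have "\<bar>Re (\<Sum>n\<in>modes N. cnj (u n - v n) * (mudp_rhs u n - mudp_rhs v n))\<bar>
       \<le> c * R * (\<Sum>n\<in>modes N. (cmod (u n - v n))^2) + c * R^3 * tail_rate s N"
    if uv: "in_Hs s u" "in_Hs s v" "nsq s u \<le> R^2" "nsq s v \<le> R^2" and R: "0 \<le> R" for N R u v
  proof -
    let ?M = "modes N"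
    define z where "z = (\<lambda>n. u n - v n)"
    define D where "D = (\<Sum>n\<in>?M. (cmod (z n))^2)"
    define a where "a = trunc N z"
    define h where "h = (\<lambda>n. z n - a n)"
    define \<delta> where "\<delta> = tail_rate s N * (2 * R)"
    have D0: "0 \<le> D" by (simp add: D_def sum_nonneg)
    have \<delta>0: "0 \<le> \<delta>" using R by (simp add: \<delta>_def tail_rate_def)
    have z: "in_Hs s z" "nsq s z \<le> (2 * R)^2"
      unfolding z_def using in_Hs_diff[OF uv(1,2)] uv(3,4) by (auto simp: power_mult_distrib)
    note lu = l1[OF uv(1,3) R] and lv = l1[OF uv(2,4) R]
    have lz: "ell1 z" "ell1 (dx z)" "l1n z \<le> C * (2 * R)"
      using l1[OF z] R by auto
    have sz: "sqrt (nsq s z) \<le> 2 * R" using z R by (intro real_le_lsqrt) auto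
    have a: "ell1 a" "ell1 (dx a)" "\<And>n. n \<in> ?M \<Longrightarrow> a n = z n"
      using ell1_trunc[of N z] finite_support_ell1[of N "dx a"] by (auto simp: a_def trunc_def dx_def)
    have h: "ell1 h" "ell1 (dx h)" "\<And>k. cmod (h k) \<le> \<delta>" "\<And>k. cmod (dx h k) \<le> \<delta>"
    proof -
      show "ell1 h" unfolding h_def by (intro ell1_diff lz a)
      show "ell1 (dx h)" unfolding h_def dx_diff by (intro ell1_diff lz a)
      fix k
      have "cmod (h k) \<le> \<delta> \<and> cmod (dx h k) \<le> \<delta>"
      proof (cases "k \<in> ?M")
        case True
        then show ?thesis using \<delta>0 by (simp add: h_def a(3) dx_def)
      next
        case False
        then have "h k = z k" "dx h k = dx z k" by (auto simp: h_def a_def trunc_def dx_def)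
        moreover have "tail_rate s N * sqrt (nsq s z) \<le> \<delta>"
          unfolding \<delta>_def using sz by (intro mult_left_mono) (auto simp: tail_rate_def)
        ultimately show ?thesis
          using high_mode_le[OF _ z(1) False] s by fastforce
      qed
      then show "cmod (h k) \<le> \<delta>" "cmod (dx h k) \<le> \<delta>" by auto
    qed
    have z_eq: "z = (\<lambda>n. a n + h n)" by (simp add: h_def)
    have conv_add1: "conv u (dx z) n = conv u (dx a) n + conv u (dx h) n" for n
    proof -
      have "conv u (dx z) n - conv u (dx a) n = conv u (dx h) n + conv (\<lambda>n. u n - u n) (dx a) n"
        using conv_diff[OF lu(1) lu(1) lz(2) a(2)] by (simp add: h_def dx_diff)
      then show ?thesis by (simp add: conv_def algebra_simps)
    qed
    have conv_add2: "conv z (dx v) n = conv a (dx v) n + conv h (dx v) n" for n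
    proof -
      have "conv z (dx v) n - conv a (dx v) n = conv z (\<lambda>n. dx v n - dx v n) n + conv h (dx v) n"
        using conv_diff[OF lz(1) a(1) lv(2) lv(2)] by (simp add: h_def)
      then show ?thesis by (simp add: conv_def algebra_simps)
    qed
    have sumz: "(\<Sum>n\<in>?M. cmod (z n)) \<le> C * (2 * R)"
      using l1n_ge_sum[OF lz(1), of ?M] lz(3) by simp
    have small: "\<bar>Re (\<Sum>n\<in>?M. cnj (z n) * f n)\<bar> \<le> C * (2 * R) * (C * R * \<delta>)"
      if "\<And>n. cmod (f n) \<le> C * R * \<delta>" for f
    proof -
      have "\<bar>Re (\<Sum>n\<in>?M. cnj (z n) * f n)\<bar> \<le> (\<Sum>n\<in>?M. cmod (z n) * (C * R * \<delta>))"
        using that by (intro order.trans[OF abs_Re_le_cmod] sum_norm_le) (auto simp: norm_mult intro!: mult_left_mono)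
      also have "\<dots> \<le> C * (2 * R) * (C * R * \<delta>)"
        unfolding sum_distrib_right[symmetric] using sumz C(1) R \<delta>0 by (intro mult_right_mono) auto
      finally show ?thesis .
    qed
    have A1: "\<bar>Re (\<Sum>n\<in>?M. cnj (z n) * conv u (dx a) n)\<bar> \<le> C * R * D"
    proof -
      have "(\<Sum>n\<in>?M. cnj (z n) * conv u (dx a) n) = (\<Sum>n\<in>?M. \<Sum>m\<in>?M. cnj (z n) * u (n - m) * dx z m)"
      proof (intro sum.cong refl)
        fix n
        have "conv u (dx a) n = (\<Sum>m\<in>?M. u (n - m) * dx a m)"
          by (rule conv_support) (auto simp: a_def trunc_def dx_def)
        also have "\<dots> = (\<Sum>m\<in>?M. u (n - m) * dx z m)"
          by (intro sum.cong) (auto simp: a_def trunc_def dx_def)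
        finally show "cnj (z n) * conv u (dx a) n = (\<Sum>m\<in>?M. cnj (z n) * u (n - m) * dx z m)"
          by (simp add: sum_distrib_left mult.assoc)
      qed
      then have "\<bar>Re (\<Sum>n\<in>?M. cnj (z n) * conv u (dx a) n)\<bar> \<le> 1/2 * l1n (dx u) * D"
        unfolding D_def using transport_form_le[OF in_Hs_herm[OF uv(1)] lu(2), of ?M z] by simp
      also have "\<dots> \<le> 1 * (C * R) * D"
        using lu(4) D0 by (intro mult_right_mono mult_mono) auto
      finally show ?thesis by simp
    qed
    have A2: "\<bar>Re (\<Sum>n\<in>?M. cnj (z n) * conv u (dx h) n)\<bar> \<le> C * (2 * R) * (C * R * \<delta>)"
    proof (rule small)
      show "cmod (conv u (dx h) n) \<le> C * R * \<delta>" for n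
        using norm_conv_le_sup(1)[OF lu(1) h(2,4), of n] mult_right_mono[OF lu(3) \<delta>0] by linarith
    qed
    have B1: "\<bar>Re (\<Sum>n\<in>?M. cnj (z n) * conv a (dx v) n)\<bar> \<le> C * R * D"
    proof -
      have "conv a (dx v) n = (\<Sum>k\<in>?M. dx v (n - k) * z k)" for n
      proof -
        have "conv a (dx v) n = (\<Sum>\<^sub>\<infinity>k\<in>?M. a k * dx v (n - k))"
          unfolding conv_def by (intro infsum_cong_neutral) (auto simp: a_def trunc_def)
        also have "\<dots> = (\<Sum>k\<in>?M. dx v (n - k) * z k)"
          by (simp add: a(3) mult.commute)
        finally show ?thesis .
      qed
      then have "\<bar>Re (\<Sum>n\<in>?M. cnj (z n) * conv a (dx v) n)\<bar>
          \<le> (\<Sum>n\<in>?M. \<Sum>k\<in>?M. cmod (dx v (n - k)) * cmod (z n) * cmod (z k))"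
        unfolding sum_distrib_left
        by (intro order.trans[OF abs_Re_le_cmod] sum_norm_le) (simp add: sum_distrib_left, intro sum_norm_le, simp add: norm_mult mult_ac)
      also have "\<dots> \<le> l1n (dx v) * (sqrt D * sqrt D)"
        unfolding D_def using lv(2) by (intro Young_form l1n_ge_sum) auto
      also have "\<dots> \<le> C * R * D"
        using lv(4) D0 by (simp add: mult_right_mono flip: power2_eq_square)
      finally show ?thesis .
    qed
    have B2: "\<bar>Re (\<Sum>n\<in>?M. cnj (z n) * conv h (dx v) n)\<bar> \<le> C * (2 * R) * (C * R * \<delta>)"
    proof (rule small)
      show "cmod (conv h (dx v) n) \<le> C * R * \<delta>" for n
        using norm_conv_le_sup(2)[OF lv(2) h(1,3), of n] mult_right_mono[OF lv(4) \<delta>0] by linarith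
    qed
    have C0: "Re (\<Sum>n\<in>?M. cnj (z n) * (of_real (3 * mu u) * dx (Lambda_mu_inv2 z) n)) = 0"
      by (simp only: Re_sum Re_cnj_dx_Lambda_inv sum.neutral_const)
    \<comment> \<open>The half of the nonlocal difference that is not skew carries the factor
      \<open>mu z\<close>. The mean is one of the modes in the truncated energy, so this factor is
      at most \<open>sqrt D\<close>.\<close>
    have E0: "\<bar>Re (\<Sum>n\<in>?M. cnj (z n) * (of_real (3 * mu z) * dx (Lambda_mu_inv2 v) n))\<bar> \<le> 3 * R * D"
    proof -
      have mu: "\<bar>mu z\<bar> \<le> sqrt D"
      proof (rule real_le_rsqrt)
        have "(mu z)^2 \<le> (cmod (z 0))^2"
          using power_mono[OF abs_Re_le_cmod[of "z 0"], of 2] by (simp add: mu_def)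
        also have "\<dots> \<le> D" unfolding D_def by (intro member_le_sum) auto
        finally show "\<bar>mu z\<bar>^2 \<le> D" by simp
      qed
      have "\<bar>Re (\<Sum>n\<in>?M. cnj (z n) * (of_real (3 * mu z) * dx (Lambda_mu_inv2 v) n))\<bar>
          \<le> (\<Sum>n\<in>?M. 3 * sqrt D * (cmod (z n) * cmod (v n)))"
      proof (intro order.trans[OF abs_Re_le_cmod] sum_norm_le)
        fix n
        have "cmod (cnj (z n) * (of_real (3 * mu z) * dx (Lambda_mu_inv2 v) n))
            = (3 * \<bar>mu z\<bar>) * (cmod (z n) * cmod (dx (Lambda_mu_inv2 v) n))"
          by (simp only: norm_mult complex_mod_cnj norm_of_real abs_mult) simp
        also have "\<dots> \<le> 3 * sqrt D * (cmod (z n) * cmod (v n))"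
          using mu D0 by (intro mult_mono norm_dx_Lambda_inv_le) auto
        finally show "cmod (cnj (z n) * (of_real (3 * mu z) * dx (Lambda_mu_inv2 v) n)) \<le> \<dots>" .
      qed
      also have "\<dots> = 3 * sqrt D * (\<Sum>n\<in>?M. 1 * cmod (z n) * cmod (v n))"
        by (simp add: sum_distrib_left)
      also have "\<dots> \<le> 3 * sqrt D * (sqrt D * sqrt (R^2))"
      proof (intro mult_left_mono weighted_Cauchy_Schwarz)
        have "(\<Sum>n\<in>?M. 1 * (cmod (v n))^2) \<le> (\<Sum>n\<in>?M. Hs_weight s n * (cmod (v n))^2)"
          using s by (intro sum_mono mult_right_mono Hs_weight_ge_1) auto
        also have "\<dots> \<le> R^2"
          using nsq_ge_sum[OF uv(2), of ?M] uv(4) by simp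
        finally show "(\<Sum>n\<in>?M. 1 * (cmod (v n))^2) \<le> R^2" .
      qed (use D0 in \<open>auto simp: D_def\<close>)
      also have "\<dots> = 3 * R * (sqrt D * sqrt D)" using R by simp
      finally show ?thesis using D0 by simp
    qed
    have "cnj (z n) * (mudp_rhs u n - mudp_rhs v n) = - (cnj (z n) * conv u (dx a) n) - cnj (z n) * conv u (dx h) n
        - cnj (z n) * conv a (dx v) n - cnj (z n) * conv h (dx v) n
        - cnj (z n) * (of_real (3 * mu u) * dx (Lambda_mu_inv2 z) n)
        - cnj (z n) * (of_real (3 * mu z) * dx (Lambda_mu_inv2 v) n)" for n
      unfolding mudp_rhs_diff[OF lu(1) lv(1) lu(2) lv(2), of n, folded z_def] conv_add1 conv_add2
      by (simp only: right_diff_distrib distrib_left minus_add_distrib mult_minus_right) simp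
    then have "(\<Sum>n\<in>?M. cnj (z n) * (mudp_rhs u n - mudp_rhs v n)) =
        - (\<Sum>n\<in>?M. cnj (z n) * conv u (dx a) n) - (\<Sum>n\<in>?M. cnj (z n) * conv u (dx h) n)
        - (\<Sum>n\<in>?M. cnj (z n) * conv a (dx v) n) - (\<Sum>n\<in>?M. cnj (z n) * conv h (dx v) n)
        - (\<Sum>n\<in>?M. cnj (z n) * (of_real (3 * mu u) * dx (Lambda_mu_inv2 z) n))
        - (\<Sum>n\<in>?M. cnj (z n) * (of_real (3 * mu z) * dx (Lambda_mu_inv2 v) n))"
      by (simp only: sum_subtractf sum_negf)
    then have "\<bar>Re (\<Sum>n\<in>?M. cnj (z n) * (mudp_rhs u n - mudp_rhs v n))\<bar>
        \<le> C * R * D + C * (2 * R) * (C * R * \<delta>) + C * R * D + C * (2 * R) * (C * R * \<delta>) + 3 * R * D"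
      using A1 A2 B1 B2 C0 E0 by (simp only: minus_complex.sel uminus_complex.sel)
    also have "\<dots> = (2 * C + 3) * (R * D) + 8 * C^2 * (R^3 * tail_rate s N)"
      by (simp add: \<delta>_def power2_eq_square power3_eq_cube algebra_simps)
    also have "\<dots> \<le> c * (R * D) + c * (R^3 * tail_rate s N)"
      using C(1) R D0 by (intro add_mono mult_right_mono) (auto simp: c_def tail_rate_def)
    finally show ?thesis by (simp add: z_def D_def mult.assoc)
  qed
  moreover have "0 < c" using C(1) by (simp add: c_def add_pos_nonneg)
  ultimately show thesis by (rule that[rotated])
qed

definition modes_solution :: "real \<Rightarrow> real \<Rightarrow> nat \<Rightarrow> real set \<Rightarrow> (real \<Rightarrow> int \<Rightarrow> complex) \<Rightarrow> bool" where
  "modes_solution s R N I u \<longleftrightarrow> (\<forall>t\<in>I. in_Hs s (u t) \<and> nsq s (u t) \<le> R^2 \<and>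
     (\<forall>n\<in>modes N. ((\<lambda>\<tau>. u \<tau> n) has_vector_derivative mudp_rhs (u t) n) (at t within I)))"

text \<open>Exact solutions and Galerkin approximations of level at least \<open>N\<close> both qualify, so this one estimate
  gives uniqueness, convergence of the approximations and Lipschitz dependence in \<open>L\<^sup>2\<close>.\<close>

lemma difference_estimate:
  fixes s :: real
  assumes s: "s > 3/2"
  obtains c where "0 < c" "\<And>N R I u v a b.
     \<lbrakk>modes_solution s R N I u; modes_solution s R N I v; closed_segment a b \<subseteq> I; 0 \<le> R\<rbrakk> \<Longrightarrow>
      (\<Sum>n\<in>modes N. (cmod (u b n - v b n))^2) \<le>
        ((\<Sum>n\<in>modes N. (cmod (u a n - v a n))^2) + c * R^3 * tail_rate s N * \<bar>b - a\<bar>) * exp (c * R * \<bar>b - a\<bar>)"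
proof -
  obtain c where c: "0 < c" "\<And>N R u v. \<lbrakk>in_Hs s u; in_Hs s v; nsq s u \<le> R^2; nsq s v \<le> R^2; 0 \<le> R\<rbrakk> \<Longrightarrow>
     \<bar>Re (\<Sum>n\<in>modes N. cnj (u n - v n) * (mudp_rhs u n - mudp_rhs v n))\<bar>
       \<le> c * R * (\<Sum>n\<in>modes N. (cmod (u n - v n))^2) + c * R^3 * tail_rate s N"
    using difference_form_le[OF s] by blast
  show thesis
  proof (rule that[of "2 * c"])
    show "0 < 2 * c" using c(1) by simp
    fix N R I u v a b
    assume u: "modes_solution s R N I u" and v: "modes_solution s R N I v"
      and seg: "closed_segment a b \<subseteq> I" and R: "0 \<le> R"
    show "(\<Sum>n\<in>modes N. (cmod (u b n - v b n))^2) \<le>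
        ((\<Sum>n\<in>modes N. (cmod (u a n - v a n))^2) + 2 * c * R^3 * tail_rate s N * \<bar>b - a\<bar>) * exp (2 * c * R * \<bar>b - a\<bar>)"
    proof (rule gronwall[OF seg])
      fix t assume t: "t \<in> I"
      have "((\<lambda>t. \<Sum>n\<in>modes N. 1 * (cmod (u t n - v t n))^2) has_real_derivative
           2 * Re (\<Sum>n\<in>modes N. of_real 1 * cnj (u t n - v t n) * (mudp_rhs (u t) n - mudp_rhs (v t) n))) (at t within I)"
        using u v t unfolding modes_solution_def
        by (intro weighted_energy_derivative has_vector_derivative_diff) blast+
      then show "((\<lambda>t. \<Sum>n\<in>modes N. (cmod (u t n - v t n))^2) has_real_derivative
           2 * Re (\<Sum>n\<in>modes N. cnj (u t n - v t n) * (mudp_rhs (u t) n - mudp_rhs (v t) n))) (at t within I)"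
        by (simp only: of_real_1 mult_1)
      have "in_Hs s (u t)" "in_Hs s (v t)" "nsq s (u t) \<le> R^2" "nsq s (v t) \<le> R^2"
        using u v t unfolding modes_solution_def by blast+
      from c(2)[OF this R, of N]
      show "\<bar>2 * Re (\<Sum>n\<in>modes N. cnj (u t n - v t n) * (mudp_rhs (u t) n - mudp_rhs (v t) n))\<bar>
          \<le> 2 * c * R * (\<Sum>n\<in>modes N. (cmod (u t n - v t n))^2) + 2 * c * R^3 * tail_rate s N"
        by (simp add: abs_mult del: Re_sum)
    qed (use c(1) R in \<open>auto simp: tail_rate_def\<close>)
  qed
qed

section \<open>Local existence\<close>

definition tail_energy :: "real \<Rightarrow> real \<Rightarrow> (int \<Rightarrow> complex) \<Rightarrow> real" where
  "tail_energy s K u = (\<Sum>\<^sub>\<infinity>n. (tail_weight s K n)^2 * (cmod (u n))^2)"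

lemma tail_sum_le:
  assumes "in_Hs s u" "1 \<le> K" "finite S"
  shows "(\<Sum>n\<in>S. (tail_weight s K n)^2 * (cmod (u n))^2) \<le> tail_energy s K u"
  unfolding tail_energy_def
proof (rule finite_sum_le_infsum)
  show "(\<lambda>n. (tail_weight s K n)^2 * (cmod (u n))^2) summable_on UNIV"
    by (rule summable_on_comparison_test[OF in_Hs_summable[OF assms(1)]])
       (auto intro!: mult_right_mono tail_weight_sq_le assms)
qed (use assms in auto)

lemma tail_energy_bounded:
  assumes "\<And>S. finite S \<Longrightarrow> (\<Sum>n\<in>S. (tail_weight s K n)^2 * (cmod (u n))^2) \<le> B"
  shows "tail_energy s K u \<le> B"
  unfolding tail_energy_def by (rule nonneg_bounded_sums(2)) (use assms in auto)

lemma tail_energy_nonneg [simp]: "0 \<le> tail_energy s K u"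
  unfolding tail_energy_def by (intro infsum_nonneg) auto

text \<open>Dominated convergence by hand: a finite set F carries the sum up to e/2, and on F the
  squared damping factor is at most B / K, which a large K makes small.\<close>

lemma tail_energy_small:
  assumes u: "in_Hs s u" and e: "0 < e"
  obtains K where "1 \<le> K" "tail_energy s K u \<le> e"
proof -
  let ?f = "\<lambda>n. Hs_weight s n * (cmod (u n))^2"
  have "(?f has_sum nsq s u) UNIV"
    unfolding nsq_def using in_Hs_summable[OF u] by (rule has_sum_infsum)
  then obtain F where F: "finite F" "dist (sum ?f F) (nsq s u) \<le> e / 2"
    using has_sum_finite_approximation[OF _ half_gt_zero[OF e]] by blast
  define B where "B = (\<Sum>n\<in>F. jap n)"
  have B: "0 \<le> B" "n \<in> F \<Longrightarrow> jap n \<le> B" for n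
  proof -
    show "0 \<le> B" unfolding B_def by (intro sum_nonneg less_imp_le jap_pos)
    show "jap n \<le> B" if "n \<in> F"
      unfolding B_def using that F(1) less_imp_le[OF jap_pos] by (intro member_le_sum) auto
  qed
  define K where "K = 1 + 2 * B * (nsq s u + 1) / e"
  have K: "1 \<le> K" using B e by (simp add: K_def)
  have BK: "B / K * nsq s u \<le> e / 2"
  proof -
    have "2 * B * nsq s u \<le> 2 * B * (nsq s u + 1)" using B by (intro mult_left_mono) auto
    also have "\<dots> = (K - 1) * e" using e by (simp add: K_def)
    also have "\<dots> \<le> K * e" using e by simp
    finally show ?thesis using K by (simp add: field_simps)
  qed
  have "tail_energy s K u \<le> e"
  proof (rule tail_energy_bounded)
    fix S :: "int set" assume S: "finite S"
    have "(\<Sum>n\<in>S - F. (tail_weight s K n)^2 * (cmod (u n))^2) \<le> sum ?f (S - F)"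
      by (intro sum_mono mult_right_mono tail_weight_sq_le K) auto
    also have "\<dots> = sum ?f ((S - F) \<union> F) - sum ?f F"
      using S F(1) by (subst sum.union_disjoint) auto
    also have "\<dots> \<le> e / 2"
      
    proof -
      have "nsq s u - sum ?f F \<le> e / 2"
        using F(2) unfolding dist_real_def abs_le_iff by linarith
      moreover have "sum ?f ((S - F) \<union> F) \<le> nsq s u"
        using S F(1) by (intro nsq_ge_sum[OF u]) auto
      ultimately show ?thesis by linarith
    qed
    finally have 1: "(\<Sum>n\<in>S - F. (tail_weight s K n)^2 * (cmod (u n))^2) \<le> e / 2" .
    have "(\<Sum>n\<in>S \<inter> F. (tail_weight s K n)^2 * (cmod (u n))^2) \<le> (\<Sum>n\<in>S \<inter> F. B / K * ?f n)"
    proof (rule sum_mono)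
      fix n assume n: "n \<in> S \<inter> F"
      define m where "m = min 1 (jap n / K)"
      have m: "0 \<le> m" "m \<le> 1" "m \<le> B / K"
        using B(2)[of n] n K by (auto simp: m_def less_imp_le divide_right_mono min_le_iff_disj)
      have "m^2 \<le> 1 * m" unfolding power2_eq_square using m by (intro mult_right_mono) auto
      then have "m^2 \<le> B / K" using m by linarith
      have "(tail_weight s K n)^2 * (cmod (u n))^2 = m^2 * ?f n"
        by (simp add: tail_weight_def power_mult_distrib Hs_weight_half_sq m_def)
      also have "\<dots> \<le> B / K * ?f n"
        using \<open>m^2 \<le> B / K\<close> by (intro mult_right_mono) auto
      finally show "(tail_weight s K n)^2 * (cmod (u n))^2 \<le> B / K * ?f n" .
    qed
    also have "\<dots> \<le> B / K * nsq s u"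
      unfolding sum_distrib_left[symmetric] using nsq_ge_sum[OF u, of "S \<inter> F"] S B K by (intro mult_left_mono) auto
    finally have 2: "(\<Sum>n\<in>S \<inter> F. (tail_weight s K n)^2 * (cmod (u n))^2) \<le> e / 2"
      using BK by linarith
    have "(\<Sum>n\<in>S. (tail_weight s K n)^2 * (cmod (u n))^2)
        = (\<Sum>n\<in>S - F. (tail_weight s K n)^2 * (cmod (u n))^2) + (\<Sum>n\<in>S \<inter> F. (tail_weight s K n)^2 * (cmod (u n))^2)"
      using S by (subst sum.union_disjoint[symmetric]) (auto intro!: sum.cong)
    then show "(\<Sum>n\<in>S. (tail_weight s K n)^2 * (cmod (u n))^2) \<le> e"
      using 1 2 by simp
  qed
  then show thesis by (rule that[OF K])
qed

text \<open>It lets one K serve all data near u, as continuous dependence requires.\<close>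

lemma tail_energy_perturb:
  assumes u: "in_Hs s u" and v: "in_Hs s v" and K: "1 \<le> K"
  shows "tail_energy s K v \<le> 2 * tail_energy s K u + 2 * nsq s (\<lambda>n. v n - u n)"
proof (rule tail_energy_bounded)
  fix S :: "int set" assume S: "finite S"
  have "(\<Sum>n\<in>S. (tail_weight s K n)^2 * (cmod (v n))^2)
      \<le> (\<Sum>n\<in>S. 2 * ((tail_weight s K n)^2 * (cmod (u n))^2) + 2 * (Hs_weight s n * (cmod (v n - u n))^2))"
  proof (rule sum_mono)
    fix n
    have "(cmod (v n))^2 \<le> 2 * (cmod (u n))^2 + 2 * (cmod (v n - u n))^2"
      using norm_add_sq_le[of "u n" "v n - u n"] by simp
    then have "(tail_weight s K n)^2 * (cmod (v n))^2 \<le> (tail_weight s K n)^2 * (2 * (cmod (u n))^2 + 2 * (cmod (v n - u n))^2)"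
      by (intro mult_left_mono) auto
    moreover have "(tail_weight s K n)^2 * (cmod (v n - u n))^2 \<le> Hs_weight s n * (cmod (v n - u n))^2"
      by (intro mult_right_mono tail_weight_sq_le K) auto
    ultimately show "(tail_weight s K n)^2 * (cmod (v n))^2
        \<le> 2 * ((tail_weight s K n)^2 * (cmod (u n))^2) + 2 * (Hs_weight s n * (cmod (v n - u n))^2)"
      by (simp add: algebra_simps)
  qed
  also have "\<dots> \<le> 2 * tail_energy s K u + 2 * nsq s (\<lambda>n. v n - u n)"
    using tail_sum_le[OF u K S] nsq_ge_sum[OF in_Hs_diff(1)[OF v u] S]
    by (simp add: sum.distrib flip: sum_distrib_left)
  finally show "(\<Sum>n\<in>S. (tail_weight s K n)^2 * (cmod (v n))^2) \<le> 2 * tail_energy s K u + 2 * nsq s (\<lambda>n. v n - u n)" .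
qed

text \<open>Modes with \<open>jap n\<close> < K lie in \<open>modes N\<close> and have Sobolev
  weight at most K^s, so their \<open>L^2\<close> closeness suffices. On the others the damped
  weight is the full one, so the tails control them. The 4 comes from 2 |u|^2 + 2 |v|^2.\<close>

lemma nsq_diff_le_tails:
  assumes s: "0 \<le> s" and u: "in_Hs s u" and v: "in_Hs s v" and K: "1 \<le> K" "K \<le> real N"
    and low: "(\<Sum>n\<in>modes N. (cmod (u n - v n))^2) \<le> \<epsilon>"
    and tails: "tail_energy s K u \<le> \<eta>" "tail_energy s K v \<le> \<eta>"
  shows "nsq s (\<lambda>n. u n - v n) \<le> K powr s * \<epsilon> + 4 * \<eta>"
proof (rule in_Hs_bounded(2)[OF herm_diff[OF in_Hs_herm[OF u] in_Hs_herm[OF v]]])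
  fix S :: "int set" assume S: "finite S"
  let ?g = "\<lambda>n. if n \<in> modes N then K powr s * (cmod (u n - v n))^2 else 0"
  let ?t = "\<lambda>w n. (tail_weight s K n)^2 * (cmod (w n))^2"
  have "(\<Sum>n\<in>S. Hs_weight s n * (cmod (u n - v n))^2) \<le> (\<Sum>n\<in>S. ?g n + (2 * ?t u n + 2 * ?t v n))"
  proof (rule sum_mono)
    fix n
    show "Hs_weight s n * (cmod (u n - v n))^2 \<le> ?g n + (2 * ?t u n + 2 * ?t v n)"
    proof (cases "jap n < K")
      case True
      then have "n \<in> modes N" using jap_ge_abs[of n] K by (simp add: mem_modes)
      moreover have "Hs_weight s n \<le> K powr s"
        unfolding Hs_weight_jap using True s by (intro powr_mono2) (auto simp: less_imp_le)
      then have "Hs_weight s n * (cmod (u n - v n))^2 \<le> K powr s * (cmod (u n - v n))^2"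
        by (intro mult_right_mono) auto
      ultimately show ?thesis by (simp add: add_increasing2)
    next
      case False
      then have w: "(tail_weight s K n)^2 = Hs_weight s n" using K by (intro tail_weight_eq) auto
      have "Hs_weight s n * (cmod (u n - v n))^2 \<le> Hs_weight s n * (2 * (cmod (u n))^2 + 2 * (cmod (v n))^2)"
        by (intro mult_left_mono norm_diff_sq_le) auto
      then have "Hs_weight s n * (cmod (u n - v n))^2 \<le> 2 * ?t u n + 2 * ?t v n"
        unfolding w by (simp add: algebra_simps)
      moreover have "0 \<le> ?g n" by simp
      ultimately show ?thesis by linarith
    qed
  qed
  also have "\<dots> = (\<Sum>n\<in>S. ?g n) + (2 * (\<Sum>n\<in>S. ?t u n) + 2 * (\<Sum>n\<in>S. ?t v n))"
    by (simp add: sum.distrib sum_distrib_left)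
  also have "(\<Sum>n\<in>S. ?g n) = (\<Sum>n\<in>S \<inter> modes N. K powr s * (cmod (u n - v n))^2)"
    using S by (simp add: sum.inter_restrict)
  also have "\<dots> \<le> (\<Sum>n\<in>modes N. K powr s * (cmod (u n - v n))^2)"
    by (intro sum_mono2) auto
  also have "\<dots> \<le> K powr s * \<epsilon>"
    unfolding sum_distrib_left[symmetric] using low by (intro mult_left_mono) auto
  finally show "(\<Sum>n\<in>S. Hs_weight s n * (cmod (u n - v n))^2) \<le> K powr s * \<epsilon> + 4 * \<eta>"
    using tail_sum_le[OF u K(1) S] tail_sum_le[OF v K(1) S] tails by linarith
qed

lemma galerkin_tail:
  assumes "galerkin N I v" "t \<in> I"
  shows "in_Hs s (v t)" "nsq s (v t) = (\<Sum>n\<in>modes N. (tail_weight s 1 n)^2 * (cmod (v t n))^2)"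
    "tail_energy s K (v t) = (\<Sum>n\<in>modes N. (tail_weight s K n)^2 * (cmod (v t n))^2)"
proof -
  have v: "herm (v t)" "\<And>n. n \<notin> modes N \<Longrightarrow> v t n = 0"
    using assms by (auto simp: galerkin_def)
  show "in_Hs s (v t)" "nsq s (v t) = (\<Sum>n\<in>modes N. (tail_weight s 1 n)^2 * (cmod (v t n))^2)"
    using finite_support_in_Hs[OF v] by (auto simp: tail_weight_1)
  have "tail_energy s K (v t) = (\<Sum>\<^sub>\<infinity>n\<in>modes N. (tail_weight s K n)^2 * (cmod (v t n))^2)"
    unfolding tail_energy_def using v(2) by (intro infsum_cong_neutral) auto
  then show "tail_energy s K (v t) = (\<Sum>n\<in>modes N. (tail_weight s K n)^2 * (cmod (v t n))^2)" by simp
qed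

text \<open>For |y'| <= c y^(3/2) the natural variable is y^(-1/2), whose derivative is at most c/2
  in size. Adding R^2 keeps it finite where y vanishes. Over a time of length T it drops by at most
  1 / (4R).\<close>

lemma inverse_sqrt_growth:
  fixes y :: "real \<Rightarrow> real"
  assumes R: "0 < R" and c: "0 < c" and T: "0 \<le> T" "T * (2 * c * R) \<le> 1"
    and der: "\<And>t. t \<in> {-T..T} \<Longrightarrow> (y has_real_derivative y' t) (at t within {-T..T})"
    and y: "\<And>t. t \<in> {-T..T} \<Longrightarrow> 0 \<le> y t" "\<And>t. t \<in> {-T..T} \<Longrightarrow> \<bar>y' t\<bar> \<le> c * sqrt (y t) * y t" "y 0 \<le> R^2"
    and t: "t \<in> {-T..T}"
  shows "y t \<le> (3 * R)^2"
proof -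
  define z where "z t = 1 / sqrt (y t + R^2)" for t
  define z' where "z' t = - (y' t / (2 * sqrt (y t + R^2))) / (y t + R^2)" for t
  have w: "0 < y r + R^2" if "r \<in> {-T..T}" for r
    using y(1)[OF that] R by (simp add: add_nonneg_pos)
  have dz: "(z has_real_derivative z' r) (at r within {-T..T})" if r: "r \<in> {-T..T}" for r
    unfolding z_def z'_def using w[OF r]
    by (auto intro!: derivative_eq_intros der r simp: divide_simps power2_eq_square)
  have bz: "norm (z' r) \<le> c / 2" if r: "r \<in> {-T..T}" for r
  proof -
    have "c * sqrt (y r) * y r \<le> c * sqrt (y r + R^2) * (y r + R^2)"
      using y(1)[OF r] c by (intro mult_mono) auto
    then have "\<bar>y' r\<bar> \<le> c * (sqrt (y r + R^2) * (y r + R^2))"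
      using y(2)[OF r] by simp
    then have "\<bar>y' r\<bar> / (2 * (sqrt (y r + R^2) * (y r + R^2))) \<le> c / 2"
      using w[OF r] by (simp add: divide_simps)
    then show ?thesis
      using w[OF r] by (simp add: z'_def abs_mult abs_divide mult.assoc)
  qed
  have 1: "norm (z t - z 0) \<le> c / 2 * norm (t - 0)"
    using field_differentiable_bound[of "{-T..T}" z z' "c/2" t 0] dz bz t T by auto
  have 2: "c / 2 * norm (t - 0) \<le> 1 / (4 * R)"
  proof -
    have "\<bar>t\<bar> * (2 * c * R) \<le> T * (2 * c * R)"
      using t c R by (intro mult_right_mono) auto
    then have "\<bar>t\<bar> * (2 * c * R) \<le> 1" using T by linarith
    then show ?thesis using R by (simp add: field_simps)
  qed
  have "z 0 - 1 / (4 * R) \<le> z t"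
    using order.trans[OF 1 2] unfolding real_norm_def abs_le_iff by linarith
  \<comment> \<open>Initially y + R^2 is at most 2 R^2, which is below (3/2 R)^2. As 2/3 - 1/4
    exceeds 1/3, at least 1 / (3R) is left at time t.\<close>
  moreover have "2 / (3 * R) \<le> z 0"
  proof -
    have "(3/2 * R)^2 = 9/4 * R^2" by (simp add: power2_eq_square)
    then have "y 0 + R^2 \<le> (3/2 * R)^2" using y(3) zero_le_power2[of R] by linarith
    then have "sqrt (y 0 + R^2) \<le> 3/2 * R" using R by (intro real_le_lsqrt) auto
    then show ?thesis using R w[of 0] T by (simp add: z_def field_simps)
  qed
  ultimately have "1 / (3 * R) \<le> z t"
    using R by (simp add: field_simps)
  then have "sqrt (y t + R^2) \<le> 3 * R"
    using R w[OF t] by (simp add: z_def field_simps)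
  then have "y t + R^2 \<le> (3 * R)^2"
    by (rule sqrt_le_D)
  then show ?thesis using zero_le_power2[of R] by linarith
qed

text \<open>For K = 1 the energy is the squared \<open>H^s\<close> norm and bounds its own growth
  rate through the Wiener norm of the derivative. This yields a lifespan that depends on R and not
  on N. The norm bound then makes the estimate linear for every K.\<close>

lemma galerkin_lifespan:
  fixes s :: real
  assumes s: "s > 3/2"
  obtains c where "0 < c" "\<And>N R T v u0 t.
    \<lbrakk>0 < R; 0 \<le> T; T * (2 * c * R) \<le> 1; in_Hs s u0; nsq s u0 \<le> R^2; galerkin N {-T..T} v; v 0 = trunc N u0; t \<in> {-T..T}\<rbrakk> \<Longrightarrow>
      nsq s (v t) \<le> (3 * R)^2 \<and> (\<forall>K\<ge>1. tail_energy s K (v t) \<le> exp 2 * tail_energy s K u0)"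
proof -
  obtain C1 where C1: "0 < C1" "\<And>v. in_Hs (s - 1) v \<Longrightarrow> ell1 v" "\<And>v. in_Hs (s - 1) v \<Longrightarrow> l1n v \<le> C1 * sqrt (nsq (s - 1) v)"
  proof -
    have "1/2 < s - 1" using s by simp
    from in_Hs_ell1[OF this] that show thesis by blast
  qed
  obtain C where C: "0 < C" "\<And>K. 1 \<le> K \<Longrightarrow> comm_weight C (tail_weight s K)"
    using tail_weight_comm[of s] s by auto
  define c where "c = (1 + 4 * C) * C1"
  have c: "0 < c" using C C1 by (simp add: c_def)
  show thesis
  proof (rule that[OF c])
    fix N R T v u0 t
    assume R: "0 < R" and T: "0 \<le> T" "T * (2 * c * R) \<le> 1" and u0: "in_Hs s u0" "nsq s u0 \<le> R^2"
      and v: "galerkin N {-T..T} v" "v 0 = trunc N u0" and t: "t \<in> {-T..T}"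
    define E where "E K r = (\<Sum>n\<in>modes N. (tail_weight s K n)^2 * (cmod (v r n))^2)" for K r
    define F where "F K r = Re (\<Sum>n\<in>modes N. of_real ((tail_weight s K n)^2) * cnj (v r n) * conv (v r) (dx (v r)) n)" for K r
    have l1: "l1n (dx (v r)) \<le> C1 * sqrt (nsq s (v r))" if r: "r \<in> {-T..T}" for r
    proof -
      have v_r: "in_Hs s (v r)" by (rule galerkin_tail(1)[OF v(1) r])
      have "l1n (dx (v r)) \<le> C1 * sqrt (nsq (s - 1) (dx (v r)))"
        by (intro C1 in_Hs_dx v_r)
      also have "\<dots> \<le> C1 * sqrt (nsq s (v r))"
        using C1(1) in_Hs_dx(2)[OF v_r] by (intro mult_left_mono) auto
      finally show ?thesis .
    qed
    have flux: "\<bar>F K r\<bar> \<le> (1/2 + 2 * C) * l1n (dx (v r)) * E K r" if r: "r \<in> {-T..T}" and K: "1 \<le> K" for K r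
      unfolding F_def E_def using v r C(1) C(2)[OF K]
      by (intro energy_flux_le) (auto simp: galerkin_def)
    have E0: "E K 0 \<le> tail_energy s K u0" if K: "1 \<le> K" for K
    proof -
      have "E K 0 = (\<Sum>n\<in>modes N. (tail_weight s K n)^2 * (cmod (u0 n))^2)"
        by (simp add: E_def v(2) trunc_def)
      then show ?thesis using tail_sum_le[OF u0(1) K, of "modes N"] by simp
    qed
    have bound: "nsq s (v r) \<le> (3 * R)^2" if r: "r \<in> {-T..T}" for r
    proof -
      have nsqE: "nsq s (v r) = E 1 r" if "r \<in> {-T..T}" for r
        unfolding E_def by (rule galerkin_tail(2)[OF v(1) that])
      have "E 1 r \<le> (3 * R)^2"
      proof (rule inverse_sqrt_growth[OF R c T _ _ _ _ r])
        fix r assume r: "r \<in> {-T..T}"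
        show "(E 1 has_real_derivative - 2 * F 1 r) (at r within {-T..T})"
          unfolding E_def F_def by (rule galerkin_energy_derivative[OF v(1) r])
        show E1: "0 \<le> E 1 r" unfolding E_def by (intro sum_nonneg) auto
        have "\<bar>F 1 r\<bar> \<le> (1/2 + 2 * C) * l1n (dx (v r)) * E 1 r"
          by (rule flux[OF r]) simp
        also have "\<dots> \<le> (1/2 + 2 * C) * (C1 * sqrt (E 1 r)) * E 1 r"
          using l1[OF r] C(1) E1 unfolding nsqE[OF r] by (intro mult_right_mono mult_left_mono) auto
        finally show "\<bar>- 2 * F 1 r\<bar> \<le> c * sqrt (E 1 r) * E 1 r"
          by (simp add: c_def abs_mult algebra_simps)
      next
        have "tail_energy s 1 u0 = nsq s u0" by (simp add: tail_energy_def nsq_def tail_weight_1)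
        then show "E 1 0 \<le> R^2" using E0[of 1] u0(2) by simp
      qed
      then show ?thesis using nsqE[OF r] by simp
    qed
    have "tail_energy s K (v t) \<le> exp 2 * tail_energy s K u0" if K: "1 \<le> K" for K
    proof -
      have "E K t \<le> exp (2 * ((1/2 + 2 * C) * (C1 * (3 * R))) * \<bar>t - 0\<bar>) * E K 0"
        unfolding E_def
      proof (rule galerkin_weighted_bound[OF v(1)])
        show "closed_segment 0 t \<subseteq> {-T..T}" using t T by (auto simp: closed_segment_eq_real_ivl split: if_splits)
        show "0 \<le> (1/2 + 2 * C) * (C1 * (3 * R))" using C(1) C1(1) R by simp
        fix r assume r: "r \<in> {-T..T}"
        have "0 \<le> E K r" unfolding E_def by (intro sum_nonneg) auto
        have "sqrt (nsq s (v r)) \<le> 3 * R" using bound[OF r] R by (intro real_le_lsqrt) auto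
        then have "l1n (dx (v r)) \<le> C1 * (3 * R)"
          using l1[OF r] C1(1) by (meson less_imp_le mult_left_mono order.trans)
        then have "(1/2 + 2 * C) * l1n (dx (v r)) * E K r \<le> (1/2 + 2 * C) * (C1 * (3 * R)) * E K r"
          using C(1) \<open>0 \<le> E K r\<close> by (intro mult_right_mono mult_left_mono) auto
        then show "\<bar>Re (\<Sum>n\<in>modes N. of_real ((tail_weight s K n)^2) * cnj (v r n) * conv (v r) (dx (v r)) n)\<bar>
            \<le> (1/2 + 2 * C) * (C1 * (3 * R)) * (\<Sum>n\<in>modes N. (tail_weight s K n)^2 * (cmod (v r n))^2)"
          using flux[OF r K] by (simp only: F_def E_def)
      qed
      also have "\<dots> \<le> exp 2 * tail_energy s K u0"
      proof (intro mult_mono E0 K)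
        \<comment> \<open>On the lifespan the exponent is at most 3/2; the factor
          \<open>exp 2\<close> is a rounding.\<close>
        have "2 * ((1/2 + 2 * C) * (C1 * (3 * R))) * \<bar>t - 0\<bar> = 3/2 * (\<bar>t\<bar> * (2 * c * R))"
          by (simp add: c_def algebra_simps)
        also have "\<dots> \<le> 3/2 * (T * (2 * c * R))"
          using t c R by (intro mult_left_mono mult_right_mono) auto
        also have "\<dots> \<le> 2" using T(2) by linarith
        finally show "exp (2 * ((1/2 + 2 * C) * (C1 * (3 * R))) * \<bar>t - 0\<bar>) \<le> exp 2" by simp
      qed (auto simp: E_def intro!: sum_nonneg)
      finally show ?thesis
        using galerkin_tail(3)[OF v(1) t, of s K] by (simp add: E_def)
    qed
    then show "nsq s (v t) \<le> (3 * R)^2 \<and> (\<forall>K\<ge>1. tail_energy s K (v t) \<le> exp 2 * tail_energy s K u0)"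
      using bound[OF t] by blast
  qed
qed

text \<open>The approximations are recorded together with the limit because later energy estimates
  are derived along them. Convergence is uniform on the closed time interval, in the full
  \<open>H^s\<close> norm.\<close>

definition galerkin_limit where
  "galerkin_limit s R T u0 u v \<longleftrightarrow> u 0 = u0 \<and>
     (\<forall>t\<in>{-T..T}. in_Hs s (u t) \<and> nsq s (u t) \<le> (3 * R)^2 \<and>
        (\<forall>K\<ge>1. tail_energy s K (u t) \<le> exp 2 * tail_energy s K u0) \<and>
        (\<forall>n. ((\<lambda>\<tau>. u \<tau> n) has_vector_derivative mudp_rhs (u t) n) (at t within {-T..T}))) \<and>
     (\<forall>N. galerkin N {-T..T} (v N) \<and> v N 0 = trunc N u0) \<and>
     (\<forall>e>0. \<exists>N0. \<forall>N\<ge>N0. \<forall>t\<in>{-T..T}. nsq s (\<lambda>n. v N t n - u t n) < e)"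

text \<open>The lifespan is a function of the size R alone, as restarting requires. Approximations
  of levels N and M >= N agree initially on \<open>modes N\<close>, so the difference estimate
  bounds them by a null sequence. This gives a limit of each coefficient, and the uniform tail
  bounds upgrade the convergence to \<open>H^s\<close>.\<close>

lemma local_existence:
  fixes s :: real
  assumes s: "s > 3/2"
  obtains \<tau> where "\<And>R. 0 < R \<Longrightarrow> 0 < \<tau> R"
    "\<And>R u0. \<lbrakk>0 < R; in_Hs s u0; nsq s u0 \<le> R^2\<rbrakk> \<Longrightarrow> \<exists>u v. galerkin_limit s R (\<tau> R) u0 u v"
proof -
  obtain c where c: "0 < c" "\<And>N R T v u0 t.
    \<lbrakk>0 < R; 0 \<le> T; T * (2 * c * R) \<le> 1; in_Hs s u0; nsq s u0 \<le> R^2; galerkin N {-T..T} v; v 0 = trunc N u0; t \<in> {-T..T}\<rbrakk> \<Longrightarrow>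
      nsq s (v t) \<le> (3 * R)^2 \<and> (\<forall>K\<ge>1. tail_energy s K (v t) \<le> exp 2 * tail_energy s K u0)"
    using galerkin_lifespan[OF s] by blast
  obtain d where d: "0 < d" "\<And>N R I u v a b.
     \<lbrakk>modes_solution s R N I u; modes_solution s R N I v; closed_segment a b \<subseteq> I; 0 \<le> R\<rbrakk> \<Longrightarrow>
      (\<Sum>n\<in>modes N. (cmod (u b n - v b n))^2) \<le>
        ((\<Sum>n\<in>modes N. (cmod (u a n - v a n))^2) + d * R^3 * tail_rate s N * \<bar>b - a\<bar>) * exp (d * R * \<bar>b - a\<bar>)"
    using difference_estimate[OF s] by blast
  obtain L where L: "0 < L" "\<And>u. in_Hs s u \<Longrightarrow> in_Hs (s - 1) (mudp_rhs u)"
    "\<And>u v. in_Hs s u \<Longrightarrow> in_Hs s v \<Longrightarrow>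
       nsq (s - 1) (\<lambda>n. mudp_rhs u n - mudp_rhs v n) \<le> L * (nsq s u + nsq s v) * nsq s (\<lambda>n. u n - v n)"
    using mudp_rhs_Hs[OF s] by blast
  define \<tau> where "\<tau> R = 1 / (2 * c * R)" for R
  have "\<exists>u v. galerkin_limit s R (\<tau> R) u0 u v" if R: "0 < R" and u0: "in_Hs s u0" "nsq s u0 \<le> R^2" for R u0
  proof -
    let ?T = "\<tau> R"
    let ?I = "{-?T..?T}"
    have T: "0 < ?T" "?T * (2 * c * R) \<le> 1" using R c(1) by (auto simp: \<tau>_def)
    have "\<forall>N. \<exists>v. galerkin N ?I v \<and> v 0 = trunc N u0"
      using galerkin_exists[OF in_Hs_herm[OF u0(1)] T(1)] by metis
    then obtain v where v: "\<And>N. galerkin N ?I (v N)" "\<And>N. v N 0 = trunc N u0"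
      by metis
    have v_Hs: "in_Hs s (v N t)" if "t \<in> ?I" for N t
      by (rule galerkin_tail(1)[OF v(1) that])
    have v_bd: "nsq s (v N t) \<le> (3 * R)^2" "1 \<le> K \<Longrightarrow> tail_energy s K (v N t) \<le> exp 2 * tail_energy s K u0"
      if "t \<in> ?I" for N t K
      using c(2)[OF R _ T(2) u0 v(1)[of N] v(2)[of N] that] T(1) by auto
    define \<epsilon> where "\<epsilon> N = d * (3 * R)^3 * tail_rate s N * ?T * exp (d * (3 * R) * ?T)" for N
    have \<epsilon>_lim: "\<epsilon> \<longlonglongrightarrow> 0"
      unfolding \<epsilon>_def using s by (auto intro!: tendsto_eq_intros tail_rate_tendsto)
    have near: "(\<Sum>n\<in>modes N. (cmod (v N t n - v M t n))^2) \<le> \<epsilon> N" if t: "t \<in> ?I" and NM: "N \<le> M" for N M t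
    proof -
      have "(\<Sum>n\<in>modes N. (cmod (v N t n - v M t n))^2) \<le> ((\<Sum>n\<in>modes N. (cmod (v N 0 n - v M 0 n))^2)
          + d * (3 * R)^3 * tail_rate s N * \<bar>t - 0\<bar>) * exp (d * (3 * R) * \<bar>t - 0\<bar>)"
      proof (rule d(2)[of _ _ ?I])
        show "closed_segment 0 t \<subseteq> ?I" using t T(1) by (auto simp: closed_segment_eq_real_ivl split: if_splits)
        show "modes_solution s (3 * R) N ?I (v N)" "modes_solution s (3 * R) N ?I (v M)"
          using v(1)[of N] v(1)[of M] modes_mono[OF NM] v_Hs v_bd(1) by (auto simp: modes_solution_def galerkin_def)
      qed (use R in auto)
      also have "(\<Sum>n\<in>modes N. (cmod (v N 0 n - v M 0 n))^2) = 0"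
        unfolding v(2) using modes_mono[OF NM] by (intro sum.neutral) (auto simp: trunc_def)
      also have "(0 + d * (3 * R)^3 * tail_rate s N * \<bar>t - 0\<bar>) * exp (d * (3 * R) * \<bar>t - 0\<bar>) \<le> \<epsilon> N"
        unfolding \<epsilon>_def add_0 using t T(1) d(1) R
        by (intro mult_mono) (auto simp: tail_rate_def)
      finally show ?thesis .
    qed
    have coeff_near: "(cmod (v N t n - v M t n))^2 \<le> \<epsilon> N" if "t \<in> ?I" "N \<le> M" "n \<in> modes N" for N M t n
      using order.trans[OF member_le_sum[of n "modes N" "\<lambda>n. (cmod (v N t n - v M t n))^2"] near[OF that(1,2)]] that(3)
      by simp
    have "\<exists>l. (\<lambda>N. v N t n) \<longlonglongrightarrow> l" if t: "t \<in> ?I" for t n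
    proof -
      have "Cauchy (\<lambda>N. v N t n)"
      proof (rule metric_CauchyI)
        fix e :: real assume e: "0 < e"
        then have "eventually (\<lambda>N. \<epsilon> N < e^2) sequentially"
          by (intro order_tendstoD(2)[OF \<epsilon>_lim]) auto
        then obtain N0 where N0: "\<And>N. N \<ge> N0 \<Longrightarrow> \<epsilon> N < e^2"
          by (auto simp: eventually_sequentially)
        have le: "dist (v N t n) (v M t n) < e" if "N0 + nat \<bar>n\<bar> \<le> N" "N \<le> M" for N M
        proof -
          have "n \<in> modes N" using that(1) by (auto simp: mem_modes)
          then have "(cmod (v N t n - v M t n))^2 < e^2"
            using coeff_near[OF t that(2)] N0[of N] that(1) by fastforce
          then show ?thesis using e by (simp add: dist_norm power2_less_imp_less)
        qed
        show "\<exists>N0. \<forall>m\<ge>N0. \<forall>k\<ge>N0. dist (v m t n) (v k t n) < e"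
        proof (intro exI[of _ "N0 + nat \<bar>n\<bar>"] allI impI)
          fix m k assume "N0 + nat \<bar>n\<bar> \<le> m" "N0 + nat \<bar>n\<bar> \<le> k"
          then show "dist (v m t n) (v k t n) < e"
            using le[of m k] le[of k m] by (cases "m \<le> k") (auto simp: dist_commute)
        qed
      qed
      then show ?thesis by (simp add: Cauchy_convergent_iff convergent_def)
    qed
    then obtain u where u_lim: "\<And>t n. t \<in> ?I \<Longrightarrow> (\<lambda>N. v N t n) \<longlonglongrightarrow> u t n"
      by metis
    have near_u: "(\<Sum>n\<in>modes N. (cmod (v N t n - u t n))^2) \<le> \<epsilon> N" if t: "t \<in> ?I" for N t
    proof (rule tendsto_upperbound)
      show "(\<lambda>M. \<Sum>n\<in>modes N. (cmod (v N t n - v M t n))^2) \<longlonglongrightarrow> (\<Sum>n\<in>modes N. (cmod (v N t n - u t n))^2)"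
        by (intro tendsto_intros u_lim t)
      show "eventually (\<lambda>M. (\<Sum>n\<in>modes N. (cmod (v N t n - v M t n))^2) \<le> \<epsilon> N) sequentially"
        using near[OF t] by (auto simp: eventually_sequentially)
    qed simp
    have limit_sum: "(\<Sum>n\<in>S. A n * (cmod (u t n))^2) \<le> B"
      if "t \<in> ?I" "\<And>N. (\<Sum>n\<in>S. A n * (cmod (v N t n))^2) \<le> B" for t S B and A :: "int \<Rightarrow> real"
    proof (rule tendsto_upperbound)
      show "(\<lambda>N. \<Sum>n\<in>S. A n * (cmod (v N t n))^2) \<longlonglongrightarrow> (\<Sum>n\<in>S. A n * (cmod (u t n))^2)"
        by (intro tendsto_intros u_lim that)
    qed (use that in auto)
    have u_herm: "herm (u t)" if t: "t \<in> ?I" for t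
      unfolding herm_def
    proof
      fix n
      have "(\<lambda>N. v N t (- n)) \<longlonglongrightarrow> cnj (u t n)"
        using tendsto_cnj[OF u_lim[OF t, of n]] in_Hs_herm[OF v_Hs[OF t]] by (simp add: herm_def)
      then show "u t (- n) = cnj (u t n)"
        using LIMSEQ_unique u_lim[OF t] by blast
    qed
    have u_Hs: "in_Hs s (u t)" "nsq s (u t) \<le> (3 * R)^2" if t: "t \<in> ?I" for t
    proof -
      have "(\<Sum>n\<in>S. Hs_weight s n * (cmod (u t n))^2) \<le> (3 * R)^2" if S: "finite S" for S
        by (rule limit_sum[OF t]) (rule order.trans[OF nsq_ge_sum[OF v_Hs[OF t] S] v_bd(1)[OF t]])
      from in_Hs_bounded[OF u_herm[OF t] this] show "in_Hs s (u t)" "nsq s (u t) \<le> (3 * R)^2" by auto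
    qed
    have u_tail: "tail_energy s K (u t) \<le> exp 2 * tail_energy s K u0" if t: "t \<in> ?I" and K: "1 \<le> K" for t K
    proof (rule tail_energy_bounded)
      show "(\<Sum>n\<in>S. (tail_weight s K n)^2 * (cmod (u t n))^2) \<le> exp 2 * tail_energy s K u0" if S: "finite S" for S
        by (rule limit_sum[OF t]) (rule order.trans[OF tail_sum_le[OF v_Hs[OF t] K S] v_bd(2)[OF t K]])
    qed
    have conv: "\<exists>N0. \<forall>N\<ge>N0. \<forall>t\<in>?I. nsq s (\<lambda>n. v N t n - u t n) < e" if e: "0 < e" for e
    proof -
      have "0 < e / (8 * exp 2)" using e by simp
      then obtain K where K: "1 \<le> K" "tail_energy s K u0 \<le> e / (8 * exp 2)"
        using tail_energy_small[OF u0(1)] by blast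
      have "(\<lambda>N. K powr s * \<epsilon> N) \<longlonglongrightarrow> 0"
        using tendsto_mult_left[OF \<epsilon>_lim, of "K powr s"] by simp
      then have "eventually (\<lambda>N. K powr s * \<epsilon> N < e / 2) sequentially"
        using e by (intro order_tendstoD(2)) auto
      then obtain N1 where N1: "\<And>N. N \<ge> N1 \<Longrightarrow> K powr s * \<epsilon> N < e / 2"
        by (auto simp: eventually_sequentially)
      show ?thesis
      proof (intro exI[of _ "N1 + nat \<lceil>K\<rceil>"] allI impI ballI)
        fix N t assume N: "N1 + nat \<lceil>K\<rceil> \<le> N" and t: "t \<in> ?I"
        have "exp 2 * tail_energy s K u0 \<le> exp 2 * (e / (8 * exp 2))"
          by (intro mult_left_mono K) auto
        then have tl: "exp 2 * tail_energy s K u0 \<le> e / 8" by simp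
        have "nsq s (\<lambda>n. v N t n - u t n) \<le> K powr s * \<epsilon> N + 4 * (e / 8)"
        proof (rule nsq_diff_le_tails[OF _ v_Hs[OF t] u_Hs(1)[OF t] K(1) _ near_u[OF t]])
          show "K \<le> real N" using N by linarith
          show "tail_energy s K (v N t) \<le> e / 8" using v_bd(2)[OF t K(1), of N] tl by simp
          show "tail_energy s K (u t) \<le> e / 8" using u_tail[OF t K(1)] tl by simp
        qed (use s in simp)
        then show "nsq s (\<lambda>n. v N t n - u t n) < e" using N1[of N] N by simp
      qed
    qed
    have deriv: "((\<lambda>\<tau>. u \<tau> n) has_vector_derivative mudp_rhs (u t) n) (at t within ?I)" if t: "t \<in> ?I" for t n
    proof -
      \<comment> \<open>Coefficient n obeys its equation only in approximations of level at least
        |n|, so the sequence starts there.\<close>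
      let ?m = "nat \<bar>n\<bar>"
      have "\<exists>g. \<forall>x\<in>?I. (\<lambda>k. v (k + ?m) x n) \<longlonglongrightarrow> g x \<and>
          (g has_derivative (\<lambda>h. h *\<^sub>R mudp_rhs (u x) n)) (at x within ?I)"
      proof (rule has_derivative_sequence)
        show "convex ?I" by simp
        show "((\<lambda>x. v (k + ?m) x n) has_derivative (\<lambda>h. h *\<^sub>R mudp_rhs (v (k + ?m) x) n)) (at x within ?I)"
          if "x \<in> ?I" for k x
          using v(1)[of "k + ?m"] that by (auto simp: galerkin_def has_vector_derivative_def mem_modes)
        show "0 \<in> ?I" using T(1) by simp
        show "(\<lambda>k. v (k + ?m) 0 n) \<longlonglongrightarrow> u 0 n"
          using u_lim[of 0 n] T(1) by (intro LIMSEQ_ignore_initial_segment) auto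
        fix e :: real assume e: "0 < e"
        \<comment> \<open>Chosen so that the Lipschitz bound for the right-hand side, with both
          squared norms at most (3R)^2, becomes e^2.\<close>
        define e' where "e' = e^2 / (L * (2 * (3 * R)^2))"
        have e': "0 < e'" using e L(1) R by (simp add: e'_def)
        then obtain N0 where N0: "\<And>N x. N \<ge> N0 \<Longrightarrow> x \<in> ?I \<Longrightarrow> nsq s (\<lambda>n. v N x n - u x n) < e'"
          using conv by blast
        show "\<forall>\<^sub>F k in sequentially. \<forall>x\<in>?I. \<forall>h. norm (h *\<^sub>R mudp_rhs (v (k + ?m) x) n - h *\<^sub>R mudp_rhs (u x) n) \<le> e * norm h"
          unfolding eventually_sequentially
        proof (intro exI[of _ N0] allI impI ballI)
          fix k x and h :: real assume k: "N0 \<le> k" and x: "x \<in> ?I"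
          let ?w = "v (k + ?m) x"
          have "in_Hs (s - 1) (\<lambda>n. mudp_rhs ?w n - mudp_rhs (u x) n)"
            by (intro in_Hs_diff L v_Hs u_Hs x)
          then have "(cmod (mudp_rhs ?w n - mudp_rhs (u x) n))^2 \<le> nsq (s - 1) (\<lambda>n. mudp_rhs ?w n - mudp_rhs (u x) n)"
            using s by (intro norm_le_nsq) auto
          also have "\<dots> \<le> L * (nsq s ?w + nsq s (u x)) * nsq s (\<lambda>n. ?w n - u x n)"
            by (intro L v_Hs u_Hs x)
          also have "\<dots> \<le> L * ((3 * R)^2 + (3 * R)^2) * e'"
            using L(1) v_bd(1)[OF x] u_Hs(2)[OF x] N0[of "k + ?m" x] k x
            by (intro mult_mono mult_left_mono add_mono) auto
          also have "\<dots> = e^2" using L(1) R by (simp add: e'_def)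
          finally have "cmod (mudp_rhs ?w n - mudp_rhs (u x) n) \<le> e"
            by (rule power2_le_imp_le) (simp add: e less_imp_le)
          then have "\<bar>h\<bar> * cmod (mudp_rhs ?w n - mudp_rhs (u x) n) \<le> \<bar>h\<bar> * e" by (intro mult_left_mono) auto
          then show "norm (h *\<^sub>R mudp_rhs ?w n - h *\<^sub>R mudp_rhs (u x) n) \<le> e * norm h"
            by (simp add: mult.commute flip: scaleR_diff_right)
        qed
      qed
      then obtain g where g: "\<And>x. x \<in> ?I \<Longrightarrow> (\<lambda>k. v (k + ?m) x n) \<longlonglongrightarrow> g x"
        "\<And>x. x \<in> ?I \<Longrightarrow> (g has_derivative (\<lambda>h. h *\<^sub>R mudp_rhs (u x) n)) (at x within ?I)"
        by blast
      have "g x = u x n" if "x \<in> ?I" for x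
        using g(1)[OF that] LIMSEQ_ignore_initial_segment[OF u_lim[OF that, of n], of ?m] LIMSEQ_unique by blast
      then have "((\<lambda>\<tau>. u \<tau> n) has_derivative (\<lambda>h. h *\<^sub>R mudp_rhs (u t) n)) (at t within ?I)"
        by (intro has_derivative_transform[OF t _ g(2)[OF t]]) auto
      then show ?thesis by (simp add: has_vector_derivative_def)
    qed
    have u_0: "u 0 = u0"
    proof
      fix n
      have "(\<lambda>N. trunc N u0 n) \<longlonglongrightarrow> u0 n"
      proof (rule tendsto_eventually)
        show "\<forall>\<^sub>F N in sequentially. trunc N u0 n = u0 n"
          unfolding eventually_sequentially by (intro exI[of _ "nat \<bar>n\<bar>"]) (auto simp: trunc_def mem_modes)
      qed
      then show "u 0 n = u0 n"
        using u_lim[of 0 n] T(1) LIMSEQ_unique unfolding v(2) by fastforce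
    qed
    have main: "\<forall>t\<in>?I. in_Hs s (u t) \<and> nsq s (u t) \<le> (3 * R)^2 \<and>
        (\<forall>K\<ge>1. tail_energy s K (u t) \<le> exp 2 * tail_energy s K u0) \<and>
        (\<forall>n. ((\<lambda>\<tau>. u \<tau> n) has_vector_derivative mudp_rhs (u t) n) (at t within ?I))"
      using u_Hs u_tail deriv by simp
    have approx: "\<forall>N. galerkin N ?I (v N) \<and> v N 0 = trunc N u0" using v by simp
    have "\<forall>e>0. \<exists>N0. \<forall>N\<ge>N0. \<forall>t\<in>?I. nsq s (\<lambda>n. v N t n - u t n) < e" using conv by simp
    from u_0 main approx this have "galerkin_limit s R ?T u0 u v"
      unfolding galerkin_limit_def by (intro conjI)
    then show ?thesis by blast
  qed
  moreover have "0 < \<tau> R" if "0 < R" for R using that c(1) by (simp add: \<tau>_def)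
  ultimately show thesis by (rule that[rotated])
qed

section \<open>Solutions in terms of Fourier coefficients\<close>

text \<open>A working form of \<open>is_solution\<close>. No derivative in \<open>H^(s-1)\<close>
  appears and every condition concerns a neighbourhood of a single time, so restriction, shift and
  gluing are easy. Limits are two-sided at every point of I.\<close>

definition coeff_solution :: "real \<Rightarrow> real set \<Rightarrow> (real \<Rightarrow> int \<Rightarrow> complex) \<Rightarrow> bool" where
  "coeff_solution s I u \<longleftrightarrow> (\<forall>t\<in>I. in_Hs s (u t) \<and> ((\<lambda>\<tau>. nsq s (\<lambda>n. u \<tau> n - u t n)) \<longlongrightarrow> 0) (at t) \<and>
     (\<forall>n. ((\<lambda>\<tau>. u \<tau> n) has_vector_derivative mudp_rhs (u t) n) (at t)))"

lemma coeff_solution_subset: "coeff_solution s I u \<Longrightarrow> J \<subseteq> I \<Longrightarrow> coeff_solution s J u"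
  by (auto simp: coeff_solution_def)

text \<open>Uniformly small tails reduce continuity in \<open>H^s\<close> to the continuity of
  finitely many coefficients.\<close>

lemma Hs_continuous_of_tails:
  assumes s: "0 \<le> s" and u: "\<And>r. r \<in> I \<Longrightarrow> in_Hs s (u r)" and t: "t \<in> I"
    and tails: "\<And>e. 0 < e \<Longrightarrow> \<exists>K\<ge>1. \<forall>r\<in>I. tail_energy s K (u r) \<le> e"
    and cont: "\<And>n. ((\<lambda>r. u r n) \<longlongrightarrow> u t n) (at t within I)"
  shows "((\<lambda>r. nsq s (\<lambda>n. u r n - u t n)) \<longlongrightarrow> 0) (at t within I)"
proof (rule tendstoI)
  fix e :: real assume e: "0 < e"
  then obtain K where K: "1 \<le> K" "\<And>r. r \<in> I \<Longrightarrow> tail_energy s K (u r) \<le> e / 16"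
    using tails[of "e / 16"] by auto
  define N where "N = nat \<lceil>K\<rceil>"
  have N: "K \<le> real N" unfolding N_def by linarith
  have "((\<lambda>r. \<Sum>n\<in>modes N. (cmod (u r n - u t n))^2) \<longlongrightarrow> (\<Sum>n\<in>modes N. (cmod (u t n - u t n))^2)) (at t within I)"
    by (intro tendsto_intros cont)
  then have "((\<lambda>r. K powr s * (\<Sum>n\<in>modes N. (cmod (u r n - u t n))^2)) \<longlongrightarrow> 0) (at t within I)"
    by (auto intro: tendsto_mult_right_zero)
  then have "\<forall>\<^sub>F r in at t within I. K powr s * (\<Sum>n\<in>modes N. (cmod (u r n - u t n))^2) < e / 2"
    using e by (intro order_tendstoD(2)) auto
  moreover have "\<forall>\<^sub>F r in at t within I. r \<in> I"
    by (simp add: eventually_at_filter)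
  ultimately show "\<forall>\<^sub>F r in at t within I. dist (nsq s (\<lambda>n. u r n - u t n)) 0 < e"
  proof eventually_elim
    case (elim r)
    have "nsq s (\<lambda>n. u r n - u t n) \<le> K powr s * (\<Sum>n\<in>modes N. (cmod (u r n - u t n))^2) + 4 * (e / 16)"
      by (rule nsq_diff_le_tails[OF s u[OF elim(2)] u[OF t] K(1) N order.refl K(2)[OF elim(2)] K(2)[OF t]])
    then show ?case using elim(1) e by simp
  qed
qed

lemma galerkin_limit_coeff_solution:
  assumes s: "0 \<le> s" and u: "galerkin_limit s R T u0 u v" and u0: "in_Hs s u0"
  shows "coeff_solution s {-T<..<T} u"
  unfolding coeff_solution_def
proof (intro ballI conjI allI)
  fix t assume t: "t \<in> {-T<..<T}"
  then have t': "t \<in> {-T..T}" by auto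
  have at: "at t within {-T..T} = at t"
    using t by (intro at_within_interior) (auto simp: interior_atLeastAtMost_real)
  show "in_Hs s (u t)" using u t' by (auto simp: galerkin_limit_def)
  show D: "((\<lambda>\<tau>. u \<tau> n) has_vector_derivative mudp_rhs (u t) n) (at t)" for n
    using u t' at unfolding galerkin_limit_def by metis
  have "((\<lambda>r. nsq s (\<lambda>n. u r n - u t n)) \<longlongrightarrow> 0) (at t within {-T..T})"
  proof (rule Hs_continuous_of_tails[OF s _ t'])
    show "in_Hs s (u r)" if "r \<in> {-T..T}" for r using u that by (auto simp: galerkin_limit_def)
    fix e :: real assume e: "0 < e"
    then have "0 < e / exp 2" by simp
    then obtain K where K: "1 \<le> K" "tail_energy s K u0 \<le> e / exp 2"
      using tail_energy_small[OF u0] by blast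
    then have "exp 2 * tail_energy s K u0 \<le> e" by (simp add: pos_le_divide_eq mult.commute)
    then show "\<exists>K\<ge>1. \<forall>r\<in>{-T..T}. tail_energy s K (u r) \<le> e"
      using u K(1) unfolding galerkin_limit_def by (meson order.trans)
  next
    show "((\<lambda>r. u r n) \<longlongrightarrow> u t n) (at t within {-T..T})" for n
      using has_vector_derivative_continuous[OF D[of n]] unfolding at isCont_def .
  qed
  then show "((\<lambda>r. nsq s (\<lambda>n. u r n - u t n)) \<longlongrightarrow> 0) (at t)" unfolding at .
qed

lemma nsq_tendsto_iff:
  "((\<lambda>x. Hs_norm s (f x)) \<longlongrightarrow> 0) F \<longleftrightarrow> ((\<lambda>x. nsq s (f x)) \<longlongrightarrow> 0) F"
proof
  assume "((\<lambda>x. Hs_norm s (f x)) \<longlongrightarrow> 0) F"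
  from tendsto_power[OF this, of 2] show "((\<lambda>x. nsq s (f x)) \<longlongrightarrow> 0) F"
    by (simp add: Hs_norm_nsq)
next
  assume "((\<lambda>x. nsq s (f x)) \<longlongrightarrow> 0) F"
  from tendsto_real_sqrt[OF this] show "((\<lambda>x. Hs_norm s (f x)) \<longlongrightarrow> 0) F"
    by (simp add: Hs_norm_nsq)
qed

lemma mudp_rhs_continuous:
  fixes s :: real
  assumes s: "s > 3/2" and u: "in_Hs s (u t)" "\<forall>\<^sub>F r in F. in_Hs s (u r)"
    and lim: "((\<lambda>r. nsq s (\<lambda>n. u r n - u t n)) \<longlongrightarrow> 0) F"
  shows "((\<lambda>r. nsq (s - 1) (\<lambda>n. mudp_rhs (u r) n - mudp_rhs (u t) n)) \<longlongrightarrow> 0) F"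
proof -
  obtain L where L: "0 < L" "\<And>u. in_Hs s u \<Longrightarrow> in_Hs (s - 1) (mudp_rhs u)"
    "\<And>u v. in_Hs s u \<Longrightarrow> in_Hs s v \<Longrightarrow>
       nsq (s - 1) (\<lambda>n. mudp_rhs u n - mudp_rhs v n) \<le> L * (nsq s u + nsq s v) * nsq s (\<lambda>n. u n - v n)"
    using mudp_rhs_Hs[OF s] by blast
  let ?x = "\<lambda>r. nsq s (\<lambda>n. u r n - u t n)"
  have bound: "\<forall>\<^sub>F r in F. nsq (s - 1) (\<lambda>n. mudp_rhs (u r) n - mudp_rhs (u t) n)
      \<le> L * (2 * ?x r + 3 * nsq s (u t)) * ?x r"
    using u(2)
  proof eventually_elim
    case (elim r)
    have "nsq s (u r) \<le> 2 * ?x r + 2 * nsq s (u t)"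
      using in_Hs_add(2)[OF in_Hs_diff(1)[OF elim u(1)] u(1)] by simp
    then have "L * (nsq s (u r) + nsq s (u t)) * ?x r \<le> L * (2 * ?x r + 3 * nsq s (u t)) * ?x r"
      using L(1) by (intro mult_right_mono mult_left_mono) auto
    then show ?case using L(3)[OF elim u(1)] by linarith
  qed
  have "((\<lambda>r. L * (2 * ?x r + 3 * nsq s (u t)) * ?x r) \<longlongrightarrow> L * (2 * 0 + 3 * nsq s (u t)) * 0) F"
    by (intro tendsto_intros lim)
  then have "((\<lambda>r. L * (2 * ?x r + 3 * nsq s (u t)) * ?x r) \<longlongrightarrow> 0) F" by simp
  then show ?thesis
    by (rule tendsto_sandwich[OF always_eventually bound tendsto_const, rotated]) simp
qed

text \<open>Testing against the fixed vector \<open>d b - d a\<close> reduces this to the scalar mean value theorem.\<close>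

lemma weighted_mean_value:
  fixes d :: "real \<Rightarrow> int \<Rightarrow> complex"
  assumes der: "\<And>r n. r \<in> closed_segment a b \<Longrightarrow> n \<in> S \<Longrightarrow>
      ((\<lambda>r. d r n) has_vector_derivative g r n) (at r within closed_segment a b)"
    and w: "\<And>n. 0 \<le> w n" and e: "0 \<le> e"
    and le: "\<And>r. r \<in> closed_segment a b \<Longrightarrow> (\<Sum>n\<in>S. w n * (cmod (g r n))^2) \<le> e^2"
  shows "(\<Sum>n\<in>S. w n * (cmod (d b n - d a n))^2) \<le> (e * \<bar>b - a\<bar>)^2"
proof -
  define \<Delta> where "\<Delta> n = d b n - d a n" for n
  define D where "D = (\<Sum>n\<in>S. w n * (cmod (\<Delta> n))^2)"
  define h where "h r = (\<Sum>n\<in>S. w n * (\<Delta> n \<bullet> d r n))" for r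
  have D0: "0 \<le> D" unfolding D_def by (intro sum_nonneg mult_nonneg_nonneg w) auto
  have "norm (h b - h a) \<le> (sqrt D * e) * norm (b - a)"
  proof (rule field_differentiable_bound)
    show "convex (closed_segment a b)" by simp
    fix r assume r: "r \<in> closed_segment a b"
    have "((\<lambda>r. \<Delta> n \<bullet> d r n) has_vector_derivative \<Delta> n \<bullet> g r n) (at r within closed_segment a b)"
      if "n \<in> S" for n
      by (rule bounded_linear.has_vector_derivative[OF bounded_linear_inner_right der[OF r that]])
    then show "(h has_field_derivative (\<Sum>n\<in>S. w n * (\<Delta> n \<bullet> g r n))) (at r within closed_segment a b)"
      unfolding h_def has_real_derivative_iff_has_vector_derivative
      by (intro has_vector_derivative_sum has_vector_derivative_mult_right)
    have "norm (\<Sum>n\<in>S. w n * (\<Delta> n \<bullet> g r n)) \<le> (\<Sum>n\<in>S. w n * cmod (\<Delta> n) * cmod (g r n))"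
      using Cauchy_Schwarz_ineq2 w
      by (intro sum_norm_le) (auto simp: abs_mult mult.assoc intro!: mult_left_mono)
    also have "\<dots> \<le> sqrt D * sqrt (e^2)"
      using w le[OF r] by (intro weighted_Cauchy_Schwarz) (auto simp: D_def)
    finally show "norm (\<Sum>n\<in>S. w n * (\<Delta> n \<bullet> g r n)) \<le> sqrt D * e"
      using e by simp
  qed auto
  moreover have "h b - h a = D"
  proof -
    have "h b - h a = (\<Sum>n\<in>S. w n * (\<Delta> n \<bullet> \<Delta> n))"
      unfolding h_def sum_subtractf[symmetric]
      by (intro sum.cong refl) (simp only: \<Delta>_def right_diff_distrib[symmetric] inner_diff_right[symmetric])
    then show ?thesis by (simp add: D_def power2_norm_eq_inner)
  qed
  ultimately have "D \<le> sqrt D * (e * \<bar>b - a\<bar>)" using D0 by simp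
  then have le: "sqrt D * sqrt D \<le> sqrt D * (e * \<bar>b - a\<bar>)" using D0 by simp
  have "sqrt D \<le> e * \<bar>b - a\<bar>"
  proof (cases "D = 0")
    case True
    then show ?thesis using e by simp
  next
    case False
    then have "0 < sqrt D" using D0 by simp
    from mult_le_cancel_left_pos[OF this] le show ?thesis by blast
  qed
  then have "D \<le> (e * \<bar>b - a\<bar>)^2" by (rule sqrt_le_D)
  then show ?thesis by (simp add: D_def \<Delta>_def)
qed

lemma in_Hs_divide: "in_Hs s v \<Longrightarrow> in_Hs s (\<lambda>n. v n / of_real r)"
proof -
  assume v: "in_Hs s v"
  have "(\<lambda>n. (1 / r)^2 * (Hs_weight s n * (cmod (v n))^2)) summable_on UNIV"
    by (intro summable_on_cmult_right in_Hs_summable v)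
  moreover have eq: "Hs_weight s n * (cmod (v n / of_real r))^2 = (1 / r)^2 * (Hs_weight s n * (cmod (v n))^2)" for n
    by (simp add: norm_divide power_divide)
  moreover have "v (- n) / of_real r = cnj (v n / of_real r)" for n
    using v by (simp add: in_Hs_def)
  ultimately show ?thesis unfolding in_Hs_def eq by simp
qed

lemma has_vector_derivative_iff_quotient:
  fixes f :: "real \<Rightarrow> complex"
  shows "(f has_vector_derivative d) (at t) \<longleftrightarrow> ((\<lambda>\<tau>. (f \<tau> - f t) / of_real (\<tau> - t) - d) \<longlongrightarrow> 0) (at t)"
proof -
  have "norm (f \<tau> - f t - (\<tau> - t) *\<^sub>R d) / norm (\<tau> - t) = norm ((f \<tau> - f t) / of_real (\<tau> - t) - d)"
    if "\<tau> \<noteq> t" for \<tau>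
  proof -
    have "f \<tau> - f t - (\<tau> - t) *\<^sub>R d = ((f \<tau> - f t) / of_real (\<tau> - t) - d) * of_real (\<tau> - t)"
      using that by (simp add: scaleR_conv_of_real field_simps)
    then show ?thesis using that by (simp add: norm_mult flip: of_real_diff)
  qed
  then have "((\<lambda>\<tau>. norm (f \<tau> - f t - (\<tau> - t) *\<^sub>R d) / norm (\<tau> - t)) \<longlongrightarrow> 0) (at t)
      \<longleftrightarrow> ((\<lambda>\<tau>. norm ((f \<tau> - f t) / of_real (\<tau> - t) - d)) \<longlongrightarrow> 0) (at t)"
    by (intro filterlim_cong refl) (simp add: eventually_at_filter)
  then show ?thesis
    unfolding has_vector_derivative_def has_derivative_iff_norm tendsto_norm_zero_iff
    by (simp only: bounded_linear_scaleR_left simp_thms)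
qed

text \<open>Single coefficients are dominated by the \<open>H^(s-1)\<close> norm, which gives one
  direction. For the other, the right-hand side is continuous in \<open>H^(s-1)\<close> along u, and
  the mean value inequality turns coefficientwise derivatives into difference quotients that
  converge in that norm.\<close>

lemma is_solution_iff:
  fixes s :: real
  assumes s: "s > 3/2"
  shows "is_solution s T u \<longleftrightarrow> coeff_solution s {-T<..<T} u"
proof -
  let ?I = "{-T<..<T}"
  have at: "at t within ?I = at t" if "t \<in> ?I" for t
    using that by (intro at_within_open) auto
  have ev: "\<forall>\<^sub>F r in at t. r \<in> ?I" if "t \<in> ?I" for t
    using that by (intro eventually_at_in_open') auto
  show ?thesis
  proof
    assume "is_solution s T u"
    then obtain u' where u: "cont_Hs s ?I u" and u': "cont_Hs (s - 1) ?I u'"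
      and D': "\<forall>t\<in>?I. has_Hs_deriv (s - 1) u (u' t) t ?I \<and> u' t = mudp_rhs (u t)"
      unfolding is_solution_def by blast
    have D: "has_Hs_deriv (s - 1) u (u' t) t ?I" "u' t = mudp_rhs (u t)" if "t \<in> ?I" for t
      using bspec[OF D' that] by blast+
    show "coeff_solution s ?I u"
      unfolding coeff_solution_def
    proof (intro ballI conjI allI)
      fix t assume t: "t \<in> ?I"
      show ut: "in_Hs s (u t)" using u t by (auto simp: cont_Hs_def)
      show "((\<lambda>\<tau>. nsq s (\<lambda>n. u \<tau> n - u t n)) \<longlongrightarrow> 0) (at t)"
      proof -
        have "((\<lambda>\<tau>. nsq s (\<lambda>n. u \<tau> n - u t n)) \<longlongrightarrow> 0) (at t within ?I)"
          using u t unfolding cont_Hs_def Hs_dist_def nsq_tendsto_iff by blast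
        then show ?thesis unfolding at[OF t] .
      qed
      fix n
      let ?q = "\<lambda>\<tau> n. (u \<tau> n - u t n) / of_real (\<tau> - t) - u' t n"
      have lim: "((\<lambda>\<tau>. Hs_norm (s - 1) (?q \<tau>)) \<longlongrightarrow> 0) (at t)"
        using D(1)[OF t] by (simp add: has_Hs_deriv_def at[OF t])
      have "\<forall>\<^sub>F \<tau> in at t. norm (?q \<tau> n) \<le> Hs_norm (s - 1) (?q \<tau>)"
        using ev[OF t]
      proof eventually_elim
        case (elim \<tau>)
        have "in_Hs (s - 1) (\<lambda>n. u \<tau> n - u t n)"
          using u elim ut by (intro in_Hs_mono(1)[OF in_Hs_diff(1)]) (auto simp: cont_Hs_def)
        moreover have "in_Hs (s - 1) (u' t)"
          using u' t by (simp add: cont_Hs_def)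
        ultimately have "in_Hs (s - 1) (?q \<tau>)"
          by (rule in_Hs_diff(1)[OF in_Hs_divide])
        then have "(cmod (?q \<tau> n))^2 \<le> nsq (s - 1) (?q \<tau>)"
          using s by (intro norm_le_nsq) auto
        then show ?case unfolding Hs_norm_nsq by (rule real_le_rsqrt)
      qed
      from Lim_null_comparison[OF this lim]
      show "((\<lambda>\<tau>. u \<tau> n) has_vector_derivative mudp_rhs (u t) n) (at t)"
        unfolding has_vector_derivative_iff_quotient D(2)[OF t, symmetric] .
    qed
  next
    assume sol: "coeff_solution s ?I u"
    then have u: "in_Hs s (u t)" "((\<lambda>\<tau>. nsq s (\<lambda>n. u \<tau> n - u t n)) \<longlongrightarrow> 0) (at t)"
      "((\<lambda>\<tau>. u \<tau> n) has_vector_derivative mudp_rhs (u t) n) (at t)" if "t \<in> ?I" for t n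
      using that by (auto simp: coeff_solution_def)
    have rhs: "in_Hs (s - 1) (mudp_rhs (u t))" if "t \<in> ?I" for t
      using mudp_rhs_Hs[OF s] u(1)[OF that] by metis
    have rhs_cont: "((\<lambda>r. nsq (s - 1) (\<lambda>n. mudp_rhs (u r) n - mudp_rhs (u t) n)) \<longlongrightarrow> 0) (at t)"
      if t: "t \<in> ?I" for t
    proof (rule mudp_rhs_continuous[OF s u(1)[OF t] _ u(2)[OF t]])
      show "\<forall>\<^sub>F r in at t. in_Hs s (u r)"
        using ev[OF t] by eventually_elim (rule u(1))
    qed
    show "is_solution s T u"
      unfolding is_solution_def
    proof (intro conjI exI[of _ "\<lambda>t. mudp_rhs (u t)"] ballI refl)
      show "cont_Hs s ?I u"
        unfolding cont_Hs_def Hs_dist_def nsq_tendsto_iff using u at by auto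
      show "cont_Hs (s - 1) ?I (\<lambda>t. mudp_rhs (u t))"
        unfolding cont_Hs_def Hs_dist_def nsq_tendsto_iff using rhs rhs_cont at by auto
      fix t assume t: "t \<in> ?I"
      let ?q = "\<lambda>\<tau> n. (u \<tau> n - u t n) / of_real (\<tau> - t) - mudp_rhs (u t) n"
      have "((\<lambda>\<tau>. nsq (s - 1) (?q \<tau>)) \<longlongrightarrow> 0) (at t)"
      proof (rule tendstoI)
        fix e :: real assume e: "0 < e"
        define e' where "e' = sqrt (e / 2)"
        have e': "0 < e'" "e'^2 = e / 2" using e by (auto simp: e'_def)
        have "\<forall>\<^sub>F r in at t. nsq (s - 1) (\<lambda>n. mudp_rhs (u r) n - mudp_rhs (u t) n) < e'^2 \<and> r \<in> ?I"
          using e' by (intro eventually_conj order_tendstoD(2)[OF rhs_cont[OF t]] ev[OF t]) auto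
        then obtain \<delta> where \<delta>: "0 < \<delta>" "\<And>r. r \<noteq> t \<Longrightarrow> dist r t < \<delta> \<Longrightarrow>
            nsq (s - 1) (\<lambda>n. mudp_rhs (u r) n - mudp_rhs (u t) n) < e'^2 \<and> r \<in> ?I"
          unfolding eventually_at by auto
        have "nsq (s - 1) (?q \<tau>) \<le> e'^2" if \<tau>: "\<tau> \<noteq> t" "dist \<tau> t < \<delta>" for \<tau>
        proof -
          have seg: "r \<in> ?I \<and> nsq (s - 1) (\<lambda>n. mudp_rhs (u r) n - mudp_rhs (u t) n) \<le> e'^2"
            if "r \<in> closed_segment t \<tau>" for r
          proof (cases "r = t")
            case True
            then show ?thesis using t e' by simp
          next
            case False
            have "dist r t \<le> dist \<tau> t"
              using that segment_bound(1)[of r t \<tau>] by (simp add: dist_norm norm_minus_commute)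
            then show ?thesis using \<delta>(2)[OF False] \<tau> by auto
          qed
          have herm_q: "herm (?q \<tau>)"
            using in_Hs_diff(1)[OF in_Hs_divide[OF in_Hs_mono(1)[OF in_Hs_diff(1)[OF u(1) u(1)[OF t]]]] rhs[OF t], of \<tau> "\<tau> - t"]
              \<delta>(2)[OF \<tau>] in_Hs_herm by auto
          have "(\<Sum>n\<in>S. Hs_weight (s - 1) n * (cmod (?q \<tau> n))^2) \<le> e'^2" if S: "finite S" for S
          proof -
            \<comment> \<open>Subtracting the linear function whose slope is the derivative at t
              leaves a derivative that is small near t.\<close>
            let ?d = "\<lambda>r n. u r n - r *\<^sub>R mudp_rhs (u t) n"
            have "(\<Sum>n\<in>S. Hs_weight (s - 1) n * (cmod (?d \<tau> n - ?d t n))^2) \<le> (e' * \<bar>\<tau> - t\<bar>)^2"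
            proof (rule weighted_mean_value[where g = "\<lambda>r n. mudp_rhs (u r) n - mudp_rhs (u t) n"])
              fix r n assume r: "r \<in> closed_segment t \<tau>"
              have "((\<lambda>r. ?d r n) has_vector_derivative mudp_rhs (u r) n - 1 *\<^sub>R mudp_rhs (u t) n) (at r)"
                using seg[OF r] by (intro has_vector_derivative_diff u(3) bounded_linear.has_vector_derivative[OF bounded_linear_scaleR_left]) (auto intro: has_vector_derivative_id)
              then show "((\<lambda>r. ?d r n) has_vector_derivative mudp_rhs (u r) n - mudp_rhs (u t) n) (at r within closed_segment t \<tau>)"
                by (simp add: has_vector_derivative_at_within)
              have "in_Hs (s - 1) (\<lambda>n. mudp_rhs (u r) n - mudp_rhs (u t) n)"
                using seg[OF r] t by (intro in_Hs_diff rhs) auto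
              then show "(\<Sum>n\<in>S. Hs_weight (s - 1) n * (cmod (mudp_rhs (u r) n - mudp_rhs (u t) n))^2) \<le> e'^2"
                using nsq_ge_sum[OF _ S] seg[OF r] by fastforce
            qed (use e' in auto)
            also have "?d \<tau> n - ?d t n = of_real (\<tau> - t) * ?q \<tau> n" for n
              using \<tau>(1) by (simp add: scaleR_conv_of_real field_simps)
            then have "(\<Sum>n\<in>S. Hs_weight (s - 1) n * (cmod (?d \<tau> n - ?d t n))^2)
                = \<bar>\<tau> - t\<bar>^2 * (\<Sum>n\<in>S. Hs_weight (s - 1) n * (cmod (?q \<tau> n))^2)"
              unfolding sum_distrib_left
              by (intro sum.cong refl) (simp only: norm_mult norm_of_real power_mult_distrib mult.left_commute)
            finally show ?thesis
              using \<tau>(1) by (simp add: power_mult_distrib mult.commute[of "e'^2"])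
          qed
          from in_Hs_bounded(2)[OF herm_q this] show ?thesis .
        qed
        then have "\<forall>\<^sub>F \<tau> in at t. nsq (s - 1) (?q \<tau>) \<le> e'^2"
          unfolding eventually_at using \<delta>(1) by blast
        then show "\<forall>\<^sub>F \<tau> in at t. dist (nsq (s - 1) (?q \<tau>)) 0 < e"
          by eventually_elim (use e' e in auto)
      qed
      then show "has_Hs_deriv (s - 1) u (mudp_rhs (u t)) t ?I"
        unfolding has_Hs_deriv_def nsq_tendsto_iff at[OF t] .
    qed
  qed
qed

section \<open>Uniqueness and continuous dependence\<close>

lemma coeff_solution_bounded:
  assumes u: "coeff_solution s I u" and J: "compact J" "J \<subseteq> I"
  obtains R where "0 < R" "\<And>t. t \<in> J \<Longrightarrow> nsq s (u t) \<le> R^2"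
proof -
  have "\<exists>d>0. \<forall>r\<in>J. dist r t < d \<longrightarrow> nsq s (u r) \<le> 2 + 2 * nsq s (u t)" if t: "t \<in> J" for t
  proof -
    have "((\<lambda>\<tau>. nsq s (\<lambda>n. u \<tau> n - u t n)) \<longlongrightarrow> 0) (at t)" and ut: "in_Hs s (u t)"
      using u t J by (auto simp: coeff_solution_def)
    then have "\<forall>\<^sub>F r in at t. nsq s (\<lambda>n. u r n - u t n) < 1"
      by (intro order_tendstoD(2)) auto
    then obtain d where d: "0 < d" "\<And>r. r \<noteq> t \<Longrightarrow> dist r t < d \<Longrightarrow> nsq s (\<lambda>n. u r n - u t n) < 1"
      unfolding eventually_at by auto
    have "nsq s (u r) \<le> 2 + 2 * nsq s (u t)" if r: "r \<in> J" "dist r t < d" for r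
    proof (cases "r = t")
      case True
      then show ?thesis by simp
    next
      case False
      have "in_Hs s (u r)" using u r J by (auto simp: coeff_solution_def)
      then have "nsq s (u r) \<le> 2 * nsq s (\<lambda>n. u r n - u t n) + 2 * nsq s (u t)"
        using in_Hs_add(2)[OF in_Hs_diff(1)[OF _ ut] ut, of "u r"] by simp
      then show ?thesis using d(2)[OF False r(2)] by simp
    qed
    then show ?thesis using d(1) by blast
  qed
  then obtain d where d: "\<And>t. t \<in> J \<Longrightarrow> 0 < d t"
    "\<And>t r. t \<in> J \<Longrightarrow> r \<in> J \<Longrightarrow> dist r t < d t \<Longrightarrow> nsq s (u r) \<le> 2 + 2 * nsq s (u t)"
    by metis
  have "J \<subseteq> (\<Union>t\<in>J. ball t (d t))" using d(1) by force
  then obtain C where C: "C \<subseteq> J" "finite C" "J \<subseteq> (\<Union>t\<in>C. ball t (d t))"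
    using compactE_image[OF J(1), of J "\<lambda>t. ball t (d t)"] by auto
  define B where "B = (\<Sum>t\<in>C. 2 + 2 * nsq s (u t)) + 1"
  have B: "0 < B" unfolding B_def by (intro add_nonneg_pos sum_nonneg) auto
  show thesis
  proof (rule that[of "sqrt B"])
    show "0 < sqrt B" using B by simp
    fix r assume r: "r \<in> J"
    then obtain t where t: "t \<in> C" "dist r t < d t" using C(3) by (auto simp: dist_commute)
    have "nsq s (u r) \<le> 2 + 2 * nsq s (u t)" using d(2)[of t r] t r C(1) by auto
    also have "\<dots> \<le> (\<Sum>t\<in>C. 2 + 2 * nsq s (u t))"
      using t(1) C(2) by (intro member_le_sum) auto
    also have "\<dots> \<le> (sqrt B)^2" using B by (simp add: B_def)
    finally show "nsq s (u r) \<le> (sqrt B)^2" .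
  qed
qed

text \<open>The difference estimate holds for every N with zero initial difference, and its error
  term vanishes as N grows. Compactness of the segment supplies the common bound R that it
  requires.\<close>

lemma coeff_solution_unique:
  fixes s :: real
  assumes s: "s > 3/2" and u: "coeff_solution s I u" and v: "coeff_solution s I v"
    and eq: "u a = v a" and seg: "closed_segment a b \<subseteq> I"
  shows "u b = v b"
proof
  fix n
  let ?J = "closed_segment a b"
  obtain Ru where Ru: "0 < Ru" "\<And>t. t \<in> ?J \<Longrightarrow> nsq s (u t) \<le> Ru^2"
    using coeff_solution_bounded[OF u compact_segment seg] by blast
  obtain Rv where Rv: "0 < Rv" "\<And>t. t \<in> ?J \<Longrightarrow> nsq s (v t) \<le> Rv^2"
    using coeff_solution_bounded[OF v compact_segment seg] by blast
  define R where "R = max Ru Rv"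
  have R: "0 \<le> R" "Ru^2 \<le> R^2" "Rv^2 \<le> R^2"
    using Ru(1) Rv(1) by (auto simp: R_def intro!: power_mono)
  obtain c where c: "0 < c" "\<And>N R I u v a b.
     \<lbrakk>modes_solution s R N I u; modes_solution s R N I v; closed_segment a b \<subseteq> I; 0 \<le> R\<rbrakk> \<Longrightarrow>
      (\<Sum>n\<in>modes N. (cmod (u b n - v b n))^2) \<le>
        ((\<Sum>n\<in>modes N. (cmod (u a n - v a n))^2) + c * R^3 * tail_rate s N * \<bar>b - a\<bar>) * exp (c * R * \<bar>b - a\<bar>)"
    using difference_estimate[OF s] by blast
  have le: "(\<Sum>n\<in>modes N. (cmod (u b n - v b n))^2) \<le> c * R^3 * tail_rate s N * \<bar>b - a\<bar> * exp (c * R * \<bar>b - a\<bar>)" for N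
  proof -
    have "(\<Sum>n\<in>modes N. (cmod (u b n - v b n))^2) \<le>
        ((\<Sum>n\<in>modes N. (cmod (u a n - v a n))^2) + c * R^3 * tail_rate s N * \<bar>b - a\<bar>) * exp (c * R * \<bar>b - a\<bar>)"
    proof (rule c(2)[OF _ _ order.refl])
      have "((\<lambda>\<tau>. w \<tau> n) has_vector_derivative mudp_rhs (w t) n) (at t within ?J)" "in_Hs s (w t)"
        if "coeff_solution s I w" "t \<in> ?J" for w t n
        using that subsetD[OF seg that(2)] unfolding coeff_solution_def by (blast intro: has_vector_derivative_at_within)+
      then show "modes_solution s R N ?J u" "modes_solution s R N ?J v"
        using u v Ru(2) Rv(2) R(2,3) unfolding modes_solution_def by (blast intro: order.trans)+
    qed (rule R(1))
    then show ?thesis by (simp add: eq)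
  qed
  have "(\<lambda>N. c * R^3 * tail_rate s N * \<bar>b - a\<bar> * exp (c * R * \<bar>b - a\<bar>)) \<longlonglongrightarrow> 0"
    using s by (auto intro!: tendsto_eq_intros tail_rate_tendsto)
  moreover have "\<forall>\<^sub>F N in sequentially. (cmod (u b n - v b n))^2 \<le> c * R^3 * tail_rate s N * \<bar>b - a\<bar> * exp (c * R * \<bar>b - a\<bar>)"
    unfolding eventually_sequentially
  proof (intro exI[of _ "nat \<bar>n\<bar>"] allI impI)
    fix N assume "nat \<bar>n\<bar> \<le> N"
    then have "n \<in> modes N" by (auto simp: mem_modes)
    then have "(cmod (u b n - v b n))^2 \<le> (\<Sum>n\<in>modes N. (cmod (u b n - v b n))^2)"
      by (intro member_le_sum[of n]) auto
    then show "(cmod (u b n - v b n))^2 \<le> c * R^3 * tail_rate s N * \<bar>b - a\<bar> * exp (c * R * \<bar>b - a\<bar>)"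
      using le[of N] by linarith
  qed
  ultimately have "(cmod (u b n - v b n))^2 \<le> 0"
    by (rule tendsto_lowerbound) simp
  then show "u b n = v b n" by simp
qed

lemma Hs_dist_less_iff: "0 < e \<Longrightarrow> Hs_dist s v w < e \<longleftrightarrow> nsq s (\<lambda>n. v n - w n) < e^2"
  unfolding Hs_dist_def Hs_norm_nsq
  using real_sqrt_less_iff[of "nsq s (\<lambda>n. v n - w n)" "e^2"] by simp

text \<open>The order of choices: K makes the tail of u0 small, N makes the truncation error small
  even after multiplication by K^s, and \<open>\<delta>\<close> is fitted to both. The tail bounds
  for the two solutions come from \<open>galerkin_limit\<close>, with the same R and T.\<close>

lemma continuous_dependence:
  fixes s :: real
  assumes s: "s > 3/2" and R: "0 < R" and T: "0 < T" and u0: "in_Hs s u0"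
    and u: "galerkin_limit s R T u0 u p" and e: "0 < e"
  obtains \<delta> where "0 < \<delta>" "\<And>v0 v q t. \<lbrakk>in_Hs s v0; nsq s (\<lambda>n. v0 n - u0 n) < \<delta>; galerkin_limit s R T v0 v q; t \<in> {-T..T}\<rbrakk>
      \<Longrightarrow> nsq s (\<lambda>n. v t n - u t n) < e"
proof -
  obtain c where c: "0 < c" "\<And>N R I u v a b.
     \<lbrakk>modes_solution s R N I u; modes_solution s R N I v; closed_segment a b \<subseteq> I; 0 \<le> R\<rbrakk> \<Longrightarrow>
      (\<Sum>n\<in>modes N. (cmod (u b n - v b n))^2) \<le>
        ((\<Sum>n\<in>modes N. (cmod (u a n - v a n))^2) + c * R^3 * tail_rate s N * \<bar>b - a\<bar>) * exp (c * R * \<bar>b - a\<bar>)"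
    using difference_estimate[OF s] by blast
  define E where "E = exp (c * (3 * R) * T)"
  define A where "A N = c * (3 * R)^3 * tail_rate s N * T" for N
  have E: "0 < E" by (simp add: E_def)
  have "0 < e / (64 * exp 2)" using e by simp
  then obtain K where K: "1 \<le> K" "tail_energy s K u0 \<le> e / (64 * exp 2)"
    using tail_energy_small[OF u0] by blast
  have Ks: "0 < K powr s" using K by simp
  have "(\<lambda>N. K powr s * (A N * E)) \<longlonglongrightarrow> 0"
    unfolding A_def using s by (auto intro!: tendsto_eq_intros tail_rate_tendsto)
  then have "\<forall>\<^sub>F N in sequentially. K powr s * (A N * E) < e / 8 \<and> nat \<lceil>K\<rceil> \<le> N"
    using e by (intro eventually_conj order_tendstoD(2) eventually_ge_at_top) auto
  then obtain N where "\<forall>M\<ge>N. K powr s * (A M * E) < e / 8 \<and> nat \<lceil>K\<rceil> \<le> M"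
    unfolding eventually_sequentially by blast
  then have N: "K powr s * (A N * E) < e / 8" "nat \<lceil>K\<rceil> \<le> N" by blast+
  \<comment> \<open>The first bound keeps the tail of the perturbed solution below its share e/16;
    the second lets the difference of the data contribute at most e/8 through the low modes.\<close>
  define \<delta> where "\<delta> = min (e / (64 * exp 2)) (e / (8 * (K powr s * E)))"
  have \<delta>: "0 < \<delta>" using e Ks E by (simp add: \<delta>_def)
  have \<delta>1: "exp 2 * \<delta> \<le> e / 64" 
  proof -
    have "exp 2 * \<delta> \<le> exp 2 * (e / (64 * exp 2))" by (intro mult_left_mono) (auto simp: \<delta>_def)
    then show ?thesis by simp
  qed
  have \<delta>2: "K powr s * (\<delta> * E) \<le> e / 8"
  proof -
    have "(K powr s * E) * \<delta> \<le> (K powr s * E) * (e / (8 * (K powr s * E)))"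
      using Ks E by (intro mult_left_mono) (auto simp: \<delta>_def)
    then show ?thesis using Ks E by (simp add: mult_ac)
  qed
  have tail0: "exp 2 * tail_energy s K u0 \<le> e / 64"
  proof -
    have "exp 2 * tail_energy s K u0 \<le> exp 2 * (e / (64 * exp 2))" by (intro mult_left_mono K) auto
    then show ?thesis by simp
  qed
  have "nsq s (\<lambda>n. v t n - u t n) < e"
    if v0: "in_Hs s v0" "nsq s (\<lambda>n. v0 n - u0 n) < \<delta>" and v: "galerkin_limit s R T v0 v q" and t: "t \<in> {-T..T}"
    for v0 v q t
  proof -
    have low: "(\<Sum>n\<in>modes N. (cmod (v t n - u t n))^2) \<le> (\<delta> + A N) * E"
    proof -
      have "(\<Sum>n\<in>modes N. (cmod (v t n - u t n))^2) \<le>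
        ((\<Sum>n\<in>modes N. (cmod (v 0 n - u 0 n))^2) + c * (3 * R)^3 * tail_rate s N * \<bar>t - 0\<bar>) * exp (c * (3 * R) * \<bar>t - 0\<bar>)"
      proof (rule c(2)[of _ _ "{-T..T}"])
        show "modes_solution s (3 * R) N {-T..T} v" "modes_solution s (3 * R) N {-T..T} u"
          using u v unfolding modes_solution_def galerkin_limit_def by blast+
        show "closed_segment 0 t \<subseteq> {-T..T}"
          using t T by (auto simp: closed_segment_eq_real_ivl split: if_splits)
      qed (use R in simp)
      also have "\<dots> \<le> (\<delta> + A N) * E"
      proof (rule mult_mono)
        have "(\<Sum>n\<in>modes N. (cmod (v 0 n - u 0 n))^2) \<le> (\<Sum>n\<in>modes N. Hs_weight s n * (cmod (v0 n - u0 n))^2)"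
          using u v s mult_right_mono[OF Hs_weight_ge_1[of s], of "(cmod (v0 _ - u0 _))^2"]
          by (intro sum_mono) (auto simp: galerkin_limit_def)
        also have "\<dots> \<le> \<delta>"
          using nsq_ge_sum[OF in_Hs_diff(1)[OF v0(1) u0], of "modes N"] v0(2) by simp
        finally show "(\<Sum>n\<in>modes N. (cmod (v 0 n - u 0 n))^2) + c * (3 * R)^3 * tail_rate s N * \<bar>t - 0\<bar> \<le> \<delta> + A N"
          unfolding A_def using t c(1) R by (intro add_mono mult_left_mono) (auto simp: tail_rate_def)
        show "exp (c * (3 * R) * \<bar>t - 0\<bar>) \<le> E"
          unfolding E_def exp_le_cancel_iff using t c(1) R by (intro mult_left_mono) auto
      qed (use \<delta> c(1) R T in \<open>auto simp: A_def tail_rate_def\<close>)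
      finally show ?thesis .
    qed
    have "tail_energy s K (u t) \<le> exp 2 * tail_energy s K u0"
      using u t K(1) by (auto simp: galerkin_limit_def)
    then have tail_u: "tail_energy s K (u t) \<le> e / 16" using tail0 e by linarith
    have "tail_energy s K (v t) \<le> exp 2 * tail_energy s K v0"
      using v t K(1) by (auto simp: galerkin_limit_def)
    also have "\<dots> \<le> exp 2 * (2 * tail_energy s K u0 + 2 * \<delta>)"
      using tail_energy_perturb[OF u0 v0(1) K(1)] v0(2) by (intro mult_left_mono) auto
    also have "\<dots> \<le> e / 16" using tail0 \<delta>1 by (simp add: algebra_simps)
    finally have tail_v: "tail_energy s K (v t) \<le> e / 16" .
    have Hs: "in_Hs s (v t)" "in_Hs s (u t)"
      using u v t by (auto simp: galerkin_limit_def)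
    have "nsq s (\<lambda>n. v t n - u t n) \<le> K powr s * ((\<delta> + A N) * E) + 4 * (e / 16)"
      using N(2) s by (intro nsq_diff_le_tails[OF _ Hs K(1) _ low tail_v tail_u]) linarith+
    also have "\<dots> < e" using N(1) \<delta>2 e by (simp add: algebra_simps)
    finally show ?thesis .
  qed
  then show thesis by (rule that[OF \<delta>])
qed

section \<open>The two-point transport estimate\<close>

text \<open>sin (pi h) is a smooth periodic substitute for the distance of h to the integers. For y
  = pi h <= 2 the cubic Taylor bound gives sin y >= y/3, and pi > 3 does the rest.\<close>

lemma sin_pi_ge:
  assumes "0 \<le> h" "h \<le> 1/2" shows "h \<le> sin (pi * h)"
proof -
  define y where "y = pi * h"
  have y: "0 \<le> y" "y \<le> 2"
    using assms pi_less_4 mult_mono[of pi 4 h "1/2"] by (auto simp: y_def)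
  have "\<bar>sin y - (\<Sum>m<3. sin_coeff m * y ^ m)\<bar> \<le> inverse (fact 3) * \<bar>y\<bar> ^ 3"
    by (rule Maclaurin_sin_bound)
  then have "\<bar>sin y - y\<bar> \<le> y ^ 3 / 6"
    using y by (simp add: sin_coeff_def eval_nat_numeral)
  moreover have "y ^ 3 \<le> 4 * y"
  proof -
    have "y * y \<le> 2 * 2" using y by (intro mult_mono) auto
    then have "(y * y) * y \<le> (2 * 2) * y" using y by (intro mult_right_mono) auto
    then show ?thesis by (simp add: power3_eq_cube)
  qed
  ultimately have "y / 3 \<le> sin y" unfolding abs_le_iff by linarith
  moreover have "3 * h \<le> y" using assms pi_gt3 by (simp add: y_def mult_right_mono)
  ultimately show ?thesis by (simp add: y_def)
qed

lemma sin_pi_reflect: "sin (pi * (1 - h)) = sin (pi * h)"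
  by (simp add: right_diff_distrib sin_diff)

lemma abs_sin_multiple_le: "\<bar>sin (real n * x)\<bar> \<le> real n * \<bar>sin x\<bar>"
proof (induction n)
  case (Suc n)
  have "\<bar>sin (real (Suc n) * x)\<bar> = \<bar>sin (real n * x) * cos x + cos (real n * x) * sin x\<bar>"
  proof -
    have "real (Suc n) * x = real n * x + x" by (simp add: algebra_simps)
    then show ?thesis by (simp only: sin_add)
  qed
  also have "\<dots> \<le> \<bar>sin (real n * x)\<bar> * \<bar>cos x\<bar> + \<bar>cos (real n * x)\<bar> * \<bar>sin x\<bar>"
    by (metis abs_mult abs_triangle_ineq)
  also have "\<dots> \<le> \<bar>sin (real n * x)\<bar> * 1 + 1 * \<bar>sin x\<bar>"
    by (intro add_mono mult_left_mono mult_right_mono abs_cos_le_one) auto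
  finally show ?case using Suc by (simp add: algebra_simps)
qed simp

text \<open>A smooth 1-periodic version of h^(-4), flattened at the scale
  \<open>\<delta>\<close>.\<close>

definition pair_kernel :: "real \<Rightarrow> real \<Rightarrow> real" where
  "pair_kernel \<delta> h = 1 / (\<delta>^2 + (sin (pi * h))^2)^2"

definition pair_kernel' :: "real \<Rightarrow> real \<Rightarrow> real" where
  "pair_kernel' \<delta> h = - (4 * pi * sin (pi * h) * cos (pi * h)) / (\<delta>^2 + (sin (pi * h))^2)^3"

context
  fixes \<delta> :: real
  assumes \<delta>: "0 < \<delta>"
begin

lemma denominator_pos: "0 < \<delta>^2 + (sin x)^2"
  using \<delta> by (intro add_pos_nonneg) auto

lemma pair_kernel_nonneg: "0 \<le> pair_kernel \<delta> h"
  by (simp add: pair_kernel_def)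

lemma pair_kernel_derivative: "(pair_kernel \<delta> has_real_derivative pair_kernel' \<delta> h) (at h)"
  unfolding pair_kernel_def[abs_def] pair_kernel'_def using denominator_pos[of "pi * h"]
  by (auto intro!: derivative_eq_intros simp: divide_simps power2_eq_square power3_eq_cube)

lemma continuous_on_pair_kernel [continuous_intros]:
  fixes S :: "'a::t2_space set"
  assumes "continuous_on S f"
  shows "continuous_on S (\<lambda>x. pair_kernel \<delta> (f x))" "continuous_on S (\<lambda>x. pair_kernel' \<delta> (f x))"
proof -
  have "continuous_on S (\<lambda>x. sin (pi * f x))"
    by (intro continuous_on_sin continuous_on_mult_left assms)
  moreover have "continuous_on S (\<lambda>x. cos (pi * f x))"
    by (intro continuous_on_cos continuous_on_mult_left assms)
  moreover have "\<delta>^2 + (sin x)^2 \<noteq> 0" for x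
    by (rule less_imp_neq[OF denominator_pos, symmetric])
  ultimately show "continuous_on S (\<lambda>x. pair_kernel \<delta> (f x))" "continuous_on S (\<lambda>x. pair_kernel' \<delta> (f x))"
    unfolding pair_kernel_def pair_kernel'_def
    by (auto intro!: continuous_on_divide continuous_on_minus continuous_on_mult continuous_on_power
        continuous_on_add continuous_on_const)
qed

lemma pair_kernel'_sin_le: "\<bar>pair_kernel' \<delta> h\<bar> * \<bar>sin (pi * h)\<bar> \<le> 4 * pi * pair_kernel \<delta> h"
proof -
  let ?s = "sin (pi * h)" and ?d = "\<delta>^2 + (sin (pi * h))^2"
  have d: "0 < ?d" by (rule denominator_pos)
  have "\<bar>pair_kernel' \<delta> h\<bar> * \<bar>?s\<bar> = 4 * pi * (\<bar>cos (pi * h)\<bar> * ?s^2) / ?d^3"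
    using d by (simp add: pair_kernel'_def abs_mult abs_divide power2_eq_square abs_of_pos)
  also have "\<dots> \<le> 4 * pi * (1 * ?d) / ?d^3"
    using d by (intro divide_right_mono mult_left_mono mult_mono abs_cos_le_one) auto
  also have "\<dots> = 4 * pi * pair_kernel \<delta> h"
    using d by (simp add: pair_kernel_def power3_eq_cube power2_eq_square)
  finally show ?thesis .
qed

text \<open>\<open>K(x - y)\<close> is almost invariant under the two-point flow \<open>u(x) \<partial>\<^sub>x + u(y) \<partial>\<^sub>y\<close>:
  since \<open>\<bar>K'(h)\<bar> \<bar>sin \<pi>h\<bar> \<lesssim> K(h)\<close>, only the Lipschitz constant of \<open>u\<close> enters.\<close>

lemma two_point_estimate:
  fixes U W X :: "real \<Rightarrow> real"
  assumes U: "\<And>x. (U has_real_derivative W x) (at x)" and W: "\<And>x. (W has_real_derivative X x) (at x)"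
    and X: "continuous_on UNIV X"
    and per: "\<And>x. U (x + 1) = U x" "\<And>x. W (x + 1) = W x"
    and M: "\<And>x. \<bar>W x\<bar> \<le> M"
  defines "F \<equiv> \<lambda>x. U x * X x + (W x)^2" and "Y \<equiv> \<lambda>h x. W (x + h) - W x"
  shows "\<bar>integral (cbox (0,0) (1,1)) (\<lambda>(h,x). pair_kernel \<delta> h * ((F (x + h) - F x) * Y h x))\<bar>
    \<le> (1 + 2 * pi) * M * integral (cbox (0,0) (1,1)) (\<lambda>(h,x). pair_kernel \<delta> h * (Y h x)^2)"
proof -
  let ?Q = "cbox (0,0) (1,1) :: (real \<times> real) set"
  let ?K = "pair_kernel \<delta>" and ?K' = "pair_kernel' \<delta>"
  \<comment> \<open>A is the x-derivative of K U(x) Y^2 / 2 for fixed h, and B is the h-derivative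
    of K (U(x + h) - U(x)) Y^2 / 2 for fixed x; both integrate to 0 over a period. They absorb all
    terms with second derivatives X, and the rest Z contains only U and W.\<close>
  define A where "A h x = ?K h * (W x * (Y h x)^2 / 2 + U x * Y h x * (X (x + h) - X x))" for h x
  define B where "B h x = ?K' h * (U (x + h) - U x) * (Y h x)^2 / 2
      + ?K h * (W (x + h) * (Y h x)^2 / 2 + (U (x + h) - U x) * Y h x * X (x + h))" for h x
  define Z where "Z h x = (1/2) * (?K h * (W x + W (x + h)) - ?K' h * (U (x + h) - U x)) * (Y h x)^2" for h x
  have contU: "continuous_on S U" and contW: "continuous_on S W" for S
    using U W by (meson DERIV_isCont continuous_at_imp_continuous_on)+
  have cU: "continuous_on S (\<lambda>x. U (f x))" and cW: "continuous_on S (\<lambda>x. W (f x))" and cX: "continuous_on S (\<lambda>x. X (f x))"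
    if "continuous_on S f" for S :: "(real \<times> real) set" and f
    using continuous_on_compose2[OF contU that] continuous_on_compose2[OF contW that] continuous_on_compose2[OF X that] by auto
  have cont: "continuous_on ?Q (\<lambda>p. A (fst p) (snd p))" "continuous_on ?Q (\<lambda>p. B (fst p) (snd p))"
    "continuous_on ?Q (\<lambda>p. Z (fst p) (snd p))" "continuous_on ?Q (\<lambda>p. ?K (fst p) * (Y (fst p) (snd p))^2)"
    unfolding A_def B_def Z_def Y_def by (auto intro!: continuous_intros cU cW cX)
  have decomp: "?K h * ((F (x + h) - F x) * Y h x) = A h x + B h x + Z h x" for h x
    unfolding A_def B_def Z_def F_def Y_def by (simp add: power2_eq_square algebra_simps) (simp add: field_simps)
  have intA: "integral ?Q (\<lambda>p. A (fst p) (snd p)) = 0"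
  proof -
    have "integral {0..1} (\<lambda>x. A h x) = 0" for h
    proof -
      define G where "G x = ?K h * (U x * (Y h x)^2 / 2)" for x
      have dY: "(Y h has_real_derivative (X (x + h) - X x)) (at x)" for x
        unfolding Y_def using DERIV_shift[of W "X (x + h)" x h] W
        by (auto intro!: derivative_intros)
      have "(G has_real_derivative A h x) (at x)" for x
        unfolding G_def A_def
        by (auto intro!: derivative_eq_intros U dY simp: field_simps power2_eq_square)
      then have "((\<lambda>x. A h x) has_integral (G 1 - G 0)) {0..1}"
        by (intro fundamental_theorem_of_calculus)
           (auto simp: has_real_derivative_iff_has_vector_derivative intro: has_vector_derivative_at_within)
      moreover have "G 1 = G 0"
        using per(1)[of 0] per(2)[of 0] per(2)[of h] by (simp add: G_def Y_def add.commute)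
      ultimately show ?thesis by (simp add: integral_unique)
    qed
    then show ?thesis
      using integral_prod_continuous[OF cont(1)] by simp
  qed
  have intB: "integral ?Q (\<lambda>p. B (fst p) (snd p)) = 0"
  proof -
    have "integral {0..1} (\<lambda>h. B h x) = 0" for x
    proof -
      define G where "G h = ?K h * ((U (x + h) - U x) * (Y h x * Y h x)) * (1/2)" for h
      have dU: "((\<lambda>h. U (x + h)) has_real_derivative W (x + h)) (at h)"
        and dW: "((\<lambda>h. W (x + h)) has_real_derivative X (x + h)) (at h)" for h
        using DERIV_shift[of U "W (x + h)" h x] DERIV_shift[of W "X (x + h)" h x] U W
        by (simp_all add: add.commute)
      have "(G has_real_derivative B h x) (at h)" for h
        unfolding G_def B_def Y_def
        by (rule DERIV_cong, (rule DERIV_mult DERIV_diff DERIV_const dU dW pair_kernel_derivative)+)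
           (simp add: power2_eq_square field_simps)
      then have "((\<lambda>h. B h x) has_integral (G 1 - G 0)) {0..1}"
        by (intro fundamental_theorem_of_calculus)
           (auto simp: has_real_derivative_iff_has_vector_derivative intro: has_vector_derivative_at_within)
      moreover have "G 1 = 0" "G 0 = 0"
        using per(1)[of x] by (auto simp: G_def)
      ultimately show ?thesis by (simp add: integral_unique)
    qed
    moreover have "integral {0..1} (\<lambda>h. integral {0..1} (B h)) = integral {0..1} (\<lambda>x. integral {0..1} (\<lambda>h. B h x))"
      using integral_swap_continuous[of 0 0 1 1 B] cont(2) by (simp add: split_beta')
    ultimately show ?thesis
      using integral_prod_continuous[OF cont(2)] by simp
  qed
  have "(\<lambda>(h,x). ?K h * ((F (x + h) - F x) * Y h x)) = (\<lambda>p. A (fst p) (snd p) + B (fst p) (snd p) + Z (fst p) (snd p))"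
    by (auto simp: decomp)
  then have "integral ?Q (\<lambda>(h,x). ?K h * ((F (x + h) - F x) * Y h x)) = integral ?Q (\<lambda>p. Z (fst p) (snd p))"
    using intA intB by (simp add: integral_add integrable_add integrable_continuous cont)
  moreover have "norm (integral ?Q (\<lambda>p. Z (fst p) (snd p))) \<le> integral ?Q (\<lambda>p. (1 + 2 * pi) * M * (?K (fst p) * (Y (fst p) (snd p))^2))"
  proof (rule integral_norm_bound_integral)
    show "(\<lambda>p. Z (fst p) (snd p)) integrable_on ?Q" by (intro integrable_continuous cont)
    show "(\<lambda>p. (1 + 2 * pi) * M * (?K (fst p) * (Y (fst p) (snd p))^2)) integrable_on ?Q"
      by (intro integrable_continuous continuous_on_mult_left cont)
    fix p :: "real \<times> real" assume p: "p \<in> ?Q"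
    obtain h x where hx: "p = (h, x)" "0 \<le> h" "h \<le> 1"
      using p by (cases p) (auto simp: cbox_Pair_eq)
    have M0: "0 \<le> M" using M[of 0] by linarith
    have lip: "\<bar>U a - U b\<bar> \<le> M * \<bar>a - b\<bar>" for a b
      using field_differentiable_bound[of UNIV U W M a b] U M by simp
    have "\<bar>U (x + h) - U x\<bar> \<le> M * \<bar>sin (pi * h)\<bar>"
    proof (cases "h \<le> 1/2")
      case True
      have "\<bar>U (x + h) - U x\<bar> \<le> M * h" using lip[of "x + h" x] hx by simp
      also have "\<dots> \<le> M * \<bar>sin (pi * h)\<bar>"
        using sin_pi_ge[of h] hx True M0 by (intro mult_left_mono) auto
      finally show ?thesis .
    next
      case False
      \<comment> \<open>For h > 1/2 the comparison point nearer to x + h is x + 1, where U has the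
        same value as at x.\<close>
      have "\<bar>U (x + h) - U x\<bar> \<le> M * (1 - h)" using lip[of "x + h" "x + 1"] hx per(1)[of x] by simp
      also have "\<dots> \<le> M * \<bar>sin (pi * h)\<bar>"
        using sin_pi_ge[of "1 - h"] hx False M0 unfolding sin_pi_reflect by (intro mult_left_mono) auto
      finally show ?thesis .
    qed
    then have "\<bar>?K' h * (U (x + h) - U x)\<bar> \<le> \<bar>?K' h\<bar> * (M * \<bar>sin (pi * h)\<bar>)"
      by (simp add: abs_mult mult_left_mono)
    also have "\<dots> \<le> M * (4 * pi * ?K h)"
      using mult_left_mono[OF pair_kernel'_sin_le M0, of h] by (simp add: mult_ac)
    finally have 1: "\<bar>?K' h * (U (x + h) - U x)\<bar> \<le> M * (4 * pi * ?K h)" .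
    have "\<bar>?K h * (W x + W (x + h))\<bar> \<le> ?K h * (M + M)"
      unfolding abs_mult abs_of_nonneg[OF pair_kernel_nonneg] using M[of x] M[of "x + h"]
      by (intro mult_left_mono pair_kernel_nonneg) linarith
    with 1 have "\<bar>(1/2) * (?K h * (W x + W (x + h)) - ?K' h * (U (x + h) - U x))\<bar> \<le> (1 + 2 * pi) * M * ?K h"
      by (simp add: abs_le_iff algebra_simps)
    then have "\<bar>(1/2) * (?K h * (W x + W (x + h)) - ?K' h * (U (x + h) - U x))\<bar> * (Y h x)^2
        \<le> (1 + 2 * pi) * M * ?K h * (Y h x)^2"
      by (intro mult_right_mono) auto
    then show "norm (Z (fst p) (snd p)) \<le> (1 + 2 * pi) * M * (?K (fst p) * (Y (fst p) (snd p))^2)"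
      unfolding hx Z_def real_norm_def abs_mult[of _ "(Y _ _)^2"] by (simp add: mult.assoc)
  qed
  ultimately show ?thesis
    by (simp add: split_beta')
qed

text \<open>Since |exp (2 pi i n h) - 1|^2 is 2 (1 - cos (2 pi n h)), this is half the Fourier
  multiplier of the two-point quadratic form with kernel \<open>pair_kernel\<close>.\<close>

definition pair_kernel_weight :: "int \<Rightarrow> real" where
  "pair_kernel_weight n = integral {0..1} (\<lambda>h. pair_kernel \<delta> h * (1 - cos (2 * pi * of_int n * h)))"

lemma pair_kernel_weight_integrable:
  "(\<lambda>h. pair_kernel \<delta> h * (1 - cos (2 * pi * of_int n * h))) integrable_on {a..b}"
  by (intro integrable_continuous_real continuous_intros)

lemma pair_kernel_weight_nonneg: "0 \<le> pair_kernel_weight n"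
  unfolding pair_kernel_weight_def by (intro integral_nonneg pair_kernel_weight_integrable) (simp add: pair_kernel_nonneg)

text \<open>On each half of the period sin (pi h) dominates the distance to the nearer end point.
  Adding the two arctangent integrands gives one majorant valid on the whole interval.\<close>

lemma integral_inverse_denominator:
  "integral {0..1} (\<lambda>h. 1 / (\<delta>^2 + (sin (pi * h))^2)) \<le> pi / \<delta>"
    "(\<lambda>h. 1 / (\<delta>^2 + (sin (pi * h))^2)) integrable_on {0..1}"
proof -
  have pos: "0 < \<delta>^2 + y^2" for y :: real using \<delta> by (intro add_pos_nonneg) auto
  show integrable: "(\<lambda>h. 1 / (\<delta>^2 + (sin (pi * h))^2)) integrable_on {0..1}"
    using less_imp_neq[OF pos] by (intro integrable_continuous_real continuous_intros) (auto dest: sym)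
  define G where "G h = (arctan (h / \<delta>) - arctan ((1 - h) / \<delta>)) / \<delta>" for h
  have "(G has_real_derivative (1 / (\<delta>^2 + h^2) + 1 / (\<delta>^2 + (1 - h)^2))) (at h)" for h
  proof -
    have eq: "inverse (1 + (y / \<delta>)^2) * (1 / \<delta>) / \<delta> = 1 / (\<delta>^2 + y^2)" for y
    proof -
      have "(1 + (y / \<delta>)^2) * \<delta>^2 = \<delta>^2 + y^2" using \<delta> by (simp add: field_simps)
      moreover have "inverse a * (1 / \<delta>) / \<delta> = 1 / (a * \<delta>^2)" for a
        by (simp add: power2_eq_square divide_simps)
      ultimately show ?thesis by simp
    qed
    have "(G has_real_derivative ((inverse (1 + (h / \<delta>)^2) * (1 / \<delta>) - inverse (1 + ((1 - h) / \<delta>)^2) * (- 1 / \<delta>)) / \<delta>)) (at h)"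
      unfolding G_def using \<delta> by (auto intro!: derivative_eq_intros)
    moreover have "(inverse (1 + (h / \<delta>)^2) * (1 / \<delta>) - inverse (1 + ((1 - h) / \<delta>)^2) * (- 1 / \<delta>)) / \<delta>
        = 1 / (\<delta>^2 + h^2) + 1 / (\<delta>^2 + (1 - h)^2)"
      unfolding eq[symmetric] by (simp add: diff_divide_distrib add_divide_distrib)
    ultimately show ?thesis by simp
  qed
  then have int: "((\<lambda>h. 1 / (\<delta>^2 + h^2) + 1 / (\<delta>^2 + (1 - h)^2)) has_integral (G 1 - G 0)) {0..1}"
    by (intro fundamental_theorem_of_calculus)
       (auto simp: has_real_derivative_iff_has_vector_derivative intro: has_vector_derivative_at_within)
  have "integral {0..1} (\<lambda>h. 1 / (\<delta>^2 + (sin (pi * h))^2)) \<le> G 1 - G 0"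
  proof (rule has_integral_le[OF integrable_integral[OF integrable] int])
    fix h :: real assume h: "h \<in> {0..1}"
    have le: "1 / (\<delta>^2 + (sin (pi * h))^2) \<le> 1 / (\<delta>^2 + y^2)" if "0 \<le> y" "y \<le> sin (pi * h)" for y
      using that pos[of y] by (intro divide_left_mono add_left_mono power_mono mult_pos_pos pos) auto
    show "1 / (\<delta>^2 + (sin (pi * h))^2) \<le> 1 / (\<delta>^2 + h^2) + 1 / (\<delta>^2 + (1 - h)^2)"
    proof (cases "h \<le> 1/2")
      case True
      then show ?thesis using le[of h] sin_pi_ge[of h] h pos[of "1 - h"] by (simp add: add_increasing2)
    next
      case False
      then show ?thesis using le[of "1 - h"] sin_pi_ge[of "1 - h"] h pos[of h] unfolding sin_pi_reflect
        by (simp add: add_increasing)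
    qed
  qed
  also have "G 1 - G 0 = 2 * arctan (1 / \<delta>) / \<delta>" by (simp add: G_def diff_divide_distrib)
  also have "\<dots> \<le> pi / \<delta>" using arctan_ubound[of "1 / \<delta>"] \<delta> by (intro divide_right_mono) auto
  finally show "integral {0..1} (\<lambda>h. 1 / (\<delta>^2 + (sin (pi * h))^2)) \<le> pi / \<delta>" .
qed

lemma one_minus_cos: "1 - cos (2 * pi * of_int n * h) = 2 * (sin (pi * of_int n * h))^2"
  using cos_double_sin[of "pi * of_int n * h"] by (simp add: mult_ac)

text \<open>One power of the denominator is traded away, in the first bound for
  \<open>\<delta>\<close>^2 and in the second by |sin (pi n h)| <= |n| |sin (pi h)|. The integral of
  the remaining inverse power is at most pi / \<open>\<delta>\<close>.\<close>

lemma pair_kernel_weight_le: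
  shows "pair_kernel_weight n \<le> 2 * pi / \<delta>^3" "pair_kernel_weight n \<le> 2 * pi / \<delta>^3 * ((real_of_int n)^2 * \<delta>^2)"
proof -
  let ?d = "\<lambda>h. \<delta>^2 + (sin (pi * h))^2"
  have *: "pair_kernel_weight n \<le> c * (pi / \<delta>)"
    if "0 \<le> c" "\<And>h. pair_kernel \<delta> h * (1 - cos (2 * pi * of_int n * h)) \<le> c * (1 / ?d h)" for c
  proof -
    have "pair_kernel_weight n \<le> integral {0..1} (\<lambda>h. c * (1 / ?d h))"
      unfolding pair_kernel_weight_def using that
      by (intro integral_le pair_kernel_weight_integrable integrable_on_mult_right integral_inverse_denominator) auto
    also have "\<dots> \<le> c * (pi / \<delta>)"
      by (subst integral_mult_right) (intro mult_left_mono integral_inverse_denominator that)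
    finally show ?thesis .
  qed
  have "pair_kernel_weight n \<le> (2 / \<delta>^2) * (pi / \<delta>)"
  proof (rule *)
    fix h
    have d: "0 < ?d h" "\<delta>^2 \<le> ?d h" by (rule denominator_pos, simp)
    have "pair_kernel \<delta> h * (1 - cos (2 * pi * of_int n * h)) \<le> (1 / (\<delta>^2 * ?d h)) * 2"
    proof (rule mult_mono)
      show "pair_kernel \<delta> h \<le> 1 / (\<delta>^2 * ?d h)"
        unfolding pair_kernel_def power2_eq_square[of "?d h"] using d \<delta>
        by (intro divide_left_mono mult_right_mono mult_pos_pos) auto
      show "1 - cos (2 * pi * of_int n * h) \<le> 2" using cos_ge_minus_one[of "2 * pi * of_int n * h"] by linarith
    qed (use d \<delta> in auto)
    then show "pair_kernel \<delta> h * (1 - cos (2 * pi * of_int n * h)) \<le> 2 / \<delta>^2 * (1 / ?d h)" by simp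
  qed simp
  then show "pair_kernel_weight n \<le> 2 * pi / \<delta>^3" by (simp add: power3_eq_cube power2_eq_square)
  have "pair_kernel_weight n \<le> (2 * (real_of_int n)^2) * (pi / \<delta>)"
  proof (rule *)
    fix h
    have d: "0 < ?d h" "(sin (pi * h))^2 \<le> ?d h" by (rule denominator_pos, simp)
    have "\<bar>sin (pi * of_int n * h)\<bar> = \<bar>sin (real (nat \<bar>n\<bar>) * (pi * h))\<bar>"
      by (cases "0 \<le> n") (auto simp: mult_ac)
    also have "\<dots> \<le> real (nat \<bar>n\<bar>) * \<bar>sin (pi * h)\<bar>" by (rule abs_sin_multiple_le)
    finally have "\<bar>sin (pi * of_int n * h)\<bar>^2 \<le> (real (nat \<bar>n\<bar>) * \<bar>sin (pi * h)\<bar>)^2"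
      by (intro power_mono) auto
    then have "(sin (pi * of_int n * h))^2 \<le> (real_of_int n)^2 * (sin (pi * h))^2"
      by (simp add: power_mult_distrib)
    also have "\<dots> \<le> (real_of_int n)^2 * ?d h" using d by (intro mult_left_mono) auto
    finally have "pair_kernel \<delta> h * (1 - cos (2 * pi * of_int n * h)) \<le> pair_kernel \<delta> h * (2 * ((real_of_int n)^2 * ?d h))"
      unfolding one_minus_cos by (intro mult_left_mono pair_kernel_nonneg) auto
    also have "\<dots> = 2 * (real_of_int n)^2 * (1 / ?d h)"
      using d by (simp add: pair_kernel_def power2_eq_square)
    finally show "pair_kernel \<delta> h * (1 - cos (2 * pi * of_int n * h)) \<le> 2 * (real_of_int n)^2 * (1 / ?d h)" .
  qed simp
  then show "pair_kernel_weight n \<le> 2 * pi / \<delta>^3 * ((real_of_int n)^2 * \<delta>^2)"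
    using \<delta> by (simp add: power3_eq_cube power2_eq_square mult_ac)
qed

text \<open>For frequencies at least 1 / \<open>\<delta>\<close> the range h <=
  \<open>\<delta>\<close> / pi suffices: there the kernel is at least 1 / (4
  \<open>\<delta>\<close>^4), and 1 - cos has mean at least 1/2.\<close>

lemma pair_kernel_weight_ge:
  assumes "\<delta> \<le> 1" "1 \<le> \<bar>real_of_int n\<bar> * \<delta>"
  shows "1 / (8 * pi * \<delta>^3) \<le> pair_kernel_weight n"
proof -
  define b where "b = \<delta> / pi"
  have b: "0 < b" "b \<le> 1" using \<delta> assms(1) pi_gt3 by (auto simp: b_def)
  have n: "real_of_int n \<noteq> 0" using assms(2) \<delta> by auto
  define k where "k = 1 / (4 * \<delta>^4)"
  define G where "G h = (h - sin (2 * pi * of_int n * h) / (2 * pi * of_int n)) * k" for h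
  have "(G has_real_derivative ((1 - cos (2 * pi * of_int n * h)) * k)) (at h)" for h
    unfolding G_def using n by (auto intro!: derivative_eq_intros)
  then have int: "((\<lambda>h. (1 - cos (2 * pi * of_int n * h)) * k) has_integral (G b - G 0)) {0..b}"
    using b by (intro fundamental_theorem_of_calculus)
       (auto simp: has_real_derivative_iff_has_vector_derivative intro: has_vector_derivative_at_within)
  have "1 / (8 * pi * \<delta>^3) \<le> G b - G 0"
  proof -
    have "sin (2 * pi * of_int n * b) / (2 * pi * of_int n) \<le> 1 / (2 * pi * \<bar>real_of_int n\<bar>)"
    proof -
      have "sin (2 * pi * of_int n * b) / (2 * pi * of_int n) \<le> \<bar>sin (2 * pi * of_int n * b)\<bar> / (2 * pi * \<bar>real_of_int n\<bar>)"
        by (rule order.trans[OF abs_ge_self]) (simp add: abs_divide abs_mult)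
      also have "\<dots> \<le> 1 / (2 * pi * \<bar>real_of_int n\<bar>)"
        by (intro divide_right_mono abs_sin_le_one) auto
      finally show ?thesis .
    qed
    also have "\<dots> \<le> b / 2"
      using assms(2) n \<delta> by (simp add: b_def field_simps)
    finally have "b / 2 \<le> b - sin (2 * pi * of_int n * b) / (2 * pi * of_int n)" by simp
    have "b / 2 * k \<le> G b - G 0"
    proof -
      have "G b - G 0 = (b - sin (2 * pi * of_int n * b) / (2 * pi * of_int n)) * k" by (simp add: G_def)
      moreover have "0 \<le> k" by (simp add: k_def)
      ultimately show ?thesis using \<open>b / 2 \<le> b - _\<close> by (simp only: mult_right_mono)
    qed
    moreover have "b / 2 * k = 1 / (8 * pi * \<delta>^3)"
      using \<delta> by (simp add: k_def b_def eval_nat_numeral)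
    ultimately show ?thesis by simp
  qed
  also have "G b - G 0 \<le> integral {0..b} (\<lambda>h. pair_kernel \<delta> h * (1 - cos (2 * pi * of_int n * h)))"
  proof (rule has_integral_le[OF int integrable_integral[OF pair_kernel_weight_integrable]])
    fix h assume h: "h \<in> {0..b}"
    have "\<bar>sin (pi * h)\<bar> \<le> \<bar>pi * h\<bar>" by (rule abs_sin_x_le_abs_x)
    also have "\<dots> \<le> \<delta>" using h by (simp add: b_def field_simps abs_mult)
    finally have "\<bar>sin (pi * h)\<bar>^2 \<le> \<delta>^2" by (intro power_mono) auto
    then have "\<delta>^2 + (sin (pi * h))^2 \<le> 2 * \<delta>^2" by simp
    then have "(\<delta>^2 + (sin (pi * h))^2)^2 \<le> (2 * \<delta>^2)^2"
      using denominator_pos[of "pi * h"] by (intro power_mono) auto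
    then have "k \<le> pair_kernel \<delta> h"
      unfolding pair_kernel_def k_def using denominator_pos[of "pi * h"] \<delta>
      by (intro divide_left_mono) (auto simp: power_mult_distrib simp flip: power_mult)
    then have "k * (1 - cos (2 * pi * of_int n * h)) \<le> pair_kernel \<delta> h * (1 - cos (2 * pi * of_int n * h))"
      by (intro mult_right_mono) auto
    then show "(1 - cos (2 * pi * of_int n * h)) * k \<le> pair_kernel \<delta> h * (1 - cos (2 * pi * of_int n * h))"
      by (simp only: mult.commute)
  qed
  also have "\<dots> \<le> pair_kernel_weight n"
    unfolding pair_kernel_weight_def using b
    by (intro integral_subset_le pair_kernel_weight_integrable) (auto simp: pair_kernel_nonneg)
  finally show ?thesis .
qed

end

section \<open>Trigonometric polynomials and Parseval identities\<close>

definition wave :: "int \<Rightarrow> real \<Rightarrow> complex" where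
  "wave n x = exp (2 * of_real pi * \<i> * of_int n * of_real x)"

definition trig :: "nat \<Rightarrow> (int \<Rightarrow> complex) \<Rightarrow> real \<Rightarrow> complex" where
  "trig N v x = (\<Sum>n\<in>modes N. v n * wave n x)"

lemma wave_cis: "wave n x = cis (2 * pi * of_int n * x)"
  by (simp add: wave_def cis_conv_exp mult_ac)

lemma wave_0 [simp]: "wave 0 x = 1" "wave n 0 = 1"
  by (simp_all add: wave_def)

lemma norm_wave [simp]: "cmod (wave n x) = 1"
  by (simp add: wave_cis)

lemma wave_add: "wave n (x + y) = wave n x * wave n y"
  by (simp add: wave_cis cis_mult distrib_left)

lemma wave_mult: "wave n x * wave m x = wave (n + m) x"
  by (simp add: wave_cis cis_mult algebra_simps)

lemma cnj_wave: "cnj (wave n x) = wave (- n) x"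
  by (simp add: wave_cis cis_cnj)

lemma wave_1 [simp]: "wave n 1 = 1"
  using cis_multiple_2pi[of "of_int n"] by (simp add: wave_cis mult_ac)

lemma norm_wave_minus_1: "(cmod (wave n h - 1))^2 = 2 * (1 - cos (2 * pi * of_int n * h))"
proof -
  have "(cmod (cis t - 1))^2 = (cos t - 1)^2 + (sin t)^2" for t
    by (simp add: cmod_power2)
  moreover have "(cos t - 1)^2 + (sin t)^2 = 2 * (1 - cos t)" for t :: real
    using sin_cos_squared_add[of t] by (simp add: power2_eq_square algebra_simps)
  ultimately show ?thesis by (simp only: wave_cis)
qed

lemma wave_derivative: "(wave n has_vector_derivative (2 * of_real pi * \<i> * of_int n) * wave n x) (at x within S)"
proof -
  let ?c = "2 * of_real pi * \<i> * of_int n :: complex"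
  have "((\<lambda>z. exp (?c * z)) has_field_derivative ?c * exp (?c * of_real x)) (at (of_real x))"
    by (auto intro!: derivative_eq_intros)
  from has_vector_derivative_real_field[OF this, of S] show ?thesis
    by (simp add: wave_def[abs_def] o_def)
qed

lemma wave_integral: "(wave n has_integral (if n = 0 then 1 else 0)) {0..1}"
proof (cases "n = 0")
  case True
  then show ?thesis using has_integral_const_real[of "1::complex" 0 1] by (simp add: wave_def[abs_def])
next
  case False
  let ?c = "2 * of_real pi * \<i> * of_int n :: complex"
  have "(wave n has_integral (wave n 1 / ?c - wave n 0 / ?c)) {0..1}"
  proof (rule fundamental_theorem_of_calculus)
    show "((\<lambda>x. wave n x / ?c) has_vector_derivative wave n x) (at x within {0..1})" for x
      using has_vector_derivative_mult_right[OF wave_derivative[of n x "{0..1}"], of "1 / ?c"] False by simp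
  qed simp
  then show ?thesis using False by simp
qed

lemma trig_derivative: "(trig N v has_vector_derivative trig N (dx v) x) (at x within S)"
proof -
  have "(trig N v has_vector_derivative (\<Sum>n\<in>modes N. v n * ((2 * of_real pi * \<i> * of_int n) * wave n x))) (at x within S)"
    unfolding trig_def by (intro has_vector_derivative_sum has_vector_derivative_mult_right wave_derivative)
  then show ?thesis by (simp add: trig_def dx_def mult_ac)
qed

lemma trig_periodic: "trig N v (x + 1) = trig N v x"
  by (simp add: trig_def wave_add)

lemma trig_real:
  assumes "herm v" shows "trig N v x = of_real (Re (trig N v x))"
proof -
  have "cnj (trig N v x) = (\<Sum>n\<in>modes N. v (- n) * wave (- n) x)"
    using assms by (simp add: trig_def herm_def cnj_wave)
  also have "\<dots> = trig N v x"
    unfolding trig_def by (rule sum.reindex_bij_witness[of _ uminus uminus]) auto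
  finally show ?thesis by (metis Reals_cnj_iff of_real_Re)
qed

text \<open>The product has degree 2N, so summing over \<open>modes (2 * N)\<close> loses
  nothing.\<close>

lemma trig_mult:
  assumes v: "\<And>n. n \<notin> modes N \<Longrightarrow> v n = 0" and w: "\<And>n. n \<notin> modes N \<Longrightarrow> w n = 0"
  shows "trig N v x * trig N w x = trig (2 * N) (conv v w) x"
proof -
  have "trig (2 * N) (conv v w) x = (\<Sum>n\<in>modes (2 * N). \<Sum>m\<in>modes N. v (n - m) * w m * wave n x)"
    using w by (simp add: trig_def conv_support[of "modes N" w] sum_distrib_right)
  also have "\<dots> = (\<Sum>m\<in>modes N. \<Sum>n\<in>modes (2 * N). v (n - m) * w m * wave n x)"
    by (rule sum.swap)
  also have "\<dots> = (\<Sum>m\<in>modes N. \<Sum>k\<in>modes N. v k * w m * wave (k + m) x)"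
  proof (rule sum.cong[OF refl])
    fix m assume m: "m \<in> modes N"
    have "(\<Sum>n\<in>modes (2 * N). v (n - m) * w m * wave n x) = (\<Sum>n\<in>(\<lambda>k. k + m) ` modes N. v (n - m) * w m * wave n x)"
    proof (rule sum.mono_neutral_right)
      show "(\<lambda>k. k + m) ` modes N \<subseteq> modes (2 * N)" using m by (auto simp: mem_modes)
      show "\<forall>i\<in>modes (2 * N) - (\<lambda>k. k + m) ` modes N. v (i - m) * w m * wave i x = 0"
      proof
        fix i assume "i \<in> modes (2 * N) - (\<lambda>k. k + m) ` modes N"
        then have "i - m \<notin> modes N" by (metis DiffD2 diff_add_cancel imageI)
        then show "v (i - m) * w m * wave i x = 0" using v by simp
      qed
    qed simp
    also have "\<dots> = (\<Sum>k\<in>modes N. v k * w m * wave (k + m) x)"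
      by (subst sum.reindex) auto
    finally show "(\<Sum>n\<in>modes (2 * N). v (n - m) * w m * wave n x) = (\<Sum>k\<in>modes N. v k * w m * wave (k + m) x)" .
  qed
  also have "\<dots> = (\<Sum>k\<in>modes N. \<Sum>m\<in>modes N. (v k * wave k x) * (w m * wave m x))"
    by (subst sum.swap) (simp add: wave_mult[symmetric] mult_ac)
  also have "\<dots> = trig N v x * trig N w x"
    by (simp add: trig_def sum_product)
  finally show ?thesis by simp
qed

text \<open>The two degrees differ because the flux, of degree 2N, is tested against v_x, of degree
  N. Orthogonality of the waves discards the modes above N, which is exactly the Galerkin
  projection.\<close>

lemma difference_Parseval:
  assumes "N \<le> L"
  shows "((\<lambda>x. (trig L p (x + h) - trig L p x) * cnj (trig N w (x + h) - trig N w x)) has_integral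
    (\<Sum>n\<in>modes N. p n * cnj (w n) * of_real (2 * (1 - cos (2 * pi * of_int n * h))))) {0..1}"
proof -
  define c where "c n m = p n * (wave n h - 1) * cnj (w m * (wave m h - 1))" for n m
  have diff: "trig L q (x + h) - trig L q x = (\<Sum>n\<in>modes L. q n * (wave n h - 1) * wave n x)" for q x L
    by (simp add: trig_def wave_add sum_subtractf algebra_simps)
  have "(\<lambda>x. (trig L p (x + h) - trig L p x) * cnj (trig N w (x + h) - trig N w x))
      = (\<lambda>x. \<Sum>n\<in>modes L. \<Sum>m\<in>modes N. c n m * wave (n - m) x)"
  proof
    fix x
    have "wave n x * wave (- m) x = wave (n - m) x" for n m by (simp add: wave_mult)
    then have "p n * (wave n h - 1) * wave n x * cnj (w m * (wave m h - 1) * wave m x) = c n m * wave (n - m) x" for n m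
      by (simp add: c_def cnj_wave)
    then show "(trig L p (x + h) - trig L p x) * cnj (trig N w (x + h) - trig N w x)
        = (\<Sum>n\<in>modes L. \<Sum>m\<in>modes N. c n m * wave (n - m) x)"
      unfolding diff cnj_sum sum_product by simp
  qed
  moreover have "((\<lambda>x. \<Sum>n\<in>modes L. \<Sum>m\<in>modes N. c n m * wave (n - m) x) has_integral
      (\<Sum>n\<in>modes L. \<Sum>m\<in>modes N. c n m * (if n - m = 0 then 1 else 0))) {0..1}"
    by (intro has_integral_sum has_integral_mult_right wave_integral) auto
  moreover have "(\<Sum>n\<in>modes L. \<Sum>m\<in>modes N. c n m * (if n - m = 0 then 1 else 0)) = (\<Sum>m\<in>modes N. c m m)"
  proof -
    have "(\<Sum>n\<in>modes L. \<Sum>m\<in>modes N. c n m * (if n - m = 0 then 1 else 0))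
        = (\<Sum>m\<in>modes N. \<Sum>n\<in>modes L. if n = m then c n m else 0)"
      by (subst sum.swap) (intro sum.cong refl, simp)
    also have "\<dots> = (\<Sum>m\<in>modes N. c m m)"
      using modes_mono[OF assms] by (intro sum.cong refl) (auto simp: sum.delta)
    finally show ?thesis .
  qed
  moreover have "c n n = p n * cnj (w n) * of_real (2 * (1 - cos (2 * pi * of_int n * h)))" for n
    unfolding norm_wave_minus_1[symmetric] c_def complex_norm_square by simp
  ultimately show ?thesis by simp
qed

lemma pair_kernel_Parseval:
  assumes \<delta>: "0 < \<delta>" and NL: "N \<le> L" and p: "herm p" and w: "herm w"
  defines "P \<equiv> \<lambda>x. Re (trig L p x)" and "W \<equiv> \<lambda>x. Re (trig N w x)"
  shows "integral (cbox (0,0) (1,1)) (\<lambda>(h,x). pair_kernel \<delta> h * ((P (x + h) - P x) * (W (x + h) - W x)))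
    = 2 * (\<Sum>n\<in>modes N. pair_kernel_weight \<delta> n * Re (p n * cnj (w n)))"
proof -
  let ?f = "\<lambda>h x. pair_kernel \<delta> h * ((P (x + h) - P x) * (W (x + h) - W x))"
  have "continuous_on UNIV (trig N' q)" for N' q
    using trig_derivative has_vector_derivative_continuous by (metis continuous_at_imp_continuous_on)
  then have cont_trig: "continuous_on S (\<lambda>x. trig N' q (g x))" if "continuous_on S g" for S :: "(real \<times> real) set" and g N' q
    using continuous_on_compose2[OF _ that, of UNIV] by auto
  have cont: "continuous_on (cbox (0,0) (1,1)) (\<lambda>(h,x). ?f h x)"
    unfolding split_beta' P_def W_def
    by (intro continuous_intros cont_trig continuous_on_pair_kernel \<delta>)
  have inner: "integral {0..1} (\<lambda>x. ?f h x)
      = 2 * (\<Sum>n\<in>modes N. Re (p n * cnj (w n)) * (pair_kernel \<delta> h * (1 - cos (2 * pi * of_int n * h))))" for h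
  proof -
    have eq: "(trig L p (x + h) - trig L p x) * cnj (trig N w (x + h) - trig N w x)
        = of_real ((P (x + h) - P x) * (W (x + h) - W x))" for x
      unfolding P_def W_def
      by (subst trig_real[OF p, of L "x + h"], subst trig_real[OF p, of L x], subst trig_real[OF w, of N "x + h"], subst trig_real[OF w, of N x]) simp
    have "((\<lambda>x. Re (of_real ((P (x + h) - P x) * (W (x + h) - W x)))) has_integral
        Re (\<Sum>n\<in>modes N. p n * cnj (w n) * of_real (2 * (1 - cos (2 * pi * of_int n * h))))) {0..1}"
      using has_integral_linear[OF difference_Parseval[OF NL, of p h w] bounded_linear_Re] unfolding eq o_def .
    then have "((\<lambda>x. ?f h x) has_integral pair_kernel \<delta> h * Re (\<Sum>n\<in>modes N. p n * cnj (w n) * of_real (2 * (1 - cos (2 * pi * of_int n * h))))) {0..1}"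
      unfolding Re_complex_of_real by (rule has_integral_mult_right)
    moreover have "Re (p n * cnj (w n) * of_real r) = Re (p n * cnj (w n)) * r" for n r
      by (simp only: mult.commute[of _ "of_real r"] Re_of_real_mult mult.commute[of _ r])
    ultimately have "((\<lambda>x. ?f h x) has_integral pair_kernel \<delta> h * (\<Sum>n\<in>modes N. Re (p n * cnj (w n)) * (2 * (1 - cos (2 * pi * of_int n * h))))) {0..1}"
      by (simp only: Re_sum)
    then show ?thesis
      by (simp only: integral_unique sum_distrib_left mult_ac)
  qed
  have "integral (cbox (0,0) (1,1)) (\<lambda>(h,x). ?f h x) = integral {0..1} (\<lambda>h. integral {0..1} (\<lambda>x. ?f h x))"
    using integral_prod_continuous[OF cont] by simp
  also have "\<dots> = integral {0..1} (\<lambda>h. 2 * (\<Sum>n\<in>modes N. Re (p n * cnj (w n)) * (pair_kernel \<delta> h * (1 - cos (2 * pi * of_int n * h)))))"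
    unfolding inner ..
  also have "\<dots> = 2 * (\<Sum>n\<in>modes N. Re (p n * cnj (w n)) * pair_kernel_weight \<delta> n)"
    unfolding pair_kernel_weight_def[OF \<delta>]
    by (intro integral_unique has_integral_mult_right has_integral_sum integrable_integral pair_kernel_weight_integrable[OF \<delta>]) auto
  finally show ?thesis by (simp add: mult.commute)
qed

text \<open>The function F of \<open>two_point_estimate\<close> is the derivative of U W, that is of
  v v_x, so that estimate bounds the growth of the two-point energy under the Galerkin flow.
  Parseval rewrites it with the weight 4 pi^2 n^2 \<open>pair_kernel_weight\<close>, in the form
  that \<open>galerkin_weighted_bound\<close> expects.\<close>

lemma two_point_flux_le:
  assumes \<delta>: "0 < \<delta>" and v: "herm v" "\<And>n. n \<notin> modes N \<Longrightarrow> v n = 0" and M: "\<And>x. cmod (trig N (dx v) x) \<le> M"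
  shows "\<bar>Re (\<Sum>n\<in>modes N. of_real (4 * pi^2 * (of_int n)^2 * pair_kernel_weight \<delta> n) * cnj (v n) * conv v (dx v) n)\<bar>
    \<le> (1 + 2 * pi) * M * (\<Sum>n\<in>modes N. 4 * pi^2 * (of_int n)^2 * pair_kernel_weight \<delta> n * (cmod (v n))^2)"
proof -
  define c where "c = conv v (dx v)"
  define U where "U x = Re (trig N v x)" for x
  define W where "W x = Re (trig N (dx v) x)" for x
  define X where "X x = Re (trig N (dx (dx v)) x)" for x
  have dv: "herm (dx v)" "\<And>n. n \<notin> modes N \<Longrightarrow> dx v n = 0"
    using v by (auto intro: dx_herm dx_support)
  have c: "herm c" "herm (dx c)" unfolding c_def by (auto intro!: conv_herm dx_herm v)
  have Re_der: "((\<lambda>x. Re (trig K q x)) has_real_derivative Re (trig K (dx q) x)) (at x)" for K q x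
    unfolding has_real_derivative_iff_has_vector_derivative
    by (rule bounded_linear.has_vector_derivative[OF bounded_linear_Re trig_derivative])
  have U: "(U has_real_derivative W x) (at x)" and W: "(W has_real_derivative X x) (at x)" for x
    unfolding U_def[abs_def] W_def[abs_def] X_def by (rule Re_der)+
  have prod: "U x * W x = Re (trig (2 * N) c x)" for x
  proof -
    have "trig (2 * N) c x = of_real (U x) * of_real (W x)"
      unfolding c_def U_def W_def trig_real[OF v(1), symmetric] trig_real[OF dv(1), symmetric]
      by (rule trig_mult[OF v(2) dv(2), symmetric])
    then show ?thesis by simp
  qed
  have F: "U x * X x + (W x)^2 = Re (trig (2 * N) (dx c) x)" for x
  proof (rule DERIV_unique)
    show "((\<lambda>x. U x * W x) has_real_derivative Re (trig (2 * N) (dx c) x)) (at x)"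
      unfolding prod by (rule Re_der)
    show "((\<lambda>x. U x * W x) has_real_derivative U x * X x + (W x)^2) (at x)"
      using DERIV_mult[OF U[of x] W[of x]] by (simp add: power2_eq_square algebra_simps)
  qed
  have X: "continuous_on UNIV X"
    unfolding X_def[abs_def] using Re_der by (meson DERIV_isCont continuous_at_imp_continuous_on)
  have WM: "\<bar>W x\<bar> \<le> M" for x
    unfolding W_def using order.trans[OF abs_Re_le_cmod M] .
  have "\<bar>integral (cbox (0,0) (1,1)) (\<lambda>(h,x). pair_kernel \<delta> h * (((U (x + h) * X (x + h) + (W (x + h))^2) - (U x * X x + (W x)^2)) * (W (x + h) - W x)))\<bar>
    \<le> (1 + 2 * pi) * M * integral (cbox (0,0) (1,1)) (\<lambda>(h,x). pair_kernel \<delta> h * (W (x + h) - W x)^2)"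
    by (rule two_point_estimate[OF \<delta> U W X _ _ WM]) (simp_all add: U_def W_def trig_periodic)
  also have "(\<lambda>(h,x). pair_kernel \<delta> h * (W (x + h) - W x)^2) = (\<lambda>(h,x). pair_kernel \<delta> h * ((W (x + h) - W x) * (W (x + h) - W x)))"
    by (simp add: power2_eq_square)
  also have "integral (cbox (0,0) (1,1)) \<dots> = 2 * (\<Sum>n\<in>modes N. pair_kernel_weight \<delta> n * Re (dx v n * cnj (dx v n)))"
    using pair_kernel_Parseval[OF \<delta> order.refl dv(1) dv(1), of N, folded W_def] .
  also have "integral (cbox (0,0) (1,1)) (\<lambda>(h,x). pair_kernel \<delta> h * (((U (x + h) * X (x + h) + (W (x + h))^2) - (U x * X x + (W x)^2)) * (W (x + h) - W x)))
      = 2 * (\<Sum>n\<in>modes N. pair_kernel_weight \<delta> n * Re (dx c n * cnj (dx v n)))"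
    unfolding F using pair_kernel_Parseval[OF \<delta> _ c(2) dv(1), of N "2 * N", folded W_def] by simp
  finally have main: "\<bar>2 * (\<Sum>n\<in>modes N. pair_kernel_weight \<delta> n * Re (dx c n * cnj (dx v n)))\<bar>
    \<le> (1 + 2 * pi) * M * (2 * (\<Sum>n\<in>modes N. pair_kernel_weight \<delta> n * Re (dx v n * cnj (dx v n))))" .
  have "Re (dx v n * cnj (dx v n)) = 4 * pi^2 * (of_int n)^2 * (cmod (v n))^2" for n
    unfolding complex_norm_square[symmetric] norm_dx by (simp add: power_mult_distrib)
  moreover have "dx c n * cnj (dx v n) = of_real (4 * pi^2 * (of_int n)^2) * (cnj (v n) * c n)" for n
    by (simp add: dx_def power2_eq_square)
  then have "Re (dx c n * cnj (dx v n)) = 4 * pi^2 * (of_int n)^2 * Re (cnj (v n) * c n)" for n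
    by (simp only: Re_of_real_mult)
  moreover have "Re (of_real (4 * pi^2 * (of_int n)^2 * pair_kernel_weight \<delta> n) * cnj (v n) * conv v (dx v) n)
      = pair_kernel_weight \<delta> n * (4 * pi^2 * (of_int n)^2 * Re (cnj (v n) * c n))" for n
    unfolding mult.assoc[of _ "cnj (v n)"] Re_of_real_mult c_def by simp
  ultimately show ?thesis
    using main by (simp add: mult_ac flip: sum_distrib_left)
qed

section \<open>Persistence\<close>

lemma galerkin_subset:
  assumes "galerkin N I v" "J \<subseteq> I" shows "galerkin N J v"
  using assms unfolding galerkin_def by (meson has_vector_derivative_within_subset subsetD)

lemma coeff_solution_shift:
  assumes u: "coeff_solution s I u" and J: "\<And>r. r \<in> J \<Longrightarrow> a + r \<in> I"
  shows "coeff_solution s J (\<lambda>r. u (a + r))"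
  unfolding coeff_solution_def
proof (intro ballI conjI allI)
  fix r assume "r \<in> J"
  then have r: "a + r \<in> I" by (rule J)
  show "in_Hs s (u (a + r))" using u r by (simp add: coeff_solution_def)
  have "((\<lambda>t. nsq s (\<lambda>n. u t n - u (a + r) n)) \<longlongrightarrow> 0) (at (a + r))"
    using u r by (simp add: coeff_solution_def)
  from LIM_offset[OF this, of a]
  show "((\<lambda>\<tau>. nsq s (\<lambda>n. u (a + \<tau>) n - u (a + r) n)) \<longlongrightarrow> 0) (at r)"
    by (simp add: add.commute)
  fix n
  have "((\<lambda>t. u t n) has_vector_derivative mudp_rhs (u (a + r)) n) (at (a + r))"
    using u r by (simp add: coeff_solution_def)
  then have "((\<lambda>t. u t n) \<circ> (\<lambda>r. a + r) has_vector_derivative (1 *\<^sub>R mudp_rhs (u (a + r)) n)) (at r)"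
    by (intro vector_diff_chain_at) (auto intro!: derivative_eq_intros)
  then show "((\<lambda>\<tau>. u (a + \<tau>) n) has_vector_derivative mudp_rhs (u (a + r)) n) (at r)"
    by (simp add: o_def)
qed

lemma coeff_solution_cong:
  assumes u: "coeff_solution s I u" and I: "open I" and eq: "\<And>t. t \<in> I \<Longrightarrow> v t = u t"
  shows "coeff_solution s I v"
  unfolding coeff_solution_def
proof (intro ballI conjI allI)
  fix t assume t: "t \<in> I"
  have ev: "\<forall>\<^sub>F r in at t. u r = v r"
    using eventually_at_in_open'[OF I t] by eventually_elim (simp add: eq)
  show "in_Hs s (v t)" using u t eq by (simp add: coeff_solution_def)
  have "((\<lambda>\<tau>. nsq s (\<lambda>n. u \<tau> n - u t n)) \<longlongrightarrow> 0) (at t)"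
    using u t by (simp add: coeff_solution_def)
  then show "((\<lambda>\<tau>. nsq s (\<lambda>n. v \<tau> n - v t n)) \<longlongrightarrow> 0) (at t)"
    by (rule Lim_transform_eventually) (use ev eq[OF t] in \<open>auto elim!: eventually_mono\<close>)
  fix n
  have "((\<lambda>\<tau>. u \<tau> n) has_vector_derivative mudp_rhs (u t) n) (at t)"
    using u t by (simp add: coeff_solution_def)
  then show "((\<lambda>\<tau>. v \<tau> n) has_vector_derivative mudp_rhs (v t) n) (at t)"
    unfolding eq[OF t] by (rule has_vector_derivative_transform_within_open[OF _ I t]) (simp add: eq)
qed

lemma coeff_solution_Un:
  "coeff_solution s I u \<Longrightarrow> coeff_solution s J u \<Longrightarrow> coeff_solution s (I \<union> J) u"
  by (auto simp: coeff_solution_def)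

text \<open>An estimate known for short steps is multiplied along a subdivision of the segment. The
  step lengths add up to the full length, so the step size leaves no trace in the result.\<close>

lemma exponential_chain:
  fixes f :: "real \<Rightarrow> real"
  assumes \<tau>: "0 < \<tau>"
    and step: "\<And>x y. \<lbrakk>x \<in> closed_segment a b; y \<in> closed_segment a b; \<bar>y - x\<bar> < \<tau>\<rbrakk> \<Longrightarrow> f y \<le> exp (C * \<bar>y - x\<bar>) * f x"
  shows "f b \<le> exp (C * \<bar>b - a\<bar>) * f a"
proof -
  obtain k :: nat where k: "\<bar>b - a\<bar> / \<tau> < real k" using reals_Archimedean2 by blast
  have "0 \<le> \<bar>b - a\<bar> / \<tau>" using \<tau> by simp
  then have k0: "0 < real k" using k by linarith
  define x where "x i = a + real i * ((b - a) / real k)" for i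
  have x_seg: "x i \<in> closed_segment a b" if "i \<le> k" for i
  proof -
    have "x i = (1 - real i / real k) *\<^sub>R a + (real i / real k) *\<^sub>R b"
      using k0 by (simp add: x_def field_simps)
    moreover have "0 \<le> real i / real k" "real i / real k \<le> 1" using that k0 by auto
    ultimately show ?thesis unfolding closed_segment_def by blast
  qed
  have dist_x: "\<bar>x (Suc i) - x i\<bar> = \<bar>b - a\<bar> / real k" for i
  proof -
    have "x (Suc i) - x i = (b - a) / real k"
      unfolding x_def of_nat_Suc by (simp only: distrib_right mult_1 add_diff_cancel_left add_diff_cancel_right')
    then show ?thesis by simp
  qed
  have dist_a: "\<bar>x i - a\<bar> = real i * (\<bar>b - a\<bar> / real k)" for i
    by (simp add: x_def abs_mult)
  have "i \<le> k \<Longrightarrow> f (x i) \<le> exp (C * \<bar>x i - a\<bar>) * f a" for i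
  proof (induction i)
    case 0
    then show ?case by (simp add: x_def)
  next
    case (Suc i)
    have "\<bar>x (Suc i) - x i\<bar> < \<tau>"
      unfolding dist_x using k k0 \<tau> by (simp add: field_simps)
    then have "f (x (Suc i)) \<le> exp (C * \<bar>x (Suc i) - x i\<bar>) * f (x i)"
      using Suc.prems by (intro step x_seg) auto
    also have "\<dots> \<le> exp (C * \<bar>x (Suc i) - x i\<bar>) * (exp (C * \<bar>x i - a\<bar>) * f a)"
      using Suc by (intro mult_left_mono) auto
    also have "\<dots> = exp (C * \<bar>x (Suc i) - a\<bar>) * f a"
      unfolding dist_x dist_a by (simp add: exp_add[symmetric] algebra_simps add_divide_distrib)
    finally show ?case .
  qed
  from this[of k] show ?thesis using k0 by (simp add: x_def)
qed

text \<open>Energies are differentiated along approximations restarted from u at points of the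
  segment; uniqueness identifies their limit with u. The step length depends on a bound R of the
  \<open>H^s\<close> norm over the segment, but the resulting rate c does not, which a persistence
  criterion requires. The margin \<open>\<eta>\<close> carries hypotheses on u over to
  approximations close to it in \<open>H^s\<close>.\<close>

lemma weighted_bound_transfer:
  fixes s :: real
  assumes s: "s > 3/2" and u: "coeff_solution s I u" and I: "is_interval I" "open I"
    and A: "\<And>n. 0 \<le> A n" "\<And>n. A n \<le> B * Hs_weight s n" and c: "0 \<le> c" and \<eta>: "0 < \<eta>"
    and flux: "\<And>t N v. \<lbrakk>t \<in> I; herm v; \<And>n. n \<notin> modes N \<Longrightarrow> v n = 0; nsq s (\<lambda>n. v n - u t n) < \<eta>\<rbrakk> \<Longrightarrow>
      \<bar>Re (\<Sum>n\<in>modes N. of_real (A n) * cnj (v n) * conv v (dx v) n)\<bar> \<le> c * (\<Sum>n\<in>modes N. A n * (cmod (v n))^2)"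
    and ab: "a \<in> I" "b \<in> I" and S: "finite S"
  shows "(\<Sum>n\<in>S. A n * (cmod (u b n))^2) \<le> exp (2 * c * \<bar>b - a\<bar>) * (\<Sum>\<^sub>\<infinity>n. A n * (cmod (u a n))^2)"
proof -
  let ?J = "closed_segment a b"
  have J: "?J \<subseteq> I" using I(1) ab by (simp add: is_interval_convex_1 closed_segment_subset)
  obtain R where R: "0 < R" "\<And>t. t \<in> ?J \<Longrightarrow> nsq s (u t) \<le> R^2"
    using coeff_solution_bounded[OF u compact_segment J] by blast
  obtain \<tau> where \<tau>: "\<And>R. 0 < R \<Longrightarrow> 0 < \<tau> R"
    "\<And>R u0. \<lbrakk>0 < R; in_Hs s u0; nsq s u0 \<le> R^2\<rbrakk> \<Longrightarrow> \<exists>u v. galerkin_limit s R (\<tau> R) u0 u v"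
    using local_existence[OF s] by blast
  define f where "f t = (\<Sum>\<^sub>\<infinity>n. A n * (cmod (u t n))^2)" for t
  have u_Hs: "in_Hs s (u t)" if "t \<in> I" for t using u that by (simp add: coeff_solution_def)
  have sum_le_f: "(\<Sum>n\<in>S. A n * (cmod (u t n))^2) \<le> f t" if "t \<in> I" "finite S" for t S
    unfolding f_def
  proof (rule finite_sum_le_infsum)
    show "(\<lambda>n. A n * (cmod (u t n))^2) summable_on UNIV"
    proof (rule summable_on_comparison_test)
      show "(\<lambda>n. B * (Hs_weight s n * (cmod (u t n))^2)) summable_on UNIV"
        by (intro summable_on_cmult_right in_Hs_summable u_Hs that)
      show "A n * (cmod (u t n))^2 \<le> B * (Hs_weight s n * (cmod (u t n))^2)" for n
        using mult_right_mono[OF A(2)[of n], of "(cmod (u t n))^2"] by (simp add: mult.assoc)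
    qed (use A(1) in auto)
  qed (use that A(1) in auto)
  have step: "f y \<le> exp ((2 * c) * \<bar>y - x\<bar>) * f x" if xy: "x \<in> ?J" "y \<in> ?J" "\<bar>y - x\<bar> < \<tau> R" for x y
  proof -
    let ?T = "\<tau> R" and ?r = "y - x"
    have x: "x \<in> I" and y: "y \<in> I" using xy J by auto
    have seg_xy: "closed_segment x y \<subseteq> ?J"
      using xy by (intro closed_segment_subset) auto
    obtain w v where w: "galerkin_limit s R ?T (u x) w v"
      using \<tau>(2)[OF R(1) u_Hs[OF x] R(2)[OF xy(1)]] by blast
    have seg: "closed_segment 0 ?r \<subseteq> {-?T<..<?T}"
      using xy(3) by (auto simp: closed_segment_eq_real_ivl split: if_splits)
    have shift_mem: "x + r \<in> closed_segment x y" if "r \<in> closed_segment 0 ?r" for r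
      using that by (auto simp: closed_segment_eq_real_ivl split: if_splits)
    let ?D = "{-?T<..<?T} \<inter> (\<lambda>r. x + r) -` I"
    have w_sol: "coeff_solution s ?D w"
      using galerkin_limit_coeff_solution[OF _ w u_Hs[OF x]] s by (auto intro: coeff_solution_subset)
    have u_sol: "coeff_solution s ?D (\<lambda>r. u (x + r))"
      by (rule coeff_solution_shift[OF u]) auto
    have segD: "closed_segment 0 ?r \<subseteq> ?D"
    proof
      fix r assume r: "r \<in> closed_segment 0 ?r"
      then have "x + r \<in> I" using shift_mem seg_xy J by blast
      then show "r \<in> ?D" using seg r by auto
    qed
    have w_eq: "w r = u (x + r)" if r: "r \<in> closed_segment 0 ?r" for r
    proof (rule coeff_solution_unique[OF s w_sol u_sol])
      show "w 0 = u (x + 0)" using w by (simp add: galerkin_limit_def)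
      have "closed_segment 0 r \<subseteq> closed_segment 0 ?r"
        using r by (intro closed_segment_subset) auto
      then show "closed_segment 0 r \<subseteq> ?D" using segD by blast
    qed
    obtain N0 where N0: "\<And>N r. \<lbrakk>N0 \<le> N; r \<in> {-?T..?T}\<rbrakk> \<Longrightarrow> nsq s (\<lambda>n. v N r n - w r n) < \<eta>"
      using w \<eta> unfolding galerkin_limit_def by meson
    have v: "galerkin N (closed_segment 0 ?r) (v N)" "v N 0 = trunc N (u x)" for N
    proof -
      have "galerkin N {-?T..?T} (v N)" "v N 0 = trunc N (u x)" using w by (auto simp: galerkin_limit_def)
      moreover have "closed_segment 0 ?r \<subseteq> {-?T..?T}" using seg by force
      ultimately show "galerkin N (closed_segment 0 ?r) (v N)" "v N 0 = trunc N (u x)"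
        by (auto intro: galerkin_subset)
    qed
    have bound: "(\<Sum>n\<in>modes N. A n * (cmod (v N ?r n))^2) \<le> exp (2 * c * \<bar>?r\<bar>) * f x" if N: "N0 \<le> N" for N
    proof -
      have "(\<Sum>n\<in>modes N. A n * (cmod (v N ?r n))^2) \<le> exp (2 * c * \<bar>?r - 0\<bar>) * (\<Sum>n\<in>modes N. A n * (cmod (v N 0 n))^2)"
      proof (rule galerkin_weighted_bound[OF v(1) order.refl c])
        fix r assume r: "r \<in> closed_segment 0 ?r"
        show "\<bar>Re (\<Sum>n\<in>modes N. of_real (A n) * cnj (v N r n) * conv (v N r) (dx (v N r)) n)\<bar>
            \<le> c * (\<Sum>n\<in>modes N. A n * (cmod (v N r n))^2)"
        proof (rule flux)
          show "x + r \<in> I" using shift_mem[OF r] seg_xy J by auto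
          show "herm (v N r)" "\<And>n. n \<notin> modes N \<Longrightarrow> v N r n = 0"
            using v(1)[of N] r by (auto simp: galerkin_def)
          show "nsq s (\<lambda>n. v N r n - u (x + r) n) < \<eta>"
            using N0[OF N, of r] seg r unfolding w_eq[OF r] by force
        qed
      qed
      also have "(\<Sum>n\<in>modes N. A n * (cmod (v N 0 n))^2) = (\<Sum>n\<in>modes N. A n * (cmod (u x n))^2)"
        by (simp add: v(2) trunc_def)
      also have "\<dots> \<le> f x" by (rule sum_le_f[OF x]) simp
      finally show ?thesis by (simp add: mult_left_mono)
    qed
    have lim: "(\<lambda>N. v N ?r n) \<longlonglongrightarrow> u y n" for n
    proof (rule LIMSEQ_I)
      fix e :: real assume e: "0 < e"
      have e2: "0 < e^2" using e by simp
      obtain N1 where N1: "\<And>N r. \<lbrakk>N1 \<le> N; r \<in> {-?T..?T}\<rbrakk> \<Longrightarrow> nsq s (\<lambda>n. v N r n - w r n) < e^2"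
        using w e2 unfolding galerkin_limit_def by meson
      show "\<exists>N1. \<forall>N\<ge>N1. norm (v N ?r n - u y n) < e"
      proof (intro exI[of _ N1] allI impI)
        fix N assume N: "N1 \<le> N"
        have r: "?r \<in> {-?T..?T}" using xy(3) by auto
        have wr: "w ?r = u y" using w_eq[of ?r] by simp
        have "in_Hs s (\<lambda>n. v N ?r n - u y n)"
          using galerkin_tail(1)[OF v(1)[of N], of ?r s] u_Hs[OF y] by (intro in_Hs_diff) auto
        then have "(cmod (v N ?r n - u y n))^2 \<le> nsq s (\<lambda>n. v N ?r n - u y n)"
          using s by (intro norm_le_nsq) auto
        also have "\<dots> < e^2" using N1[OF N r] unfolding wr .
        finally show "norm (v N ?r n - u y n) < e" using e by (simp add: power2_less_imp_less)
      qed
    qed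
    have fin: "(\<Sum>n\<in>S. A n * (cmod (u y n))^2) \<le> exp (2 * c * \<bar>?r\<bar>) * f x" if S: "finite S" for S
    proof (rule tendsto_upperbound)
      show "(\<lambda>N. \<Sum>n\<in>S. A n * (cmod (v N ?r n))^2) \<longlonglongrightarrow> (\<Sum>n\<in>S. A n * (cmod (u y n))^2)"
        by (intro tendsto_intros lim)
      show "\<forall>\<^sub>F N in sequentially. (\<Sum>n\<in>S. A n * (cmod (v N ?r n))^2) \<le> exp (2 * c * \<bar>?r\<bar>) * f x"
        unfolding eventually_sequentially
      proof (intro exI[of _ N0] allI impI)
        fix N assume N: "N0 \<le> N"
        have "(\<Sum>n\<in>S. A n * (cmod (v N ?r n))^2) = (\<Sum>n\<in>S \<inter> modes N. A n * (cmod (v N ?r n))^2)"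
          using v(1)[of N] S by (intro sum.mono_neutral_right) (auto simp: galerkin_def)
        also have "\<dots> \<le> (\<Sum>n\<in>modes N. A n * (cmod (v N ?r n))^2)"
          using A(1) by (intro sum_mono2) auto
        finally show "(\<Sum>n\<in>S. A n * (cmod (v N ?r n))^2) \<le> exp (2 * c * \<bar>?r\<bar>) * f x"
          using bound[OF N] by linarith
      qed
    qed simp
    show ?thesis
      unfolding f_def[of y] using fin A(1) by (intro nonneg_bounded_sums(2)) auto
  qed
  have "f b \<le> exp ((2 * c) * \<bar>b - a\<bar>) * f a"
    by (rule exponential_chain[OF \<tau>(1)[OF R(1)] step])
  then show ?thesis
    using sum_le_f[OF ab(2) S] by (simp add: f_def)
qed

section \<open>From a bound on sup |u_x| to the Wiener norm of u_x\<close>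

lemma fourier_eval_diff_le:
  assumes "ell1 f" "ell1 g"
  shows "cmod (fourier_eval f x - fourier_eval g x) \<le> l1n (\<lambda>n. f n - g n)"
proof -
  have summ: "(\<lambda>n. cmod (f n * exp (2 * of_real pi * \<i> * of_int n * of_real x))) summable_on UNIV" if "ell1 f" for f
    using that by (simp add: ell1_def norm_mult wave_def[symmetric])
  have "fourier_eval f x - fourier_eval g x = (\<Sum>\<^sub>\<infinity>n. (f n - g n) * exp (2 * of_real pi * \<i> * of_int n * of_real x))"
    unfolding fourier_eval_def left_diff_distrib
    by (rule infsum_minus[symmetric, OF Infinite_Sum.abs_summable_summable[OF summ[OF assms(1)]]
          Infinite_Sum.abs_summable_summable[OF summ[OF assms(2)]]])
  also have "cmod \<dots> \<le> (\<Sum>\<^sub>\<infinity>n. cmod ((f n - g n) * exp (2 * of_real pi * \<i> * of_int n * of_real x)))"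
    by (intro norm_infsum_bound summ ell1_diff assms)
  also have "\<dots> = l1n (\<lambda>n. f n - g n)"
    by (simp add: l1n_def norm_mult wave_def[symmetric])
  finally show ?thesis .
qed

lemma fourier_eval_trig:
  assumes "\<And>n. n \<notin> modes N \<Longrightarrow> v n = 0"
  shows "fourier_eval v x = trig N v x"
proof -
  have "fourier_eval v x = (\<Sum>\<^sub>\<infinity>n\<in>modes N. v n * wave n x)"
    unfolding fourier_eval_def wave_def using assms by (intro infsum_cong_neutral) auto
  then show ?thesis by (simp add: trig_def)
qed

text \<open>A radius in \<open>H^s\<close> within which neither the Wiener norm nor the supremum of
  the derivative changes by more than 1.\<close>

lemma l1n_dx_near:
  fixes s :: real
  assumes s: "s > 3/2"
  obtains \<eta> where "0 < \<eta>" "\<And>u. in_Hs s u \<Longrightarrow> ell1 (dx u)"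
    "\<And>u v. \<lbrakk>in_Hs s u; in_Hs s v; nsq s (\<lambda>n. v n - u n) < \<eta>\<rbrakk> \<Longrightarrow> l1n (\<lambda>n. dx v n - dx u n) \<le> 1"
proof -
  have "1/2 < s - 1" using s by simp
  then obtain C where C: "0 < C" "\<And>v. in_Hs (s - 1) v \<Longrightarrow> ell1 v" "\<And>v. in_Hs (s - 1) v \<Longrightarrow> l1n v \<le> C * sqrt (nsq (s - 1) v)"
    using in_Hs_ell1 by blast
  show thesis
  proof (rule that[of "(1 / C)^2"])
    show "0 < (1 / C)^2" using C(1) by simp
    show "ell1 (dx u)" if "in_Hs s u" for u by (intro C in_Hs_dx that)
    fix u v assume uv: "in_Hs s u" "in_Hs s v" "nsq s (\<lambda>n. v n - u n) < (1 / C)^2"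
    have z: "in_Hs s (\<lambda>n. v n - u n)" by (intro in_Hs_diff uv)
    have "l1n (dx (\<lambda>n. v n - u n)) \<le> C * sqrt (nsq (s - 1) (dx (\<lambda>n. v n - u n)))"
      by (intro C in_Hs_dx z)
    also have "\<dots> \<le> C * (1 / C)"
    proof (intro mult_left_mono real_le_lsqrt)
      show "nsq (s - 1) (dx (\<lambda>n. v n - u n)) \<le> (1 / C)^2"
        using in_Hs_dx(2)[OF z] uv(3) by linarith
    qed (use C(1) in auto)
    finally show "l1n (\<lambda>n. dx v n - dx u n) \<le> 1" using C(1) by (simp add: dx_diff)
  qed
qed

text \<open>The decay of the dyadic blocks is slightly stronger than \<open>H\<^sup>q\<close> regularity.\<close>

lemma weighted_sum_of_dyadic:
  fixes a :: "int \<Rightarrow> real" and q \<sigma> D :: real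
  assumes a: "\<And>n. 0 \<le> a n" "a 0 = 0" and q: "0 \<le> q" "q < \<sigma>" and D: "0 \<le> D"
    and dyadic: "\<And>j S. finite S \<Longrightarrow> (\<Sum>n\<in>{n\<in>S. 2 ^ j \<le> \<bar>n\<bar>}. a n) \<le> D * ((1/2) ^ j) powr (2 * \<sigma>)"
    and S: "finite S"
  shows "(\<Sum>n\<in>S. Hs_weight q n * a n) \<le> (4 * (1 + 4 * pi^2)) powr q * D / (1 - (1/2) powr (2 * (\<sigma> - q)))"
proof -
  define c where "c = (4 * (1 + 4 * pi^2)) powr q"
  \<comment> \<open>The ratio of the geometric series: in block j the weight 2^(2qj) meets the decay
    2^(-2 \<open>\<sigma>\<close> j).\<close>
  define r where "r = (1/2 :: real) powr (2 * (\<sigma> - q))"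
  have r: "0 < r" "r < 1"
  proof -
    show "0 < r" by (simp add: r_def)
    have "r = 1 / 2 powr (2 * (\<sigma> - q))" by (simp add: r_def powr_divide)
    also have "\<dots> = 2 powr (- (2 * (\<sigma> - q)))" by (simp only: powr_minus_divide)
    finally have "r = 2 powr (- (2 * (\<sigma> - q)))" .
    then show "r < 1" using powr_less_one[of 2 "- (2 * (\<sigma> - q))"] q by simp
  qed
  obtain J where J: "S \<subseteq> modes J" using finite_subset_modes[OF S] by blast
  have c0: "0 \<le> c" by (simp add: c_def)
  \<comment> \<open>A frequency is charged to every j with 2^j <= |n|. The largest such j already
    pays for its weight, and the other charges are nonnegative.\<close>
  define b where "b j n = c * (2 ^ j) powr (2 * q) * (if 2 ^ j \<le> \<bar>n\<bar> then a n else 0)" for j :: nat and n :: int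
  have b0: "0 \<le> b j n" for j n using a c0 by (simp add: b_def)
  have pt: "Hs_weight q n * a n \<le> (\<Sum>j\<le>J. b j n)" if n: "n \<in> S" for n
  proof (cases "n = 0")
    case True
    then show ?thesis using a b0 by (simp add: sum_nonneg)
  next
    case False
    define m where "m = nat \<bar>n\<bar>"
    have m: "0 < m" "m \<le> J" using False n J by (auto simp: m_def mem_modes subset_iff)
    obtain j where j: "2 ^ j \<le> m" "m < 2 ^ Suc j"
      using ex_power_ivl1[of 2 m] m by auto
    have "j < 2 ^ j" by (rule less_exp)
    then have jJ: "j \<le> J" using j m by linarith
    have n_le: "\<bar>real_of_int n\<bar> \<le> 2 * 2 ^ j"
    proof -
      have "real m \<le> real (2 ^ Suc j)" using j(2) by (simp only: of_nat_le_iff)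
      then show ?thesis by (simp add: m_def)
    qed
    have "jap n \<le> (4 * (1 + 4 * pi^2)) * (2 ^ j)^2"
    proof -
      have "1 \<le> (real_of_int n)^2" using False by (simp add: abs_le_square_iff[of 1, simplified, symmetric])
      then have "jap n \<le> (1 + 4 * pi^2) * (real_of_int n)^2" by (simp add: jap_def algebra_simps)
      also have "\<dots> \<le> (1 + 4 * pi^2) * (2 * 2 ^ j)^2"
        using power_mono[OF n_le, of 2] by (intro mult_left_mono) (auto simp: add_nonneg_nonneg)
      finally show ?thesis by (simp add: power_mult_distrib algebra_simps)
    qed
    then have "Hs_weight q n \<le> ((4 * (1 + 4 * pi^2)) * (2 ^ j)^2) powr q"
      unfolding Hs_weight_jap using q by (intro powr_mono2) (auto simp: less_imp_le)
    also have "\<dots> = c * (2 ^ j) powr (2 * q)"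
    proof -
      have "((2 ^ j)^2 :: real) powr q = (2 ^ j) powr (2 * q)"
        using powr_powr[of "2 ^ j :: real" 2 q] by simp
      moreover have "((4 * (1 + 4 * pi^2)) * (2 ^ j)^2) powr q = (4 * (1 + 4 * pi^2)) powr q * ((2 ^ j)^2) powr q"
        by (rule powr_mult)
      ultimately show ?thesis by (simp add: c_def)
    qed
    finally have "Hs_weight q n * a n \<le> c * (2 ^ j) powr (2 * q) * a n"
      using a by (intro mult_right_mono) auto
    also have "\<dots> = b j n"
    proof -
      have "int (2 ^ j) \<le> int m" using j(1) by (simp only: of_nat_le_iff)
      then have "2 ^ j \<le> \<bar>n\<bar>" by (simp add: m_def)
      then show ?thesis by (simp add: b_def)
    qed
    also have "\<dots> \<le> (\<Sum>j\<le>J. b j n)"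
      using jJ b0 by (intro member_le_sum) auto
    finally show ?thesis .
  qed
  have "(\<Sum>n\<in>S. Hs_weight q n * a n) \<le> (\<Sum>n\<in>S. \<Sum>j\<le>J. b j n)"
    by (intro sum_mono pt)
  also have "\<dots> = (\<Sum>j\<le>J. \<Sum>n\<in>S. b j n)" by (rule sum.swap)
  also have "\<dots> \<le> (\<Sum>j\<le>J. c * D * r ^ j)"
  proof (rule sum_mono)
    fix j
    have "(\<Sum>n\<in>S. b j n) = c * (2 ^ j) powr (2 * q) * (\<Sum>n\<in>{n\<in>S. 2 ^ j \<le> \<bar>n\<bar>}. a n)"
      using S unfolding b_def sum_distrib_left[symmetric] by (simp add: sum.inter_filter)
    also have "\<dots> \<le> c * (2 ^ j) powr (2 * q) * (D * ((1/2) ^ j) powr (2 * \<sigma>))"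
      using c0 by (intro mult_left_mono dyadic S) auto
    also have "\<dots> = c * D * r ^ j"
    proof -
      have "(2 ^ j :: real) powr (2 * q) = ((1/2) ^ j) powr (- (2 * q))"
        by (simp add: powr_minus powr_divide power_one_over powr_one_eq_one)
      then have "(2 ^ j :: real) powr (2 * q) * ((1/2) ^ j) powr (2 * \<sigma>) = ((1/2) ^ j) powr (2 * (\<sigma> - q))"
        by (simp add: powr_add[symmetric] algebra_simps)
      also have "\<dots> = r ^ j"
        by (simp add: r_def powr_powr mult.commute flip: powr_realpow)
      finally show ?thesis by simp
    qed
    finally show "(\<Sum>n\<in>S. b j n) \<le> c * D * r ^ j" .
  qed
  also have "\<dots> = c * D * (\<Sum>j\<le>J. r ^ j)" by (simp add: sum_distrib_left)
  also have "\<dots> \<le> c * D * (1 / (1 - r))"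
  proof (intro mult_left_mono)
    have "(\<Sum>j\<le>J. r ^ j) = (1 - r ^ Suc J) / (1 - r)"
      using r sum_gp0[of r J] by simp
    also have "\<dots> \<le> 1 / (1 - r)" using r by (intro divide_right_mono) auto
    finally show "(\<Sum>j\<le>J. r ^ j) \<le> 1 / (1 - r)" .
  qed (use c0 D in auto)
  finally show ?thesis by (simp add: c_def r_def)
qed

text \<open>At scale 2^(-j) the normalised two-point energy starts at order 2^(-2
  \<open>\<sigma>\<close> j) by the regularity of the datum, grows by a factor independent of j, and
  dominates the part of u_x with |n| >= 2^j. The blocks are summed in \<open>H^q\<close> with 1/2 <
  q < \<open>\<sigma>\<close>, which embeds into the Wiener algebra.\<close>

lemma C1_bound_imp_l1n_bound:
  fixes s :: real
  assumes s: "s > 3/2" and T: "0 < T" and u: "coeff_solution s {-T<..<T} u"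
    and M: "\<And>t x. t \<in> {-T<..<T} \<Longrightarrow> cmod (fourier_eval (dx (u t)) x) \<le> M"
  obtains B where "\<And>t. t \<in> {-T<..<T} \<Longrightarrow> l1n (dx (u t)) \<le> B"
proof -
  let ?I = "{-T<..<T}"
  have u_Hs: "in_Hs s (u t)" if "t \<in> ?I" for t using u that by (simp add: coeff_solution_def)
  have zero: "0 \<in> ?I" using T by simp
  have M0: "0 \<le> M" using order.trans[OF norm_ge_zero M[OF zero]] .
  obtain \<eta> where \<eta>: "0 < \<eta>" "\<And>u. in_Hs s u \<Longrightarrow> ell1 (dx u)"
    "\<And>u v. \<lbrakk>in_Hs s u; in_Hs s v; nsq s (\<lambda>n. v n - u n) < \<eta>\<rbrakk> \<Longrightarrow> l1n (\<lambda>n. dx v n - dx u n) \<le> 1"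
    using l1n_dx_near[OF s] by blast
  \<comment> \<open>The initial u_x has regularity s - 1, but the upper bound for the normalised
    weight is only quadratic in n \<open>\<delta>\<close>, so decay is extracted up to order 1. What
    matters is that \<open>\<sigma>\<close> still exceeds 1/2.\<close>
  define \<sigma> where "\<sigma> = min (s - 1) 1"
  have \<sigma>: "1/2 < \<sigma>" "\<sigma> \<le> 1" "\<sigma> \<le> s - 1" using s by (auto simp: \<sigma>_def)
  define q where "q = (1/2 + \<sigma>) / 2"
  have q: "1/2 < q" "q < \<sigma>" using \<sigma> by (auto simp: q_def)
  \<comment> \<open>M + 1 bounds sup |v_x| for the approximations v, whose derivative differs from
    u_x by at most 1.\<close>
  define c where "c = (1 + 2 * pi) * (M + 1)"
  have c: "0 \<le> c" using M0 by (simp add: c_def)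
  define D where "D = exp (2 * c * T) * (16 * pi^2 * nsq s (u 0))"
  have D: "0 \<le> D" by (simp add: D_def)
  have block: "(\<Sum>n\<in>{n\<in>S. 2 ^ j \<le> \<bar>n\<bar>}. (cmod (dx (u t) n))^2) \<le> D * ((1/2) ^ j) powr (2 * \<sigma>)"
    if t: "t \<in> ?I" and S: "finite S" for t S and j :: nat
  proof -
    define \<delta> where "\<delta> = (1/2 :: real) ^ j"
    have \<delta>: "0 < \<delta>" "\<delta> \<le> 1" by (auto simp: \<delta>_def power_le_one)
    \<comment> \<open>The factor turns the lower bound of \<open>pair_kernel_weight_ge\<close> into
      1.\<close>
    define w where "w n = 8 * pi * \<delta>^3 * pair_kernel_weight \<delta> n" for n
    define A where "A n = 4 * pi^2 * (real_of_int n)^2 * w n" for n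
    have w0: "0 \<le> w n" for n
      unfolding w_def using pair_kernel_weight_nonneg[OF \<delta>(1), of n] \<delta> by simp
    have w_le: "w n \<le> 16 * pi^2" "w n \<le> 16 * pi^2 * ((real_of_int n)^2 * \<delta>^2)" for n
    proof -
      have "w n \<le> 8 * pi * \<delta>^3 * (2 * pi / \<delta>^3)"
        unfolding w_def using \<delta> pair_kernel_weight_le(1)[OF \<delta>(1), of n] by (intro mult_left_mono) auto
      then show "w n \<le> 16 * pi^2" using \<delta> by (simp add: power2_eq_square)
      have "w n \<le> 8 * pi * \<delta>^3 * (2 * pi / \<delta>^3 * ((real_of_int n)^2 * \<delta>^2))"
        unfolding w_def using \<delta> pair_kernel_weight_le(2)[OF \<delta>(1), of n] by (intro mult_left_mono) auto
      then show "w n \<le> 16 * pi^2 * ((real_of_int n)^2 * \<delta>^2)" using \<delta> by (simp add: power2_eq_square)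
    qed
    have Aw: "A n * (cmod (v n))^2 = w n * (cmod (dx v n))^2" for n v
      by (simp add: A_def norm_dx power_mult_distrib)
    have energy: "(\<Sum>n\<in>S. A n * (cmod (u t n))^2) \<le> exp (2 * c * \<bar>t - 0\<bar>) * (\<Sum>\<^sub>\<infinity>n. A n * (cmod (u 0 n))^2)" if "finite S" for S
    proof (rule weighted_bound_transfer[OF s u _ _ _ _ c \<eta>(1) _ zero t that])
      show "is_interval ?I" by (simp add: is_interval_oo)
      show "0 \<le> A n" for n unfolding A_def using w0 by simp
      show "A n \<le> 16 * pi^2 * Hs_weight s n" for n
      proof -
        have "A n \<le> (4 * pi^2 * (real_of_int n)^2) * (16 * pi^2)"
          unfolding A_def by (intro mult_left_mono w_le) auto
        also have "\<dots> \<le> Hs_weight s n * (16 * pi^2)"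
          using s Hs_weight_mono[of 1 s n] by (intro mult_right_mono) (auto simp: Hs_weight_1 jap_def)
        finally show ?thesis by (simp add: mult.commute)
      qed
      fix r N v assume r: "r \<in> ?I" and v: "herm v" "\<And>n. n \<notin> modes N \<Longrightarrow> v n = 0" "nsq s (\<lambda>n. v n - u r n) < \<eta>"
      have v_Hs: "in_Hs s v" by (rule finite_support_in_Hs(1)[OF v(1,2)])
      have "cmod (trig N (dx v) x) \<le> M + 1" for x
      proof -
        have "cmod (fourier_eval (dx v) x - fourier_eval (dx (u r)) x) \<le> 1"
          using fourier_eval_diff_le[OF \<eta>(2)[OF v_Hs] \<eta>(2)[OF u_Hs[OF r]], of x] \<eta>(3)[OF u_Hs[OF r] v_Hs v(3)] by linarith
        moreover have "fourier_eval (dx v) x = trig N (dx v) x"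
          using v(2) by (intro fourier_eval_trig) (simp add: dx_support)
        ultimately show ?thesis
          using M[OF r, of x] norm_triangle_ineq2[of "trig N (dx v) x" "fourier_eval (dx (u r)) x"] by simp
      qed
      from two_point_flux_le[OF \<delta>(1) v(1,2) this]
      have "8 * pi * \<delta>^3 * \<bar>Re (\<Sum>n\<in>modes N. of_real (4 * pi^2 * (of_int n)^2 * pair_kernel_weight \<delta> n) * cnj (v n) * conv v (dx v) n)\<bar>
          \<le> 8 * pi * \<delta>^3 * (c * (\<Sum>n\<in>modes N. 4 * pi^2 * (of_int n)^2 * pair_kernel_weight \<delta> n * (cmod (v n))^2))"
        unfolding c_def using \<delta> by (intro mult_left_mono) auto
      moreover have "8 * pi * \<delta>^3 * \<bar>Re (\<Sum>n\<in>modes N. of_real (4 * pi^2 * (of_int n)^2 * pair_kernel_weight \<delta> n) * cnj (v n) * conv v (dx v) n)\<bar>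
          = \<bar>Re (\<Sum>n\<in>modes N. of_real (A n) * cnj (v n) * conv v (dx v) n)\<bar>"
      proof -
        have "Re (\<Sum>n\<in>modes N. of_real (A n) * cnj (v n) * conv v (dx v) n)
            = Re (of_real (8 * pi * \<delta>^3) * (\<Sum>n\<in>modes N. of_real (4 * pi^2 * (of_int n)^2 * pair_kernel_weight \<delta> n) * cnj (v n) * conv v (dx v) n))"
          unfolding sum_distrib_left A_def w_def by (intro arg_cong[of _ _ Re] sum.cong refl) (simp add: mult_ac)
        then show ?thesis
          unfolding Re_of_real_mult using \<delta> by (simp only: abs_mult) (simp add: abs_mult)
      qed
      moreover have "8 * pi * \<delta>^3 * (c * (\<Sum>n\<in>modes N. 4 * pi^2 * (of_int n)^2 * pair_kernel_weight \<delta> n * (cmod (v n))^2))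
          = c * (\<Sum>n\<in>modes N. A n * (cmod (v n))^2)"
        unfolding sum_distrib_left A_def w_def by (intro sum.cong refl) (simp add: mult_ac)
      ultimately show "\<bar>Re (\<Sum>n\<in>modes N. of_real (A n) * cnj (v n) * conv v (dx v) n)\<bar> \<le> c * (\<Sum>n\<in>modes N. A n * (cmod (v n))^2)"
        by simp
    qed simp
    have initial: "(\<Sum>\<^sub>\<infinity>n. A n * (cmod (u 0 n))^2) \<le> 16 * pi^2 * \<delta> powr (2 * \<sigma>) * nsq s (u 0)"
    proof (rule nonneg_bounded_sums(2))
      show "0 \<le> A n * (cmod (u 0 n))^2" for n unfolding A_def using w0 by simp
      fix S :: "int set" assume S: "finite S"
      have w_interp: "w n \<le> 16 * pi^2 * \<delta> powr (2 * \<sigma>) * Hs_weight \<sigma> n" for n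
      proof -
        define y where "y = (real_of_int n)^2 * \<delta>^2"
        have y0: "0 \<le> y" by (simp add: y_def)
        \<comment> \<open>Interpolation between the two upper bounds for w, possible because 0 <=
          \<open>\<sigma>\<close> <= 1.\<close>
        have "min 1 y \<le> y powr \<sigma>"
        proof (cases "y \<le> 1")
          case True
          show ?thesis
          proof (cases "y = 0")
            case False
            then have "y powr 1 \<le> y powr \<sigma>" using True y0 \<sigma> by (intro powr_mono') auto
            then show ?thesis using y0 by simp
          qed simp
        next
          case False
          then have "1 \<le> y powr \<sigma>" using \<sigma> by (intro ge_one_powr_ge_zero) auto
          then show ?thesis by simp
        qed
        also have "y powr \<sigma> = ((real_of_int n)^2) powr \<sigma> * \<delta> powr (2 * \<sigma>)"
          using \<delta> powr_powr[of \<delta> 2 \<sigma>] by (simp add: y_def powr_mult)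
        also have "\<dots> \<le> Hs_weight \<sigma> n * \<delta> powr (2 * \<sigma>)"
          unfolding Hs_weight_jap
        proof (intro mult_right_mono powr_mono2)
          have "1 * (real_of_int n)^2 \<le> 4 * pi^2 * (real_of_int n)^2"
          proof (rule mult_right_mono)
            have "1^2 \<le> pi^2" using pi_gt3 by (intro power_mono) auto
            then show "1 \<le> 4 * pi^2" by simp
          qed simp
          then show "(real_of_int n)^2 \<le> jap n" by (simp add: jap_def)
        qed (use \<sigma> in auto)
        finally have "16 * pi^2 * min 1 y \<le> 16 * pi^2 * (Hs_weight \<sigma> n * \<delta> powr (2 * \<sigma>))"
          by (intro mult_left_mono) auto
        moreover have "w n \<le> 16 * pi^2 * min 1 y" using w_le[of n] by (simp add: y_def min_def)
        ultimately have "w n \<le> 16 * pi^2 * (Hs_weight \<sigma> n * \<delta> powr (2 * \<sigma>))"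
          by (rule order.trans[rotated])
        then show ?thesis by (simp add: mult_ac)
      qed
      have "(\<Sum>n\<in>S. A n * (cmod (u 0 n))^2) \<le> (\<Sum>n\<in>S. 16 * pi^2 * \<delta> powr (2 * \<sigma>) * (Hs_weight \<sigma> n * (cmod (dx (u 0) n))^2))"
        unfolding Aw using mult_right_mono[OF w_interp, of "(cmod (dx (u 0) _))^2"] by (intro sum_mono) (simp add: mult.assoc)
      also have "\<dots> = 16 * pi^2 * \<delta> powr (2 * \<sigma>) * (\<Sum>n\<in>S. Hs_weight \<sigma> n * (cmod (dx (u 0) n))^2)"
        by (simp add: sum_distrib_left)
      also have "\<dots> \<le> 16 * pi^2 * \<delta> powr (2 * \<sigma>) * nsq s (u 0)"
      proof (intro mult_left_mono)
        have "in_Hs (s - 1) (dx (u 0))" by (intro in_Hs_dx u_Hs zero)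
        from in_Hs_mono[OF this \<sigma>(3)] have "in_Hs \<sigma> (dx (u 0))" "nsq \<sigma> (dx (u 0)) \<le> nsq (s - 1) (dx (u 0))" by auto
        then show "(\<Sum>n\<in>S. Hs_weight \<sigma> n * (cmod (dx (u 0) n))^2) \<le> nsq s (u 0)"
          using nsq_ge_sum[OF _ S, of \<sigma> "dx (u 0)"] in_Hs_dx(2)[OF u_Hs[OF zero]] by linarith
      qed auto
      finally show "(\<Sum>n\<in>S. A n * (cmod (u 0 n))^2) \<le> 16 * pi^2 * \<delta> powr (2 * \<sigma>) * nsq s (u 0)" .
    qed
    let ?S' = "{n\<in>S. 2 ^ j \<le> \<bar>n\<bar>}"
    have "(\<Sum>n\<in>?S'. (cmod (dx (u t) n))^2) \<le> (\<Sum>n\<in>?S'. A n * (cmod (u t n))^2)"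
    proof (rule sum_mono)
      fix n assume "n \<in> ?S'"
      then have "real_of_int (2 ^ j) \<le> real_of_int \<bar>n\<bar>" by (simp only: of_int_le_iff mem_Collect_eq)
      then have "1 \<le> \<bar>real_of_int n\<bar> * \<delta>" by (simp add: \<delta>_def power_one_over field_simps)
      from pair_kernel_weight_ge[OF \<delta> this] have "1 \<le> w n"
        using \<delta> by (simp add: w_def field_simps)
      then show "(cmod (dx (u t) n))^2 \<le> A n * (cmod (u t n))^2"
        unfolding Aw using mult_right_mono[of 1 "w n" "(cmod (dx (u t) n))^2"] by simp
    qed
    also have "\<dots> \<le> exp (2 * c * \<bar>t - 0\<bar>) * (\<Sum>\<^sub>\<infinity>n. A n * (cmod (u 0 n))^2)"
      using S by (intro energy) auto
    also have "\<dots> \<le> exp (2 * c * T) * (16 * pi^2 * \<delta> powr (2 * \<sigma>) * nsq s (u 0))"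
    proof (intro mult_mono initial)
      show "exp (2 * c * \<bar>t - 0\<bar>) \<le> exp (2 * c * T)" using t c by (auto intro!: mult_left_mono)
      show "0 \<le> (\<Sum>\<^sub>\<infinity>n. A n * (cmod (u 0 n))^2)" unfolding A_def using w0 by (intro infsum_nonneg) simp
    qed simp
    also have "\<dots> = D * ((1/2) ^ j) powr (2 * \<sigma>)" by (simp add: D_def \<delta>_def mult_ac)
    finally show ?thesis .
  qed
  obtain C where C: "0 < C"
    "\<And>(a :: int \<Rightarrow> complex) S. finite S \<Longrightarrow> (\<Sum>n\<in>S. cmod (a n)) \<le> C * sqrt (\<Sum>n\<in>S. Hs_weight q n * (cmod (a n))^2)"
    using sum_norm_le_weighted[OF q(1)] by blast
  define E where "E = (4 * (1 + 4 * pi^2)) powr q * D / (1 - (1/2) powr (2 * (\<sigma> - q)))"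
  show thesis
  proof (rule that)
    fix t assume t: "t \<in> ?I"
    show "l1n (dx (u t)) \<le> C * sqrt E"
    proof (rule ell1_bounded(2))
      fix S :: "int set" assume S: "finite S"
      have "(\<Sum>n\<in>S. Hs_weight q n * (cmod (dx (u t) n))^2) \<le> E"
        unfolding E_def by (rule weighted_sum_of_dyadic[OF _ _ _ q(2) D block[OF t] S]) (use q in \<open>auto simp: dx_def\<close>)
      then have "C * sqrt (\<Sum>n\<in>S. Hs_weight q n * (cmod (dx (u t) n))^2) \<le> C * sqrt E"
        using C(1) by simp
      then show "(\<Sum>n\<in>S. cmod (dx (u t) n)) \<le> C * sqrt E"
        using C(2)[OF S, of "dx (u t)"] by linarith
    qed
  qed
qed

text \<open>Once the Wiener norm of u_x is bounded, the energy estimate is linear in the energy and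
  Gronwall's inequality covers the whole interval. The squared tail weight with K = 1 is the Sobolev
  weight.\<close>

lemma l1n_bound_imp_Hs_bound:
  fixes s :: real
  assumes s: "s > 3/2" and T: "0 < T" and u: "coeff_solution s {-T<..<T} u"
    and B: "\<And>t. t \<in> {-T<..<T} \<Longrightarrow> l1n (dx (u t)) \<le> B"
  obtains R where "0 < R" "\<And>t. t \<in> {-T<..<T} \<Longrightarrow> nsq s (u t) \<le> R^2"
proof -
  let ?I = "{-T<..<T}"
  have u_Hs: "in_Hs s (u t)" if "t \<in> ?I" for t using u that by (simp add: coeff_solution_def)
  have zero: "0 \<in> ?I" using T by simp
  have B0: "0 \<le> B" using order.trans[OF l1n_nonneg B[OF zero]] .
  obtain \<eta> where \<eta>: "0 < \<eta>" "\<And>u. in_Hs s u \<Longrightarrow> ell1 (dx u)"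
    "\<And>u v. \<lbrakk>in_Hs s u; in_Hs s v; nsq s (\<lambda>n. v n - u n) < \<eta>\<rbrakk> \<Longrightarrow> l1n (\<lambda>n. dx v n - dx u n) \<le> 1"
    using l1n_dx_near[OF s] by blast
  obtain C where C: "0 < C" "\<And>K. 1 \<le> K \<Longrightarrow> comm_weight C (tail_weight s K)"
    using tail_weight_comm[of s] s by auto
  define c where "c = (1/2 + 2 * C) * (B + 1)"
  have c: "0 \<le> c" using B0 C by (simp add: c_def)
  define E where "E = exp (2 * c * T) * nsq s (u 0) + 1"
  have E: "0 < E" unfolding E_def by (intro add_nonneg_pos) auto
  show thesis
  proof (rule that[of "sqrt E"])
    show "0 < sqrt E" using E by simp
    fix t assume t: "t \<in> ?I"
    have "(\<Sum>n\<in>S. Hs_weight s n * (cmod (u t n))^2) \<le> exp (2 * c * \<bar>t - 0\<bar>) * (\<Sum>\<^sub>\<infinity>n. Hs_weight s n * (cmod (u 0 n))^2)"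
      if "finite S" for S
    proof (rule weighted_bound_transfer[OF s u _ _ _ _ c \<eta>(1) _ zero t that, where B = 1])
      show "is_interval ?I" by (simp add: is_interval_oo)
      fix r N v assume r: "r \<in> ?I" and v: "herm v" "\<And>n. n \<notin> modes N \<Longrightarrow> v n = 0" "nsq s (\<lambda>n. v n - u r n) < \<eta>"
      have v_Hs: "in_Hs s v" by (rule finite_support_in_Hs(1)[OF v(1,2)])
      have l1: "l1n (dx v) \<le> B + 1"
      proof (rule ell1_bounded(2))
        fix S :: "int set" assume S: "finite S"
        have "(\<Sum>n\<in>S. cmod (dx v n)) \<le> (\<Sum>n\<in>S. cmod (dx v n - dx (u r) n) + cmod (dx (u r) n))"
          by (intro sum_mono) (metis diff_add_cancel norm_triangle_ineq)
        also have "\<dots> \<le> l1n (\<lambda>n. dx v n - dx (u r) n) + l1n (dx (u r))"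
          unfolding sum.distrib by (intro add_mono l1n_ge_sum S ell1_diff \<eta>(2) v_Hs u_Hs r)
        also have "\<dots> \<le> B + 1"
          using \<eta>(3)[OF u_Hs[OF r] v_Hs v(3)] B[OF r] by linarith
        finally show "(\<Sum>n\<in>S. cmod (dx v n)) \<le> B + 1" .
      qed
      have "\<bar>Re (\<Sum>n\<in>modes N. of_real ((tail_weight s 1 n)^2) * cnj (v n) * conv v (dx v) n)\<bar>
          \<le> (1/2 + 2 * C) * l1n (dx v) * (\<Sum>n\<in>modes N. (tail_weight s 1 n)^2 * (cmod (v n))^2)"
        using C by (intro energy_flux_le v) auto
      also have "\<dots> \<le> c * (\<Sum>n\<in>modes N. (tail_weight s 1 n)^2 * (cmod (v n))^2)"
        unfolding c_def using C(1) l1 by (intro mult_right_mono mult_left_mono sum_nonneg) auto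
      finally show "\<bar>Re (\<Sum>n\<in>modes N. of_real (Hs_weight s n) * cnj (v n) * conv v (dx v) n)\<bar>
          \<le> c * (\<Sum>n\<in>modes N. Hs_weight s n * (cmod (v n))^2)"
        unfolding tail_weight_1 .
    qed auto
    from in_Hs_bounded(2)[OF in_Hs_herm[OF u_Hs[OF t]] this]
    have "nsq s (u t) \<le> exp (2 * c * \<bar>t - 0\<bar>) * nsq s (u 0)" by (simp add: nsq_def)
    also have "\<dots> \<le> exp (2 * c * T) * nsq s (u 0)"
      using t c by (intro mult_right_mono) (auto intro!: mult_left_mono)
    also have "\<dots> \<le> (sqrt E)^2" using E by (simp add: E_def)
    finally show "nsq s (u t) \<le> (sqrt E)^2" .
  qed
qed

text \<open>The lifespan of local solutions depends on R alone, so a restart close enough to each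
  end point runs beyond it. Uniqueness makes the pieces agree on overlaps, and being a solution is a
  local property, so they can be glued.\<close>

lemma Hs_bound_imp_extension:
  fixes s :: real
  assumes s: "s > 3/2" and T: "0 < T" and u: "coeff_solution s {-T<..<T} u"
    and R: "0 < R" "\<And>t. t \<in> {-T<..<T} \<Longrightarrow> nsq s (u t) \<le> R^2"
  obtains T' w where "T < T'" "coeff_solution s {-T'<..<T'} w" "\<And>t. t \<in> {-T<..<T} \<Longrightarrow> w t = u t"
proof -
  let ?I = "{-T<..<T}"
  have u_Hs: "in_Hs s (u t)" if "t \<in> ?I" for t using u that by (simp add: coeff_solution_def)
  obtain \<tau> where \<tau>: "\<And>R. 0 < R \<Longrightarrow> 0 < \<tau> R"
    "\<And>R u0. \<lbrakk>0 < R; in_Hs s u0; nsq s u0 \<le> R^2\<rbrakk> \<Longrightarrow> \<exists>u v. galerkin_limit s R (\<tau> R) u0 u v"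
    using local_existence[OF s] by blast
  \<comment> \<open>Local solutions are used on radius 2d and start at distance d inside the end
    points, so each overshoots by d; d <= T / 2 keeps the starting points inside the
    interval.\<close>
  define d where "d = min (\<tau> R / 2) (T / 2)"
  have d: "0 < d" "2 * d \<le> \<tau> R" "2 * d \<le> T" using \<tau>(1)[OF R(1)] T by (auto simp: d_def)
  have local_sol: "\<exists>w. coeff_solution s {a - 2 * d<..<a + 2 * d} w \<and> (\<forall>t\<in>{a - 2 * d<..<a + 2 * d} \<inter> ?I. w t = u t)"
    if a: "a \<in> ?I" for a
  proof -
    obtain w v where w: "galerkin_limit s R (\<tau> R) (u a) w v"
      using \<tau>(2)[OF R(1) u_Hs[OF a] R(2)[OF a]] by blast
    define w' where "w' t = w (- a + t)" for t
    have w': "coeff_solution s {a - 2 * d<..<a + 2 * d} w'"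
      unfolding w'_def using s d
      by (intro coeff_solution_shift[OF galerkin_limit_coeff_solution[OF _ w u_Hs[OF a]]]) auto
    have "w' t = u t" if t: "t \<in> {a - 2 * d<..<a + 2 * d} \<inter> ?I" for t
    proof (rule coeff_solution_unique[OF s])
      show "coeff_solution s ({a - 2 * d<..<a + 2 * d} \<inter> ?I) w'"
        by (rule coeff_solution_subset[OF w' Int_lower1])
      show "coeff_solution s ({a - 2 * d<..<a + 2 * d} \<inter> ?I) u"
        by (rule coeff_solution_subset[OF u Int_lower2])
      show "w' a = u a" using w by (simp add: w'_def galerkin_limit_def)
      show "closed_segment a t \<subseteq> {a - 2 * d<..<a + 2 * d} \<inter> ?I"
        using a t d by (auto simp: closed_segment_eq_real_ivl split: if_splits)
    qed
    then show ?thesis using w' by blast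
  qed
  have mem: "T - d \<in> ?I" "- T + d \<in> ?I" using d T by auto
  obtain p where p: "coeff_solution s {T - d - 2 * d<..<T - d + 2 * d} p"
    "\<And>t. t \<in> {T - d - 2 * d<..<T - d + 2 * d} \<Longrightarrow> t \<in> ?I \<Longrightarrow> p t = u t"
    using local_sol[OF mem(1)] by blast
  obtain m where m: "coeff_solution s {- T + d - 2 * d<..<- T + d + 2 * d} m"
    "\<And>t. t \<in> {- T + d - 2 * d<..<- T + d + 2 * d} \<Longrightarrow> t \<in> ?I \<Longrightarrow> m t = u t"
    using local_sol[OF mem(2)] by blast
  define w where "w t = (if t \<in> ?I then u t else if 0 < t then p t else m t)" for t
  have "coeff_solution s ?I w"
    by (rule coeff_solution_cong[OF u]) (auto simp: w_def)
  moreover have "coeff_solution s {T - d<..<T + d} w"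
  proof (rule coeff_solution_cong[where u = p])
    show "coeff_solution s {T - d<..<T + d} p"
      by (rule coeff_solution_subset[OF p(1)]) (use d in auto)
    fix t assume t: "t \<in> {T - d<..<T + d}"
    then show "w t = p t" using p(2)[of t] d by (auto simp: w_def)
  qed simp
  moreover have "coeff_solution s {- T - d<..<- T + d} w"
  proof (rule coeff_solution_cong[where u = m])
    show "coeff_solution s {- T - d<..<- T + d} m"
      by (rule coeff_solution_subset[OF m(1)]) (use d in auto)
    fix t assume t: "t \<in> {- T - d<..<- T + d}"
    then show "w t = m t" using m(2)[of t] d by (auto simp: w_def)
  qed simp
  ultimately have "coeff_solution s (?I \<union> {T - d<..<T + d} \<union> {- T - d<..<- T + d}) w"
    by (intro coeff_solution_Un)
  then have "coeff_solution s {- (T + d)<..<T + d} w"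
    by (rule coeff_solution_subset) (use d in auto)
  then show thesis
    by (rule that[rotated]) (use d in \<open>auto simp: w_def\<close>)
qed

theorem theorem5p1:
  fixes s :: real
  assumes "s > 3/2"
  shows "(\<forall>u0. in_Hs s u0 \<longrightarrow>
            (\<exists>T>0. \<exists>u. is_solution s T u \<and> u 0 = u0 \<and>
               (\<forall>v. is_solution s T v \<and> v 0 = u0 \<longrightarrow> (\<forall>t\<in>{-T<..<T}. v t = u t)) \<and>
               (\<forall>T'. 0 < T' \<and> T' < T \<longrightarrow> (\<forall>\<epsilon>>0. \<exists>\<delta>>0. \<forall>v0. in_Hs s v0 \<and> Hs_dist s v0 u0 < \<delta> \<longrightarrow>
                   (\<exists>v. is_solution s T' v \<and> v 0 = v0 \<and>
                        (\<forall>t\<in>{-T'<..<T'}. Hs_dist s (v t) (u t) < \<epsilon>))))))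
       \<and> (\<forall>T u. T > 0 \<and> is_solution s T u \<and> C1_bounded T u \<longrightarrow>
            (\<exists>T'>T. \<exists>w. is_solution s T' w \<and> (\<forall>t\<in>{-T<..<T}. w t = u t)))"
proof (rule conjI)
  obtain \<tau> where \<tau>: "\<And>R. 0 < R \<Longrightarrow> 0 < \<tau> R"
    "\<And>R u0. \<lbrakk>0 < R; in_Hs s u0; nsq s u0 \<le> R^2\<rbrakk> \<Longrightarrow> \<exists>u v. galerkin_limit s R (\<tau> R) u0 u v"
    using local_existence[OF assms] by blast
  show "\<forall>u0. in_Hs s u0 \<longrightarrow>
            (\<exists>T>0. \<exists>u. is_solution s T u \<and> u 0 = u0 \<and>
               (\<forall>v. is_solution s T v \<and> v 0 = u0 \<longrightarrow> (\<forall>t\<in>{-T<..<T}. v t = u t)) \<and>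
               (\<forall>T'. 0 < T' \<and> T' < T \<longrightarrow> (\<forall>\<epsilon>>0. \<exists>\<delta>>0. \<forall>v0. in_Hs s v0 \<and> Hs_dist s v0 u0 < \<delta> \<longrightarrow>
                   (\<exists>v. is_solution s T' v \<and> v 0 = v0 \<and>
                        (\<forall>t\<in>{-T'<..<T'}. Hs_dist s (v t) (u t) < \<epsilon>)))))"
  proof (intro allI impI)
    fix u0 assume u0: "in_Hs s u0"
    \<comment> \<open>Room for perturbed data: within distance 1 of u0 the squared norm is at most 2
      + 2 \<open>nsq s u0\<close>, so all these data share the lifespan
      \<open>\<tau> R\<close>.\<close>
    define R where "R = sqrt (2 * nsq s u0 + 2)"
    have R: "0 < R" "R^2 = 2 * nsq s u0 + 2" by (auto simp: R_def add_nonneg_pos)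
    define T where "T = \<tau> R"
    have T: "0 < T" unfolding T_def by (rule \<tau>(1)[OF R(1)])
    have "nsq s u0 \<le> R^2" using R(2) nsq_nonneg[of s u0] by linarith
    then obtain u p where u: "galerkin_limit s R T u0 u p"
      unfolding T_def using \<tau>(2)[OF R(1) u0] by blast
    have sol: "is_solution s T v" "v 0 = v0" if "galerkin_limit s R T v0 v p" "in_Hs s v0" for v v0 p
      unfolding is_solution_iff[OF assms] using galerkin_limit_coeff_solution[OF _ that] assms that(1)
      by (auto simp: galerkin_limit_def)
    show "\<exists>T>0. \<exists>u. is_solution s T u \<and> u 0 = u0 \<and>
               (\<forall>v. is_solution s T v \<and> v 0 = u0 \<longrightarrow> (\<forall>t\<in>{-T<..<T}. v t = u t)) \<and>
               (\<forall>T'. 0 < T' \<and> T' < T \<longrightarrow> (\<forall>\<epsilon>>0. \<exists>\<delta>>0. \<forall>v0. in_Hs s v0 \<and> Hs_dist s v0 u0 < \<delta> \<longrightarrow>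
                   (\<exists>v. is_solution s T' v \<and> v 0 = v0 \<and>
                        (\<forall>t\<in>{-T'<..<T'}. Hs_dist s (v t) (u t) < \<epsilon>))))"
    proof (rule exI[of _ T], rule conjI, rule T, rule exI[of _ u], intro conjI allI impI ballI)
      show "is_solution s T u" "u 0 = u0" using sol[OF u u0] by auto
      fix v t assume v: "is_solution s T v \<and> v 0 = u0" and t: "t \<in> {-T<..<T}"
      show "v t = u t"
      proof (rule coeff_solution_unique[OF assms])
        show "coeff_solution s {-T<..<T} v" "coeff_solution s {-T<..<T} u"
          using v sol(1)[OF u u0] is_solution_iff[OF assms] by auto
        show "v 0 = u 0" using v sol(2)[OF u u0] by simp
        show "closed_segment 0 t \<subseteq> {-T<..<T}"
          using t by (auto simp: closed_segment_eq_real_ivl split: if_splits)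
      qed
    next
      fix T' \<epsilon> :: real assume T': "0 < T' \<and> T' < T" and \<epsilon>: "0 < \<epsilon>"
      have "0 < \<epsilon>^2" using \<epsilon> by simp
      from continuous_dependence[OF assms R(1) T u0 u this] obtain \<delta> where \<delta>: "0 < \<delta>"
        "\<And>v0 v q t. \<lbrakk>in_Hs s v0; nsq s (\<lambda>n. v0 n - u0 n) < \<delta>; galerkin_limit s R T v0 v q; t \<in> {-T..T}\<rbrakk>
          \<Longrightarrow> nsq s (\<lambda>n. v t n - u t n) < \<epsilon>^2" by blast
      \<comment> \<open>The bound 1 keeps v0 in the ball fixed by R; the square root converts from
        the squared norm to the distance.\<close>
      define \<delta>' where "\<delta>' = min 1 (sqrt \<delta>)"
      have \<delta>': "0 < \<delta>'" "\<delta>'^2 \<le> 1" "\<delta>'^2 \<le> \<delta>"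
      proof -
        show "0 < \<delta>'" using \<delta>(1) by (simp add: \<delta>'_def)
        then show "\<delta>'^2 \<le> 1" by (intro power_le_one) (auto simp: \<delta>'_def)
        have "\<delta>'^2 \<le> (sqrt \<delta>)^2" using \<open>0 < \<delta>'\<close> by (intro power_mono) (auto simp: \<delta>'_def)
        then show "\<delta>'^2 \<le> \<delta>" using \<delta>(1) by simp
      qed
      show "\<exists>\<delta>>0. \<forall>v0. in_Hs s v0 \<and> Hs_dist s v0 u0 < \<delta> \<longrightarrow>
                   (\<exists>v. is_solution s T' v \<and> v 0 = v0 \<and> (\<forall>t\<in>{-T'<..<T'}. Hs_dist s (v t) (u t) < \<epsilon>))"
      proof (intro exI[of _ \<delta>'] conjI allI impI)
        show "0 < \<delta>'" by (rule \<delta>'(1))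
        fix v0 assume v0: "in_Hs s v0 \<and> Hs_dist s v0 u0 < \<delta>'"
        then have near: "nsq s (\<lambda>n. v0 n - u0 n) < \<delta>'^2" using Hs_dist_less_iff[OF \<delta>'(1)] by blast
        have "nsq s v0 \<le> 2 * nsq s (\<lambda>n. v0 n - u0 n) + 2 * nsq s u0"
          using in_Hs_add(2)[OF in_Hs_diff(1)[OF conjunct1[OF v0] u0] u0] by simp
        also have "\<dots> \<le> R^2" using near \<delta>'(2) R(2) by linarith
        finally obtain v q where v: "galerkin_limit s R T v0 v q"
          unfolding T_def using \<tau>(2)[OF R(1) conjunct1[OF v0]] by blast
        show "\<exists>v. is_solution s T' v \<and> v 0 = v0 \<and> (\<forall>t\<in>{-T'<..<T'}. Hs_dist s (v t) (u t) < \<epsilon>)"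
        proof (intro exI[of _ v] conjI ballI)
          have "coeff_solution s {-T<..<T} v" using sol(1)[OF v conjunct1[OF v0]] is_solution_iff[OF assms] by blast
          then have "coeff_solution s {-T'<..<T'} v"
            by (rule coeff_solution_subset) (use T' in auto)
          then show "is_solution s T' v" unfolding is_solution_iff[OF assms] .
          show "v 0 = v0" by (rule sol(2)[OF v conjunct1[OF v0]])
          fix t assume "t \<in> {-T'<..<T'}"
          then have "t \<in> {-T..T}" using T' by auto
          then have "nsq s (\<lambda>n. v t n - u t n) < \<epsilon>^2"
            using near \<delta>'(3) by (intro \<delta>(2)[OF conjunct1[OF v0] _ v]) auto
          then show "Hs_dist s (v t) (u t) < \<epsilon>" using Hs_dist_less_iff[OF \<epsilon>] by blast
        qed
      qed
    qed
  qed
  show "\<forall>T u. T > 0 \<and> is_solution s T u \<and> C1_bounded T u \<longrightarrow>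
            (\<exists>T'>T. \<exists>w. is_solution s T' w \<and> (\<forall>t\<in>{-T<..<T}. w t = u t))"
  proof (intro allI impI, elim conjE)
    fix T u assume T: "0 < T" and "is_solution s T u" and C1: "C1_bounded T u"
    then have u: "coeff_solution s {-T<..<T} u" using is_solution_iff[OF assms] by blast
    obtain M where "\<And>t x. t \<in> {-T<..<T} \<Longrightarrow> cmod (fourier_eval (u t) x) + cmod (fourier_eval (dx (u t)) x) \<le> M"
      using C1 unfolding C1_bounded_def by blast
    then have M: "cmod (fourier_eval (dx (u t)) x) \<le> M" if "t \<in> {-T<..<T}" for t x
      using that by (smt (verit) norm_ge_zero)
    obtain B where "\<And>t. t \<in> {-T<..<T} \<Longrightarrow> l1n (dx (u t)) \<le> B"
      using C1_bound_imp_l1n_bound[OF assms T u M] by blast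
    then obtain R where "0 < R" "\<And>t. t \<in> {-T<..<T} \<Longrightarrow> nsq s (u t) \<le> R^2"
      using l1n_bound_imp_Hs_bound[OF assms T u] by blast
    then obtain T' w where "T < T'" "coeff_solution s {-T'<..<T'} w" "\<And>t. t \<in> {-T<..<T} \<Longrightarrow> w t = u t"
      using Hs_bound_imp_extension[OF assms T u] by blast
    then show "\<exists>T'>T. \<exists>w. is_solution s T' w \<and> (\<forall>t\<in>{-T<..<T}. w t = u t)"
      using is_solution_iff[OF assms] by blast
  qed
qed

end
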